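(* Let $(X,d)$ be a complete median metric space of finite rank. Let a topological group $G$ act on $X$ continuously by isometries. Then the Roller--Fioravanti compactification $X^{RF}$ is a Rosenthal representable $G$-system (with continuous action) and is dynamically $G$-tame.
   Context: A median metric space is a metric space $(X,d)$ such that for all $x,y,z\in X$ there is exactly one point $m(x,y,z)$ in $I(x,y)\cap I(y,z)\cap I(x,z)$, where $I(x,y)=\{p: d(x,p)+d(p,y)=d(x,y)\}$. With this $m$ and the metric topology, $X$ is a topological median algebra (a Hausdorff space with continuous median operation), with intervals $[x,y]=\{z: m(x,y,z)=z\}=I(x,y)$. The rank of $X$ is the supremum of the $n\in\mathbb N$ such that $\{0,1\}^n$ (with coordinatewise median) embeds in $X$ as a median subalgebra. Isometries of $X$ onto itself preserve $m$. A continuous action means that $G\times X\to X$ is jointly continuous. It is known that in a complete median metric space of finite rank all intervals are compact. Roller--Fioravanti compactification: let $\nu:X\to\prod_{(x,y)\in X\times X}[x,y]$, $\nu(z)=(m(x,y,z))_{x,y}$, with the product topology on the target, and let $X^{RF}$ be the closure of $\nu(X)$; $\nu$ is continuous and injective. Every $g\in G$ extends uniquely to a homeomorphism of $X^{RF}$ with $g\,\nu(z)=\nu(gz)$ for all $z\in X$ (explicitly $(g\xi)_{x,y}=g\,\xi_{g^{-1}x,g^{-1}y}$), which defines the canonical action of $G$ on $X^{RF}$. "With continuous action" means that $G\times X^{RF}\to X^{RF}$ is jointly continuous. A Banach space $V$ is Rosenthal if it contains no isomorphic copy of $\ell_1$. $\operatorname{Iso}(V)$ is the group of all linear onto isometries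 of $V$ with the strong operator topology. A $G$-space $K$ is Rosenthal representable if there are a Rosenthal Banach space $V$, a continuous homomorphism $h:G\to\operatorname{Iso}(V)$ and a $G$-equivariant topological embedding of $K$ into the dual unit ball $B_{V^*}$ with the weak-star topology, where $G$ acts by $(g\varphi)(v)=\varphi(h(g)^{-1}v)$. A sequence $(f_n)_{n\in\mathbb N}$ of bounded real functions on $K$ is independent if there are reals $a<b$ such that $\bigcap_{i\in P}f_i^{-1}(-\infty,a]\cap\bigcap_{j\in M}f_j^{-1}[b,\infty)\ne\varnothing$ for all finite disjoint $P,M\subset\mathbb N$. A compact $G$-system $K$ is (dynamically) tame if for every continuous $f:K\to\mathbb R$ the orbit $fG=\{x\mapsto f(gx): g\in G\}$ contains no infinite independent sequence. *)

theory Defs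
  imports "HOL-Analysis.Analysis" "HOL-Library.Extended_Nat"
    "HOL-Algebra.Module" "HOL-Algebra.Bij"
begin

section \<open>Median metric spaces and their rank\<close>

definition interval :: "'a::metric_space \<Rightarrow> 'a \<Rightarrow> 'a set" where
  "interval x y = {p. dist x p + dist p y = dist x y}"

definition median_space :: "'a::metric_space itself \<Rightarrow> bool" where
  "median_space (_ :: 'a itself) \<longleftrightarrow>
     (\<forall>x y z :: 'a. \<exists>!p. p \<in> interval x y \<inter> interval y z \<inter> interval x z)"

definition med :: "'a::metric_space \<Rightarrow> 'a \<Rightarrow> 'a \<Rightarrow> 'a" where
  "med x y z = (THE p. p \<in> interval x y \<inter> interval y z \<inter> interval x z)"

text \<open>The cube \<open>{0,1}\<^sup>n\<close> is \<open>{..<n} \<rightarrow>\<^sub>E UNIV\<close> with Boolean values; its median is the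
  coordinatewise majority.\<close>

definition cube_med :: "nat \<Rightarrow> (nat \<Rightarrow> bool) \<Rightarrow> (nat \<Rightarrow> bool) \<Rightarrow> (nat \<Rightarrow> bool) \<Rightarrow> nat \<Rightarrow> bool" where
  "cube_med n a b c = (\<lambda>i\<in>{..<n}. (a i \<and> b i) \<or> (b i \<and> c i) \<or> (a i \<and> c i))"

definition cube_embeds :: "nat \<Rightarrow> 'a::metric_space itself \<Rightarrow> bool" where
  "cube_embeds n (_ :: 'a itself) \<longleftrightarrow>
     (\<exists>\<iota> :: (nat \<Rightarrow> bool) \<Rightarrow> 'a. inj_on \<iota> ({..<n} \<rightarrow>\<^sub>E UNIV) \<and>
       (\<forall>a \<in> {..<n} \<rightarrow>\<^sub>E UNIV. \<forall>b \<in> {..<n} \<rightarrow>\<^sub>E UNIV. \<forall>c \<in> {..<n} \<rightarrow>\<^sub>E UNIV.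
          \<iota> (cube_med n a b c) = med (\<iota> a) (\<iota> b) (\<iota> c)))"

definition median_rank :: "'a::metric_space itself \<Rightarrow> enat" where
  "median_rank T = Sup (enat ` {n. cube_embeds n T})"


section \<open>Continuous actions\<close>

text \<open>The acting group is a type of class \<open>topological_group_add\<close>: this is the library class of
  arbitrary topological groups, written additively but not assumed commutative (nor Hausdorff).
  Thus \<open>0\<close> is the identity, \<open>g + h\<close> the product \<open>gh\<close> and \<open>- g\<close> the inverse of \<open>g\<close>.\<close>

definition continuous_action ::
    "('g::topological_group_add \<Rightarrow> 'k \<Rightarrow> 'k) \<Rightarrow> 'k topology \<Rightarrow> bool" where
  "continuous_action act K \<longleftrightarrow>
     (\<forall>x\<in>topspace K. act 0 x = x) \<and>
     (\<forall>g h. \<forall>x\<in>topspace K. act (g + h) x = act g (act h x)) \<and>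
     continuous_map (prod_topology euclidean K) K (\<lambda>(g, x). act g x)"

definition compact_G_system ::
    "('g::topological_group_add \<Rightarrow> 'k \<Rightarrow> 'k) \<Rightarrow> 'k topology \<Rightarrow> bool" where
  "compact_G_system act K \<longleftrightarrow> compact_space K \<and> continuous_action act K"


section \<open>The Roller--Fioravanti compactification\<close>

definition rf_map :: "'a::metric_space \<Rightarrow> 'a \<times> 'a \<Rightarrow> 'a" where
  "rf_map z = (\<lambda>(x, y). med x y z)"

definition interval_product :: "('a::metric_space \<times> 'a \<Rightarrow> 'a) topology" where
  "interval_product = product_topology (\<lambda>(x, y). top_of_set (interval x y)) UNIV"

definition rf_compactification :: "('a::metric_space \<times> 'a \<Rightarrow> 'a) topology" where
  "rf_compactification =
     subtopology interval_product (interval_product closure_of range rf_map)"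

definition rf_action ::
    "('g::topological_group_add \<Rightarrow> 'a \<Rightarrow> 'a) \<Rightarrow> 'g \<Rightarrow> ('a \<times> 'a \<Rightarrow> 'a) \<Rightarrow> 'a \<times> 'a \<Rightarrow> 'a" where
  "rf_action act g \<xi> = (\<lambda>(x, y). act g (\<xi> (act (- g) x, act (- g) y)))"

lemma rf_action_rf_map:
  fixes act :: "'g::topological_group_add \<Rightarrow> 'a::metric_space \<Rightarrow> 'a"
  assumes med: "median_space TYPE('a)" and act: "continuous_action act euclidean"
    and iso: "\<And>g x y. dist (act g x) (act g y) = dist x y"
  shows "rf_action act g (rf_map z) = rf_map (act g z)"
proof -
  have inv: "act g (act (- g) x) = x" for x
    using act unfolding continuous_action_def by (metis UNIV_I add.right_inverse topspace_euclidean)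
  have int: "act g p \<in> interval (act g x) (act g y) \<longleftrightarrow> p \<in> interval x y" for p x y
    by (simp add: interval_def iso)
  have the: "med a b c = p" if "p \<in> interval a b \<inter> interval b c \<inter> interval a c" for a b c p :: 'a
    unfolding med_def using med that unfolding median_space_def by (blast intro: the1_equality)
  have med_in: "med a b c \<in> interval a b \<inter> interval b c \<inter> interval a c" for a b c :: 'a
    using med the unfolding median_space_def by metis
  have "med (act g a) (act g b) (act g c) = act g (med a b c)" for a b c
    using med_in[of a b c] by (intro the) (simp add: int)
  from this[of "act (- g) _" "act (- g) _"] show ?thesis
    by (auto simp: rf_action_def rf_map_def inv)
qed


section \<open>Banach spaces on a carrier set\<close>

text \<open>A representing Banach space is existentially quantified below, so its structure is carried
  by a set rather than by a type. The ring multiplication and unit inherited from the record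
  \<open>module\<close> play no role.\<close>

record 'v normed_module = "(real, 'v) module" +
  nrm :: "'v \<Rightarrow> real"

definition real_ring :: "real ring" where
  "real_ring = \<lparr>carrier = UNIV, mult = (*), one = 1, zero = 0, add = (+)\<rparr>"

text \<open>The locale \<open>Metric_space\<close> asks for symmetry and nonnegativity off the carrier too, hence the
  value \<open>0\<close> there; it affects neither the topology nor completeness.\<close>

definition norm_dist :: "'v normed_module \<Rightarrow> 'v \<Rightarrow> 'v \<Rightarrow> real" where
  "norm_dist V v w =
     (if v \<in> carrier V \<and> w \<in> carrier V then nrm V (v \<ominus>\<^bsub>V\<^esub> w) else 0)"

definition norm_topology :: "'v normed_module \<Rightarrow> 'v topology" where
  "norm_topology V = Metric_space.mtopology (carrier V) (norm_dist V)"

definition banach_space :: "'v normed_module \<Rightarrow> bool" where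
  "banach_space V \<longleftrightarrow> Module.module real_ring V \<and>
     (\<forall>v\<in>carrier V. 0 \<le> nrm V v \<and> (nrm V v = 0 \<longleftrightarrow> v = \<zero>\<^bsub>V\<^esub>)) \<and>
     (\<forall>c. \<forall>v\<in>carrier V. nrm V (c \<odot>\<^bsub>V\<^esub> v) = \<bar>c\<bar> * nrm V v) \<and>
     (\<forall>v\<in>carrier V. \<forall>w\<in>carrier V. nrm V (v \<oplus>\<^bsub>V\<^esub> w) \<le> nrm V v + nrm V w) \<and>
     Metric_space.mcomplete (carrier V) (norm_dist V)"

definition ell1 :: "(nat \<Rightarrow> real) set" where
  "ell1 = {c. summable (\<lambda>n. \<bar>c n\<bar>)}"

definition ell1_norm :: "(nat \<Rightarrow> real) \<Rightarrow> real" where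
  "ell1_norm c = (\<Sum>n. \<bar>c n\<bar>)"

definition contains_ell1 :: "'v normed_module \<Rightarrow> bool" where
  "contains_ell1 V \<longleftrightarrow> (\<exists>T \<in> ell1 \<rightarrow> carrier V.
     (\<forall>c\<in>ell1. \<forall>d\<in>ell1. T (\<lambda>n. c n + d n) = T c \<oplus>\<^bsub>V\<^esub> T d) \<and>
     (\<forall>r. \<forall>c\<in>ell1. T (\<lambda>n. r * c n) = r \<odot>\<^bsub>V\<^esub> T c) \<and>
     (\<exists>m>0. \<exists>M. \<forall>c\<in>ell1. m * ell1_norm c \<le> nrm V (T c) \<and> nrm V (T c) \<le> M * ell1_norm c))"

definition rosenthal_space :: "'v normed_module \<Rightarrow> bool" where
  "rosenthal_space V \<longleftrightarrow> banach_space V \<and> \<not> contains_ell1 V"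

definition Iso :: "'v normed_module \<Rightarrow> ('v \<Rightarrow> 'v) set" where
  "Iso V = {T \<in> Bij (carrier V).
     (\<forall>v\<in>carrier V. \<forall>w\<in>carrier V. T (v \<oplus>\<^bsub>V\<^esub> w) = T v \<oplus>\<^bsub>V\<^esub> T w) \<and>
     (\<forall>c. \<forall>v\<in>carrier V. T (c \<odot>\<^bsub>V\<^esub> v) = c \<odot>\<^bsub>V\<^esub> T v) \<and>
     (\<forall>v\<in>carrier V. nrm V (T v) = nrm V v)}"

definition strong_topology :: "'v normed_module \<Rightarrow> ('v \<Rightarrow> 'v) topology" where
  "strong_topology V = subtopology (product_topology (\<lambda>_. norm_topology V) (carrier V)) (Iso V)"

text \<open>Functionals are extensional on the carrier, so that they are determined by their values
  there; the same convention is built into \<open>Bij\<close>.\<close>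

definition dual_ball :: "'v normed_module \<Rightarrow> ('v \<Rightarrow> real) set" where
  "dual_ball V = {\<phi> \<in> extensional (carrier V).
     (\<forall>v\<in>carrier V. \<forall>w\<in>carrier V. \<phi> (v \<oplus>\<^bsub>V\<^esub> w) = \<phi> v + \<phi> w) \<and>
     (\<forall>c. \<forall>v\<in>carrier V. \<phi> (c \<odot>\<^bsub>V\<^esub> v) = c * \<phi> v) \<and>
     (\<forall>v\<in>carrier V. \<bar>\<phi> v\<bar> \<le> nrm V v)}"

definition weak_star_ball :: "'v normed_module \<Rightarrow> ('v \<Rightarrow> real) topology" where
  "weak_star_ball V = subtopology (product_topology (\<lambda>_. euclideanreal) (carrier V)) (dual_ball V)"

definition dual_action :: "'v normed_module \<Rightarrow> ('v \<Rightarrow> 'v) \<Rightarrow> ('v \<Rightarrow> real) \<Rightarrow> 'v \<Rightarrow> real" where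
  "dual_action V T \<phi> = (\<lambda>v\<in>carrier V. \<phi> (inv_into (carrier V) T v))"


section \<open>Rosenthal representability and tameness\<close>

text \<open>HOL cannot quantify existentially over types, so the underlying set of \<open>V\<close> is taken inside
  the type \<open>'k \<Rightarrow> real\<close>. Up to isomorphism this is no restriction. Given a representation of \<open>K\<close>
  on any Rosenthal space \<open>W\<close>, with embedding \<open>e\<close>, let \<open>N\<close> be the closed invariant subspace of all
  \<open>w\<close> such that \<open>e x w = 0\<close> for all points \<open>x\<close> of \<open>K\<close>. Then \<open>W/N\<close> is again Rosenthal (a copy of
  \<open>\<ell>\<^sub>1\<close> in a quotient lifts), \<open>G\<close> acts on it by the induced isometries, \<open>K\<close> embeds in its dual ball
  (the annihilator of \<open>N\<close>), and \<open>w + N \<mapsto> (\<lambda>x. e x w)\<close> is injective into the functions on \<open>K\<close>.\<close>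

definition rosenthal_representable ::
    "('g::topological_group_add \<Rightarrow> 'k \<Rightarrow> 'k) \<Rightarrow> 'k topology \<Rightarrow> bool" where
  "rosenthal_representable act K \<longleftrightarrow>
     (\<exists>(V :: ('k \<Rightarrow> real) normed_module) h e.
        rosenthal_space V \<and>
        (\<forall>g g'. h (g + g') = compose (carrier V) (h g) (h g')) \<and>
        continuous_map euclidean (strong_topology V) h \<and>
        embedding_map K (weak_star_ball V) e \<and>
        (\<forall>g. \<forall>x\<in>topspace K. e (act g x) = dual_action V (h g) (e x)))"

definition independent_sequence :: "'k topology \<Rightarrow> (nat \<Rightarrow> 'k \<Rightarrow> real) \<Rightarrow> bool" where
  "independent_sequence K f \<longleftrightarrow> (\<exists>a b. a < b \<and>
     (\<forall>P M. finite P \<and> finite M \<and> P \<inter> M = {} \<longrightarrow>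
        (\<exists>x\<in>topspace K. (\<forall>i\<in>P. f i x \<le> a) \<and> (\<forall>j\<in>M. b \<le> f j x))))"

definition tame_system ::
    "('g::topological_group_add \<Rightarrow> 'k \<Rightarrow> 'k) \<Rightarrow> 'k topology \<Rightarrow> bool" where
  "tame_system act K \<longleftrightarrow> compact_G_system act K \<and>
     (\<forall>f. continuous_map K euclideanreal f \<longrightarrow>
        \<not> (\<exists>u. range u \<subseteq> {\<lambda>x. f (act g x) | g. True} \<and> independent_sequence K u))"

end

theory Submission
  imports Defs
begin

text \<open>
  Halfspaces separate the points of a median space, so an interval is a ring of sets, and the
  distance from one endpoint is a finitely additive mass on it. If cubes have dimension at most
  \<open>n\<close>, then for finitely many points of the interval the traces of halfspaces have no antichain of
  size \<open>n + 1\<close>; hence some chain of traces carries a proportion \<open>1/n\<close> of the mass. By compactness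
  this yields a Lipschitz median homomorphism from the whole interval into the real line.
  Splitting off such homomorphisms repeatedly shows that intervals are compact, and composing them
  with the coordinates of the compactification shows that the set \<open>F\<close> of continuous
  \<open>[-1,1]\<close>-valued functions that are median homomorphisms on \<open>X\<close> separates points.

  Superlevel sets of members of \<open>F\<close> are halfspaces, of which at most \<open>n\<close> can be shattered. By
  Sauer--Shelah the covering numbers of finite subfamilies of \<open>F\<close> grow polynomially. This rules out
  independent orbits, and by Chernoff's bound it rules out \<open>\<ell>\<^sub>1\<close>-sequences in the convex hull
  \<open>W\<close> of \<open>F\<close>. The Davis--Figiel--Johnson--Pelczynski interpolation between \<open>W\<close> and the supremum
  norm then gives a Banach space without copies of \<open>\<ell>\<^sub>1\<close>, on which the group acts and in whose
  dual ball the compactification embeds by evaluation.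
\<close>

section \<open>Median operations and gates\<close>

text \<open>The rank enters only through \<open>cube_embedsI\<close>: \<open>k\<close> halfspaces
  separating one pair of points, each with a private point lying in it and in no other, force a
  \<open>k\<close>-cube. An antichain of traces yields such points, and so does a shattered set, so
  one criterion serves both the chain argument and Sauer--Shelah.

  Neither \<open>X\<close> nor its compactification is assumed separable or metrizable, so nothing
  is extracted from sequences; finite families are counted instead. The resulting sign estimate
  holds with an \<open>N\<close> that depends only on the tolerance, and therefore survives convex
  combinations, bounded multiples and uniform errors, which are exactly what the interpolation adds
  to the hull.

  The estimate makes sign sums small in the supremum norm only, and translations are seen to be
  continuous only there. The space therefore consists of functions whose gauges tend to
  \<open>0\<close>: high gauges are small by membership, low gauges are bounded by the supremum
  norm. This one split of the indices gives both the strong continuity of the action and the gliding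
  hump.\<close>

lemma mem_interval: "p \<in> interval x y \<longleftrightarrow> dist x p + dist p y = dist x y"
  by (simp add: interval_def)

lemma interval_commute: "interval x y = interval y x"
  by (auto simp: interval_def dist_commute add.commute)

lemma interval_left [simp]: "x \<in> interval x y" and interval_right [simp]: "y \<in> interval x y"
  by (simp_all add: mem_interval)

lemma interval_sym: "p \<in> interval x y \<Longrightarrow> p \<in> interval y x"
  by (simp add: interval_commute)

lemma interval_self [simp]: "interval x x = {x}"
proof -
  have "p = x" if "p \<in> interval x x" for p
  proof -
    have "dist x p = 0"
      using that zero_le_dist[of x p] dist_commute[of p x] dist_self[of x]
      unfolding mem_interval by linarith
    then show ?thesis by simp
  qed
  then show ?thesis by auto
qed

lemma interval_trans:
  assumes "c \<in> interval a b" "d \<in> interval a c"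
  shows "d \<in> interval a b" "c \<in> interval d b"
  using assms dist_triangle[of a b d] dist_triangle[of d b c] unfolding mem_interval by linarith+

lemma interval_trans_right:
  assumes "c \<in> interval a b" "d \<in> interval c b"
  shows "d \<in> interval a b" "c \<in> interval a d"
  using interval_trans[of c b a d] assms by (simp_all add: interval_commute)

lemma interval_antisym:
  assumes "p \<in> interval x q" "q \<in> interval x p"
  shows "p = q"
proof -
  have "dist p q = 0"
    using assms dist_commute[of p q] zero_le_dist[of p q] unfolding mem_interval by linarith
  then show ?thesis by simp
qed

locale median_metric =
  fixes ty :: "'a::metric_space itself"
  assumes median_space: "median_space ty"
begin

lemma ex1_med: "\<exists>!p::'a. p \<in> interval x y \<inter> interval y z \<inter> interval x z"
  using median_space by (simp add: median_space_def)

lemma med_unique: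
  fixes p :: 'a
  assumes "p \<in> interval x y" "p \<in> interval y z" "p \<in> interval x z"
  shows "med x y z = p"
  unfolding med_def by (rule the1_equality[OF ex1_med]) (simp add: assms)

lemma med_mem:
  shows "med x y z \<in> interval x (y::'a)" "med x y z \<in> interval y z" "med x y z \<in> interval x z"
    "med x y z \<in> interval y x" "med x y z \<in> interval z y" "med x y z \<in> interval z x"
proof -
  have "med x y z \<in> interval x y \<inter> interval y z \<inter> interval x z"
    unfolding med_def by (rule theI'[OF ex1_med])
  then show "med x y z \<in> interval x y" "med x y z \<in> interval y z" "med x y z \<in> interval x z"
    "med x y z \<in> interval y x" "med x y z \<in> interval z y" "med x y z \<in> interval z x"
    by (blast intro: interval_sym)+
qed

lemma med_commute: "med x y z = med y x (z::'a)" "med x y z = med x z (y::'a)"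
  by (rule med_unique; rule med_mem)+

lemma med_rotate: "med x y z = med y z (x::'a)"
  using med_commute(1)[of x y z] med_commute(2)[of y x z] by simp

lemma med_eq_iff: "med x y p = (p::'a) \<longleftrightarrow> p \<in> interval x y"
  using med_mem(1)[of x y p] by (auto intro: med_unique)

lemma med_idem [simp]: "med x x y = (x::'a)" "med x y x = (x::'a)" "med y x x = (x::'a)"
  by (rule med_unique; simp)+

text \<open>The medians \<open>u\<close> and \<open>v\<close> pull \<open>a\<close> and
  \<open>b\<close> into \<open>interval z w\<close>; the median \<open>t\<close> of
  \<open>u\<close>, \<open>v\<close> and \<open>z\<close> already lies in the three intervals that
  characterize \<open>med a b z\<close>. So \<open>med a b z\<close> is the gate of the interval,
  met on the way from \<open>z\<close> to any of its points.\<close>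

lemma med_gate:
  fixes w :: 'a
  assumes "w \<in> interval a b"
  shows "med a b z \<in> interval z w"
proof -
  define u where "u = med z w a"
  define v where "v = med z w b"
  define t where "t = med u v z"
  have u: "u \<in> interval z w" "u \<in> interval w a" "u \<in> interval z a"
    unfolding u_def by (rule med_mem)+
  have v: "v \<in> interval z w" "v \<in> interval w b" "v \<in> interval z b"
    unfolding v_def by (rule med_mem)+
  have t: "t \<in> interval u v" "t \<in> interval v z" "t \<in> interval u z"
    unfolding t_def by (rule med_mem)+
  have "u \<in> interval a b" "w \<in> interval u b"
    using interval_trans[OF assms interval_sym[OF u(2)]] by simp_all
  then have "v \<in> interval u b"
    using interval_trans_right(1)[OF _ v(2)] by blast
  then have "t \<in> interval u b" by (rule interval_trans(1)[OF _ t(1)])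
  then have "t \<in> interval a b"
    by (rule interval_trans_right(1)[OF \<open>u \<in> interval a b\<close>])
  moreover have "t \<in> interval z a"
    by (rule interval_trans(1)[OF u(3) interval_sym[OF t(3)]])
  moreover have "t \<in> interval z b"
    by (rule interval_trans(1)[OF v(3) interval_sym[OF t(2)]])
  ultimately have "med a b z = t"
    by (auto intro!: med_unique interval_sym[of t z])
  then show ?thesis
    using interval_trans(1)[OF u(1) interval_sym[OF t(3)]] by simp
qed

lemma gate_unique:
  fixes g :: 'a
  assumes "g \<in> interval a b" "\<And>w. w \<in> interval a b \<Longrightarrow> g \<in> interval z w"
  shows "med a b z = g"
  using assms by (auto intro!: med_unique interval_sym[of g z])

text \<open>With \<open>g\<close> the gate of \<open>z\<close> in \<open>interval a b\<close>, going
  from \<open>x\<close> to \<open>y\<close> through \<open>z\<close> is longer by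
  \<open>2 * dist z g\<close> than going through \<open>g\<close>; for \<open>z\<close> between
  \<open>x\<close> and \<open>y\<close> this forces \<open>g = z\<close>.\<close>

lemma interval_convex:
  fixes x :: 'a
  assumes "x \<in> interval a b" "y \<in> interval a b"
  shows "interval x y \<subseteq> interval a b"
proof
  fix z assume z: "z \<in> interval x y"
  define g where "g = med a b z"
  have "g \<in> interval z x" "g \<in> interval z y"
    unfolding g_def by (intro med_gate assms)+
  then have "dist z g = 0"
    using z dist_triangle[of x y g] zero_le_dist[of z g] dist_commute[of z x] dist_commute[of g x]
    unfolding mem_interval by linarith
  then have "g = z" by simp
  then show "z \<in> interval a b"
    using med_mem(1)[of a b z] by (simp flip: g_def)
qed

lemma dist_med_le: "dist (med a b x) (med a b y) \<le> dist x (y::'a)"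
proof -
  have "med a b x \<in> interval x (med a b y)" "med a b y \<in> interval y (med a b x)"
    by (intro med_gate med_mem)+
  then show ?thesis
    using dist_triangle[of x "med a b y" y] dist_triangle[of y "med a b x" x]
    unfolding mem_interval by (simp add: dist_commute)
qed

lemma med_med_interval:
  fixes x :: 'a
  assumes "x \<in> interval a b" "y \<in> interval a b"
  shows "med x y (med a b z) = med x y z"
proof -
  have *: "med x y (med a b z) \<in> interval x y" by (rule med_mem)
  show ?thesis
  proof (rule gate_unique[symmetric, OF *])
    fix w assume w: "w \<in> interval x y"
    then have "w \<in> interval a b" using interval_convex assms by blast
    then have 1: "med a b z \<in> interval z w" by (rule med_gate)
    have "med x y (med a b z) \<in> interval (med a b z) w"
      using w by (rule med_gate)
    then show "med x y (med a b z) \<in> interval z w"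
      by (rule interval_trans_right(1)[OF 1])
  qed
qed

text \<open>This gives distributivity: projections to intervals are median homomorphisms. The point
  \<open>w\<close>, which lies between the two projected endpoints, turns out to be
  \<open>g\<close>. The gate property puts \<open>g\<close> between \<open>z\<close> and
  \<open>w\<close>; comparison with \<open>r\<close>, the gate of \<open>g\<close> in
  \<open>interval x y\<close>, puts \<open>w\<close> between \<open>g\<close> and
  \<open>z\<close>.\<close>

lemma med_interval_interval:
  fixes x :: 'a
  assumes z: "z \<in> interval x y"
  shows "med a b z \<in> interval (med a b x) (med a b y)"
proof -
  define g where "g = med a b z"
  define u where "u = med a b x"
  define v where "v = med a b y"
  define w where "w = med u v z"
  define r where "r = med x y g"
  have uv: "u \<in> interval a b" "v \<in> interval a b" "g \<in> interval a b"
    unfolding u_def v_def g_def by (rule med_mem)+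
  have w: "w = med u v g"
    unfolding w_def g_def using med_med_interval[OF uv(1,2)] by simp
  have "w \<in> interval a b"
    using interval_convex[OF uv(1,2)] med_mem(1) w_def by blast
  then have gw: "g \<in> interval z w"
    unfolding g_def by (rule med_gate)
  have ux: "u \<in> interval x g" and vy: "v \<in> interval y g"
    unfolding u_def v_def by (rule med_gate[OF uv(3)])+
  have "w \<in> interval u g" "w \<in> interval v g"
    unfolding w by (rule med_mem)+
  then have wx: "w \<in> interval g x" and wy: "w \<in> interval g y"
    by (blast intro: interval_sym interval_trans_right(1) ux vy)+
  define s where "s = med w x y"
  have s: "s \<in> interval w x" "s \<in> interval x y" "s \<in> interval w y"
    unfolding s_def by (rule med_mem)+
  have "s \<in> interval g x" "s \<in> interval g y"
    by (blast intro: interval_trans_right(1) s wx wy)+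
  then have "r = s"
    unfolding r_def using s(2) by (auto intro!: med_unique intro: interval_sym)
  then have "w \<in> interval g r"
    using interval_trans_right(2)[OF wx s(1)] by simp
  moreover have "r \<in> interval g z"
    unfolding r_def using z by (rule med_gate)
  ultimately have "w \<in> interval g z"
    by (rule interval_trans(1)[rotated])
  then have "g = w"
    using gw by (blast intro: interval_antisym interval_sym)
  then show ?thesis
    using med_mem(1)[of u v z] by (simp add: w_def g_def u_def v_def)
qed

lemma med_distrib: "med a b (med x y z) = med (med a b x) (med a b y) (med a b (z::'a))"
  by (rule med_unique[symmetric]; rule med_interval_interval; rule med_mem)

lemma dist_med_left: "dist (med x y z) (med x' y z) \<le> dist x (x'::'a)"
  using dist_med_le[of y z x x'] by (simp add: med_rotate[of _ y z])

lemma dist_med_both: "dist (med x y z) (med x' y' z) \<le> dist x x' + dist y (y'::'a)"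
proof -
  have "dist (med x y z) (med x' y z) \<le> dist x x'" "dist (med x' y z) (med x' y' z) \<le> dist y y'"
    using dist_med_left[of x y z x'] dist_med_left[of y x' z y'] by (simp_all add: med_commute(1)[of x'])
  then show ?thesis
    using dist_triangle[of "med x y z" "med x' y' z" "med x' y z"] by linarith
qed

end

section \<open>Halfspaces and cubes\<close>

definition geodesic_convex :: "'a::metric_space set \<Rightarrow> bool" where
  "geodesic_convex C \<longleftrightarrow> (\<forall>x\<in>C. \<forall>y\<in>C. interval x y \<subseteq> C)"

definition halfspace :: "'a::metric_space set \<Rightarrow> bool" where
  "halfspace H \<longleftrightarrow> geodesic_convex H \<and> geodesic_convex (- H)"

lemma halfspace_Compl [simp]: "halfspace (- H) \<longleftrightarrow> halfspace H"
  by (auto simp: halfspace_def)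

context median_metric
begin

lemma halfspace_med:
  fixes H :: "'a set"
  assumes "halfspace H"
  shows "med a b c \<in> H \<longleftrightarrow> a \<in> H \<and> b \<in> H \<or> b \<in> H \<and> c \<in> H \<or> a \<in> H \<and> c \<in> H"
  using assms med_mem[of a b c] unfolding halfspace_def geodesic_convex_def
  by (metis ComplD ComplI subsetD)

lemma halfspaceI:
  fixes H :: "'a set"
  assumes "\<And>a b c. a \<in> H \<Longrightarrow> b \<in> H \<Longrightarrow> med a b c \<in> H"
    and "\<And>a b c. a \<notin> H \<Longrightarrow> b \<notin> H \<Longrightarrow> med a b c \<notin> H"
  shows "halfspace H"
  using assms unfolding halfspace_def geodesic_convex_def by (metis ComplD ComplI med_eq_iff subsetI)

text \<open>The point of \<open>C\<close> whose interval to \<open>a\<close> contains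
  \<open>z\<close> is \<open>h\<close>, the projection of \<open>z\<close> to
  \<open>interval h1 h2\<close>. By distributivity \<open>med a z h\<close> is the median of
  \<open>\<alpha>\<close>, \<open>\<beta>\<close> and \<open>z\<close>, and it equals
  \<open>z\<close> because \<open>z\<close> lies between \<open>\<alpha>\<close> and
  \<open>\<beta>\<close>.\<close>

lemma geodesic_convex_join:
  fixes C :: "'a set"
  assumes C: "geodesic_convex C"
  shows "geodesic_convex (\<Union>h\<in>C. interval h a)"
  unfolding geodesic_convex_def
proof (intro ballI subsetI)
  fix z1 z2 z assume "z1 \<in> (\<Union>h\<in>C. interval h a)" "z2 \<in> (\<Union>h\<in>C. interval h a)"
    and z: "z \<in> interval z1 z2"
  then obtain h1 h2 where h: "h1 \<in> C" "h2 \<in> C" "z1 \<in> interval h1 a" "z2 \<in> interval h2 a"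
    by blast
  define h where "h = med h1 h2 z"
  have hC: "h \<in> C"
    using C h(1,2) med_mem(1)[of h1 h2 z] unfolding geodesic_convex_def h_def by blast
  define \<alpha> where "\<alpha> = med a z h1"
  define \<beta> where "\<beta> = med a z h2"
  define u where "u = med a z z1"
  define w where "w = med a z z2"
  have "u \<in> interval \<alpha> (med a z a)" "w \<in> interval \<beta> (med a z a)"
    unfolding u_def w_def \<alpha>_def \<beta>_def by (intro med_interval_interval h)+
  then have u: "u \<in> interval a \<alpha>" and w: "w \<in> interval a \<beta>"
    by (simp_all add: interval_commute)
  have "\<alpha> \<in> interval a z" "\<beta> \<in> interval a z"
    unfolding \<alpha>_def \<beta>_def by (rule med_mem)+
  then have \<alpha>: "\<alpha> \<in> interval u z" and \<beta>: "\<beta> \<in> interval w z"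
    using u w interval_trans(2) by blast+
  have "med a z z \<in> interval u w"
    unfolding u_def w_def by (intro med_interval_interval z)
  then have "z \<in> interval u w" by simp
  then have "z \<in> interval \<alpha> w"
    using \<alpha> interval_trans(2) by blast
  then have "z \<in> interval \<beta> \<alpha>"
    using interval_sym[OF \<beta>] interval_trans(2)[of z w \<alpha> \<beta>] \<beta> by (auto intro: interval_sym)
  then have "med \<alpha> \<beta> z = z"
    by (simp add: med_eq_iff interval_commute)
  moreover have "med a z h = med \<alpha> \<beta> z"
    unfolding h_def \<alpha>_def \<beta>_def by (simp add: med_distrib[of a z])
  ultimately have "z \<in> interval h a"
    using med_mem(6)[of a z h] by simp
  with hC show "z \<in> (\<Union>h\<in>C. interval h a)" by blast
qed

text \<open>A convex set that is maximal among those containing \<open>x\<close> and missing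
  \<open>y\<close> has a convex complement. By maximality its join with any outside point reaches
  \<open>y\<close>; for two outside points the witnesses \<open>h\<close> and \<open>h'\<close>
  merge into one point \<open>k\<close> of the set, and then \<open>y\<close> lies between
  \<open>k\<close> and everything between the two.\<close>

lemma halfspace_separation:
  fixes x y :: 'a
  assumes "x \<noteq> y"
  obtains H where "halfspace H" "x \<notin> H" "y \<in> H"
proof -
  define A where "A = {C. geodesic_convex C \<and> x \<in> C \<and> y \<notin> C}"
  have "\<exists>M\<in>A. \<forall>X\<in>A. M \<subseteq> X \<longrightarrow> X = M"
  proof (rule subset_Zorn_nonempty)
    have "{x} \<in> A" using assms by (auto simp: A_def geodesic_convex_def)
    then show "A \<noteq> {}" by blast
  next
    fix \<C> assume \<C>: "\<C> \<noteq> {}" "subset.chain A \<C>"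
    have "geodesic_convex (\<Union>\<C>)"
      unfolding geodesic_convex_def
    proof (intro ballI)
      fix a b assume "a \<in> \<Union>\<C>" "b \<in> \<Union>\<C>"
      then obtain C where "C \<in> \<C>" "a \<in> C" "b \<in> C"
        using \<C>(2) unfolding subset_chain_def by (metis UnionE subsetD)
      then show "interval a b \<subseteq> \<Union>\<C>"
        using \<C>(2) unfolding subset_chain_def A_def geodesic_convex_def by blast
    qed
    then show "\<Union>\<C> \<in> A"
      using \<C> unfolding A_def subset_chain_def by auto
  qed
  then obtain M where M: "geodesic_convex M" "x \<in> M" "y \<notin> M"
    and max: "\<And>X. X \<in> A \<Longrightarrow> M \<subseteq> X \<Longrightarrow> X = M"
    unfolding A_def by blast
  have y_join: "\<exists>h\<in>M. y \<in> interval h a" if "a \<notin> M" for a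
  proof (rule ccontr)
    define J where "J = (\<Union>h\<in>M. interval h a)"
    assume "\<not> (\<exists>h\<in>M. y \<in> interval h a)"
    then have "y \<notin> J" by (auto simp: J_def)
    moreover have "M \<subseteq> J" "a \<in> J"
      using M(2) by (auto simp: J_def)
    moreover have "geodesic_convex J"
      unfolding J_def by (rule geodesic_convex_join[OF M(1)])
    ultimately have "J = M"
      using M(2) by (intro max) (auto simp: A_def)
    with \<open>a \<in> J\<close> that show False by simp
  qed
  have "geodesic_convex (- M)"
    unfolding geodesic_convex_def
  proof (intro ballI subsetI)
    fix a b c assume ab: "a \<in> - M" "b \<in> - M" and c: "c \<in> interval a b"
    show "c \<in> - M"
    proof
      assume cM: "c \<in> M"
      from ab obtain h h' where h: "h \<in> M" "y \<in> interval h a" "h' \<in> M" "y \<in> interval h' b"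
        using y_join by (metis ComplD)
      define k where "k = med h h' y"
      have kM: "k \<in> M"
        using M(1) h(1,3) med_mem(1)[of h h' y] unfolding geodesic_convex_def k_def by blast
      have "med y a h = y" "med y b h' = y"
        using h(2,4) by (metis med_eq_iff med_rotate med_commute(1))+
      then have "med y a k = y" "med y b k = y"
        unfolding k_def by (simp_all add: med_distrib[of y])
      then have "med y k a = y" "med y k b = y"
        by (simp_all add: med_commute(2)[of y k])
      then have "med y k (med a b c) = y"
        by (simp add: med_distrib[of y k])
      then have "med y k c = y"
        using c by (simp add: med_eq_iff[THEN iffD2])
      then have "y \<in> interval k c"
        using med_mem(2)[of y k c] by simp
      then show False
        using M(1,3) kM cM unfolding geodesic_convex_def by blast
    qed
  qed
  then have "halfspace (- M)" using M(1) by (simp add: halfspace_def)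
  then show ?thesis using M that[of "- M"] by simp
qed

text \<open>The halfspaces separating \<open>p\<close> from \<open>q\<close> turn the interval into a ring of sets.\<close>

definition separating :: "'a \<Rightarrow> 'a \<Rightarrow> 'a set set" where
  "separating p q = {H. halfspace H \<and> p \<notin> H \<and> q \<in> H}"

lemma separatingD: "H \<in> separating p q \<Longrightarrow> halfspace H" "H \<in> separating p q \<Longrightarrow> p \<notin> H"
  "H \<in> separating p q \<Longrightarrow> q \<in> H"
  by (simp_all add: separating_def)

lemma separating_med_left: "H \<in> separating p q \<Longrightarrow> med p x y \<in> H \<longleftrightarrow> x \<in> H \<and> y \<in> H"
  and separating_med_right: "H \<in> separating p q \<Longrightarrow> med q x y \<in> H \<longleftrightarrow> x \<in> H \<or> y \<in> H"
  and separating_proj: "H \<in> separating p q \<Longrightarrow> med p q x \<in> H \<longleftrightarrow> x \<in> H"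
  by (auto simp: separating_def halfspace_med)

text \<open>A halfspace containing both or neither of \<open>p\<close> and \<open>q\<close> treats
  all points of the interval alike, so one that tells \<open>x\<close> from \<open>y\<close>
  separates \<open>p\<close> from \<open>q\<close> up to complement. Identities between medians in
  the interval can hence be checked one halfspace at a time, as Boolean identities.\<close>

lemma interval_eqI:
  assumes "x \<in> interval p q" "y \<in> interval p q"
    and "\<And>H. H \<in> separating p q \<Longrightarrow> x \<in> H \<longleftrightarrow> y \<in> H"
  shows "x = y"
proof (rule ccontr)
  assume "x \<noteq> y"
  then obtain H where H: "halfspace H" "x \<notin> H" "y \<in> H" by (rule halfspace_separation)
  have xy: "med p q x = x" "med p q y = y" using assms(1,2) by (simp_all add: med_eq_iff)
  then have "p \<in> H \<and> q \<notin> H \<or> p \<notin> H \<and> q \<in> H"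
    using H halfspace_med[OF H(1), of p q x] halfspace_med[OF H(1), of p q y] by auto
  then show False
  proof
    assume "p \<in> H \<and> q \<notin> H"
    then have "- H \<in> separating p q" using H by (simp add: separating_def)
    with assms(3)[of "- H"] H show False by simp
  next
    assume "p \<notin> H \<and> q \<in> H"
    then have "H \<in> separating p q" using H by (simp add: separating_def)
    with assms(3)[of H] H show False by simp
  qed
qed

lemma med_endpoint_mem:
  assumes "x \<in> interval p (q::'a)" "y \<in> interval p q"
  shows "med p x y \<in> interval p q" "med q x y \<in> interval p q"
  using interval_convex[OF assms] med_mem(2) by blast+

lemma interval_le_iff:
  assumes "x \<in> interval p (q::'a)" "y \<in> interval p q"
  shows "x \<in> interval p y \<longleftrightarrow> (\<forall>H\<in>separating p q. x \<in> H \<longrightarrow> y \<in> H)"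
proof -
  have "x \<in> interval p y \<longleftrightarrow> med p y x = x" by (simp add: med_eq_iff)
  also have "\<dots> \<longleftrightarrow> (\<forall>H\<in>separating p q. med p y x \<in> H \<longleftrightarrow> x \<in> H)"
    using interval_eqI[OF med_endpoint_mem(1)[OF assms(2,1)] assms(1)] by auto
  finally show ?thesis by (auto simp: separating_med_left)
qed

lemma finite_meet:
  assumes "finite S" "S \<subseteq> interval p (q::'a)"
  shows "\<exists>x\<in>interval p q. \<forall>H\<in>separating p q. x \<in> H \<longleftrightarrow> S \<subseteq> H"
  using assms
proof (induction S)
  case empty
  show ?case by (rule bexI[of _ q]) (auto dest: separatingD)
next
  case (insert z S)
  then obtain x where x: "x \<in> interval p q" "\<forall>H\<in>separating p q. x \<in> H \<longleftrightarrow> S \<subseteq> H" by auto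
  then show ?case
    using insert.prems by (intro bexI[of _ "med p z x"]) (auto simp: separating_med_left med_endpoint_mem)
qed

lemma finite_join:
  assumes "finite S" "S \<subseteq> interval p (q::'a)"
  shows "\<exists>x\<in>interval p q. \<forall>H\<in>separating p q. x \<in> H \<longleftrightarrow> S \<inter> H \<noteq> {}"
  using assms
proof (induction S)
  case empty
  show ?case by (rule bexI[of _ p]) (auto dest: separatingD)
next
  case (insert z S)
  then obtain x where x: "x \<in> interval p q" "\<forall>H\<in>separating p q. x \<in> H \<longleftrightarrow> S \<inter> H \<noteq> {}" by auto
  then show ?case
    using insert.prems by (intro bexI[of _ "med q z x"]) (auto simp: separating_med_right med_endpoint_mem)
qed

text \<open>A halfspace containing two of the projected points \<open>c i\<close> would read a
  disjunction of coordinates, which is not compatible with majority. Joining \<open>b\<close>, the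
  join of all pairwise meets, to every vertex puts all vertices into such a halfspace. After that
  each halfspace is constant on the vertices or reads a single coordinate, and \<open>H l\<close>
  reads the coordinate \<open>l\<close>.\<close>

lemma cube_embedsI:
  fixes e :: "nat \<Rightarrow> 'a"
  assumes H: "\<And>l. l < k \<Longrightarrow> H l \<in> separating p q"
    and eH: "\<And>i l. i < k \<Longrightarrow> l < k \<Longrightarrow> e i \<in> H l \<longleftrightarrow> i = l"
  shows "cube_embeds k ty"
proof -
  define c where "c i = med p q (e i)" for i
  have c: "c i \<in> interval p q" for i by (simp add: c_def med_mem)
  define I where "I H = {i. i < k \<and> c i \<in> H}" for H
  have b_ex: "\<exists>b\<in>interval p q. \<forall>H\<in>separating p q. b \<in> H \<longleftrightarrow>
      (\<lambda>(i, j). med p (c i) (c j)) ` {(i, j). i < k \<and> j < k \<and> i \<noteq> j} \<inter> H \<noteq> {}"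
  proof (rule finite_join)
    have "{(i, j). i < k \<and> j < k \<and> i \<noteq> j} \<subseteq> {..<k} \<times> {..<k}" by auto
    then show "finite ((\<lambda>(i, j). med p (c i) (c j)) ` {(i, j). i < k \<and> j < k \<and> i \<noteq> j})"
      by (meson finite_SigmaI finite_imageI finite_lessThan finite_subset)
    show "(\<lambda>(i, j). med p (c i) (c j)) ` {(i, j). i < k \<and> j < k \<and> i \<noteq> j} \<subseteq> interval p q"
      using c med_endpoint_mem by auto
  qed
  then obtain b where b: "b \<in> interval p q"
    "\<And>H. H \<in> separating p q \<Longrightarrow> b \<in> H \<longleftrightarrow> (\<exists>i\<in>I H. \<exists>j\<in>I H. i \<noteq> j)"
    unfolding I_def by (fastforce simp: separating_med_left)
  have "\<exists>x\<in>interval p q. \<forall>H\<in>separating p q. x \<in> H \<longleftrightarrow> insert b (c ` {i. i < k \<and> a i}) \<inter> H \<noteq> {}" for a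
    using b(1) c by (intro finite_join) auto
  then obtain \<iota> where \<iota>: "\<And>a. \<iota> a \<in> interval p q"
    "\<And>a H. H \<in> separating p q \<Longrightarrow> \<iota> a \<in> H \<longleftrightarrow> insert b (c ` {i. i < k \<and> a i}) \<inter> H \<noteq> {}"
    by metis
  have mem: "\<iota> a \<in> H \<longleftrightarrow> (\<exists>i\<in>I H. \<exists>j\<in>I H. i \<noteq> j) \<or> (\<exists>i\<in>I H. a i)" if "H \<in> separating p q" for a H
    unfolding \<iota>(2)[OF that] using b(2)[OF that] by (auto simp: I_def)
  have IH: "I (H l) = {l}" if "l < k" for l
    using that eH H by (auto simp: I_def c_def separating_proj)
  show ?thesis
    unfolding cube_embeds_def
  proof (intro exI[of _ \<iota>] conjI ballI)
    show "inj_on \<iota> ({..<k} \<rightarrow>\<^sub>E UNIV)"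
    proof (rule inj_onI)
      fix x y assume xy: "x \<in> {..<k} \<rightarrow>\<^sub>E (UNIV::bool set)" "y \<in> {..<k} \<rightarrow>\<^sub>E (UNIV::bool set)" "\<iota> x = \<iota> y"
      show "x = y"
      proof (rule PiE_ext[OF xy(1,2)])
        fix l assume "l \<in> {..<k}"
        then show "x l = y l"
          using mem[OF H, of l x] mem[OF H, of l y] IH[of l] xy(3) by simp
      qed
    qed
  next
    fix x y z assume "x \<in> {..<k} \<rightarrow>\<^sub>E (UNIV::bool set)" "y \<in> {..<k} \<rightarrow>\<^sub>E (UNIV::bool set)"
      "z \<in> {..<k} \<rightarrow>\<^sub>E (UNIV::bool set)"
    show "\<iota> (cube_med k x y z) = med (\<iota> x) (\<iota> y) (\<iota> z)"
    proof (rule interval_eqI[where p = p and q = q])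
      show "\<iota> (cube_med k x y z) \<in> interval p q" by (rule \<iota>)
      show "med (\<iota> x) (\<iota> y) (\<iota> z) \<in> interval p q"
        using interval_convex[OF \<iota>(1) \<iota>(1)] med_mem(1) by blast
      fix J assume J: "J \<in> separating p q"
      have lt: "i < k" if "i \<in> I J" for i using that by (simp add: I_def)
      show "\<iota> (cube_med k x y z) \<in> J \<longleftrightarrow> med (\<iota> x) (\<iota> y) (\<iota> z) \<in> J"
        unfolding halfspace_med[OF separatingD(1)[OF J]] mem[OF J] cube_med_def
        using lt by (auto; metis)
    qed
  qed
qed

end

section \<open>Valuations on intervals and chains of halfspaces\<close>

text \<open>Lowering all weights of minimal elements by the same amount lowers the weight of every
  maximal chain by that amount, and the total by at most \<open>n\<close> times it.\<close>

lemma sum_le_width_times_chain: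
  fixes w :: "'b set \<Rightarrow> real"
  assumes "finite \<S>" and "\<And>S. S \<in> \<S> \<Longrightarrow> 0 \<le> w S"
    and width: "\<And>A. A \<subseteq> \<S> \<Longrightarrow> (\<And>S T. S \<in> A \<Longrightarrow> T \<in> A \<Longrightarrow> S \<subseteq> T \<Longrightarrow> S = T) \<Longrightarrow> card A \<le> n"
    and "\<And>C. C \<subseteq> \<S> \<Longrightarrow> (\<And>S T. S \<in> C \<Longrightarrow> T \<in> C \<Longrightarrow> S \<subseteq> T \<or> T \<subseteq> S) \<Longrightarrow> sum w C \<le> W"
  shows "sum w \<S> \<le> real n * W"
  using assms(2,4)
proof (induction "card {S \<in> \<S>. 0 < w S}" arbitrary: w W rule: less_induct)
  case less
  note fin = \<open>finite \<S>\<close>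
  define P where "P = {S \<in> \<S>. 0 < w S}"
  have W0: "0 \<le> W" using less.prems(2)[of "{}"] by simp
  have finP: "finite P" using fin by (simp add: P_def)
  show ?case
  proof (cases "P = {}")
    case True
    then have "w S = 0" if "S \<in> \<S>" for S
      using less.prems(1)[OF that] that by (force simp: P_def)
    then show ?thesis using W0 by simp
  next
    case False
    define A where "A = {S \<in> P. \<forall>T\<in>P. T \<subseteq> S \<longrightarrow> T = S}"
    have below: "\<exists>a\<in>A. a \<subseteq> S" if S: "S \<in> P" for S
    proof -
      obtain a where "a \<in> P" "a \<subseteq> S" "\<And>T. T \<in> P \<Longrightarrow> T \<subseteq> a \<Longrightarrow> a = T"
        using finite_has_minimal2[OF finP S] by blast
      then show ?thesis by (auto simp: A_def)
    qed
    have AP: "A \<subseteq> P" "P \<subseteq> \<S>" by (auto simp: A_def P_def)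
    have finA: "finite A" using AP finP finite_subset by blast
    have A0: "A \<noteq> {}" using below False by blast
    \<comment> \<open>With the least weight on \<open>A\<close> as decrement, \<open>a0\<close>
      drops to weight \<open>0\<close>, so the number of positive weights decreases.\<close>
    define \<epsilon> where "\<epsilon> = Min (w ` A)"
    have eps_le: "\<epsilon> \<le> w a" if "a \<in> A" for a
      using that finA by (simp add: \<epsilon>_def)
    have "\<epsilon> \<in> w ` A"
      unfolding \<epsilon>_def using finA A0 by (intro Min_in) auto
    then obtain a0 where a0: "a0 \<in> A" "w a0 = \<epsilon>"
      by blast
    have eps: "0 < \<epsilon>" using a0 AP by (auto simp: P_def)
    define w' where "w' S = w S - (if S \<in> A then \<epsilon> else 0)" for S
    have sumw': "sum w' C = sum w C - \<epsilon> * card (C \<inter> A)" if "C \<subseteq> \<S>" for C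
    proof -
      have "finite C" using that fin finite_subset by blast
      then have "(\<Sum>S\<in>C. if S \<in> A then \<epsilon> else 0) = \<epsilon> * card (C \<inter> A)"
        by (simp add: sum.If_cases)
      then show ?thesis by (simp add: w'_def sum_subtractf)
    qed
    have w'0: "0 \<le> w' S" if "S \<in> \<S>" for S
      using less.prems(1)[OF that] eps_le[of S] by (auto simp: w'_def)
    have "{S \<in> \<S>. 0 < w' S} \<subset> P"
    proof
      show "{S \<in> \<S>. 0 < w' S} \<subseteq> P"
        using eps by (auto simp: w'_def P_def split: if_splits)
      have "a0 \<notin> {S \<in> \<S>. 0 < w' S}" using a0 by (simp add: w'_def)
      moreover have "a0 \<in> P" using a0 AP by blast
      ultimately show "{S \<in> \<S>. 0 < w' S} \<noteq> P" by metis
    qed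
    then have "card {S \<in> \<S>. 0 < w' S} < card {S \<in> \<S>. 0 < w S}"
      using psubset_card_mono[OF finP] by (simp add: P_def)
    then have "sum w' \<S> \<le> real n * (W - \<epsilon>)"
    proof (rule less.hyps[OF _ w'0])
      fix C assume C: "C \<subseteq> \<S>" "\<And>S T. S \<in> C \<Longrightarrow> T \<in> C \<Longrightarrow> S \<subseteq> T \<or> T \<subseteq> S"
      \<comment> \<open>Members of \<open>C\<close> outside \<open>D\<close> have weight
        \<open>0\<close>. A nonempty \<open>D\<close> has a least element; putting an element of
        \<open>A\<close> below it keeps a chain, and that chain meets \<open>A\<close>, so it loses
        at least \<open>\<epsilon>\<close>. For empty \<open>D\<close> the chain \<open>{a0}\<close>
        shows \<open>\<epsilon> \<le> W\<close>.\<close>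
      define D where "D = C \<inter> P"
      have finD: "finite D" using finP by (simp add: D_def)
      have "w' S = 0" if "S \<in> C - D" for S
        using that C(1) less.prems(1)[of S] AP by (force simp: w'_def D_def P_def)
      then have sumC: "sum w' C = sum w' D"
        using C(1) fin finite_subset by (intro sum.mono_neutral_right) (auto simp: D_def)
      show "sum w' C \<le> W - \<epsilon>"
      proof (cases "D = {}")
        case True
        have "sum w {a0} \<le> W" using a0 AP by (intro less.prems(2)) auto
        then show ?thesis using True sumC a0 by simp
      next
        case False
        then obtain m where m: "m \<in> D" "\<And>S. S \<in> D \<Longrightarrow> S \<subseteq> m \<Longrightarrow> m = S"
          using finite_has_minimal[OF finD] by blast
        have mD: "m \<subseteq> S" if "S \<in> D" for S
          using m that C(2)[of m S] by (auto simp: D_def)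
        obtain a where a: "a \<in> A" "a \<subseteq> m" using below m(1) by (auto simp: D_def)
        have DS: "insert a D \<subseteq> \<S>" using a AP C(1) by (auto simp: D_def)
        have "sum w' D \<le> sum w' (insert a D)"
          using DS w'0 finD by (intro sum_mono2) auto
        moreover have "\<dots> = sum w (insert a D) - \<epsilon> * card (insert a D \<inter> A)"
          by (rule sumw'[OF DS])
        moreover have "sum w (insert a D) \<le> W"
        proof (rule less.prems(2)[OF DS])
          fix S T assume "S \<in> insert a D" "T \<in> insert a D"
          then show "S \<subseteq> T \<or> T \<subseteq> S"
            using a(2) mD C(2)[of S T] by (auto simp: D_def)
        qed
        moreover have "\<epsilon> * 1 \<le> \<epsilon> * card (insert a D \<inter> A)"
        proof (rule mult_left_mono)
          have "card {a} \<le> card (insert a D \<inter> A)"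
            using a finA by (intro card_mono) auto
          then show "1 \<le> real (card (insert a D \<inter> A))" by simp
        qed (use eps in simp)
        ultimately show ?thesis using sumC by simp
      qed
    qed
    moreover have "sum w' \<S> = sum w \<S> - \<epsilon> * card A"
      using sumw'[of \<S>] AP by (simp add: inf_absorb2)
    moreover have "\<epsilon> * card A \<le> \<epsilon> * n"
    proof -
      have "card A \<le> n"
        using AP by (intro width) (auto simp: A_def)
      then show ?thesis using eps by simp
    qed
    ultimately show ?thesis by (simp add: algebra_simps)
  qed
qed

lemma heavy_chain:
  fixes w :: "'b set \<Rightarrow> real"
  assumes "finite \<S>" and "\<And>S. S \<in> \<S> \<Longrightarrow> 0 \<le> w S"
    and "\<And>A. A \<subseteq> \<S> \<Longrightarrow> (\<And>S T. S \<in> A \<Longrightarrow> T \<in> A \<Longrightarrow> S \<subseteq> T \<Longrightarrow> S = T) \<Longrightarrow> card A \<le> n"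
  obtains C where "C \<subseteq> \<S>" "\<And>S T. S \<in> C \<Longrightarrow> T \<in> C \<Longrightarrow> S \<subseteq> T \<or> T \<subseteq> S"
    "sum w \<S> \<le> real n * sum w C"
proof -
  define \<C> where "\<C> = {C. C \<subseteq> \<S> \<and> (\<forall>S\<in>C. \<forall>T\<in>C. S \<subseteq> T \<or> T \<subseteq> S)}"
  have fin: "finite (sum w ` \<C>)"
    using assms(1) by (intro finite_imageI) (auto simp: \<C>_def intro: finite_subset[of _ "Pow \<S>"])
  have "{} \<in> \<C>" by (simp add: \<C>_def)
  then have "Max (sum w ` \<C>) \<in> sum w ` \<C>"
    using fin by (intro Max_in) auto
  then obtain C where C: "C \<in> \<C>" "sum w C = Max (sum w ` \<C>)"
    by (metis imageE)
  have "sum w \<S> \<le> real n * sum w C"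
    using assms
  proof (rule sum_le_width_times_chain)
    fix D assume "D \<subseteq> \<S>" "\<And>S T. S \<in> D \<Longrightarrow> T \<in> D \<Longrightarrow> S \<subseteq> T \<or> T \<subseteq> S"
    then have "D \<in> \<C>" by (auto simp: \<C>_def)
    then show "sum w D \<le> sum w C" using C(2) fin by simp
  qed
  then show ?thesis using that C(1) by (auto simp: \<C>_def)
qed

context median_metric
begin

text \<open>On the interval \<open>med p\<close> is the meet and \<open>med q\<close> the join; a
  monotone modular function is, up to its value at \<open>p\<close>, a finitely additive mass on the
  ring of sets.\<close>

definition valuation :: "'a \<Rightarrow> 'a \<Rightarrow> ('a \<Rightarrow> real) \<Rightarrow> bool" where
  "valuation p q v \<longleftrightarrow>
     (\<forall>x\<in>interval p q. \<forall>y\<in>interval p q. v (med p x y) + v (med q x y) = v x + v y) \<and>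
     (\<forall>y\<in>interval p q. \<forall>x\<in>interval p y. v x \<le> v y)"

lemma valuation_modular:
  "valuation p q v \<Longrightarrow> x \<in> interval p q \<Longrightarrow> y \<in> interval p q \<Longrightarrow>
     v (med p x y) + v (med q x y) = v x + v y"
  and valuation_mono: "valuation p q v \<Longrightarrow> y \<in> interval p q \<Longrightarrow> x \<in> interval p y \<Longrightarrow> v x \<le> v y"
  by (auto simp: valuation_def)

text \<open>With the interval seen as a ring of sets, \<open>vdiff p v x y\<close> is the mass of \<open>x - y\<close>.\<close>

definition vdiff :: "'a \<Rightarrow> ('a \<Rightarrow> real) \<Rightarrow> 'a \<Rightarrow> 'a \<Rightarrow> real" where
  "vdiff p v x y = v x - v (med p x y)"

lemma vdiff_nonneg: "valuation p q v \<Longrightarrow> x \<in> interval p q \<Longrightarrow> 0 \<le> vdiff p v x y"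
  by (simp add: vdiff_def valuation_mono med_mem)

lemma vdiff_eq_0: "x \<in> interval p y \<Longrightarrow> vdiff p v x y = 0"
  using med_eq_iff[of p y x] by (simp add: vdiff_def med_commute(2))

text \<open>As sets, \<open>c - e\<close> is the disjoint union of the part of \<open>c - e\<close>
  inside \<open>z\<close> and the part outside it, that is, of \<open>c\<close> without the union of
  \<open>e\<close> and \<open>z\<close>.\<close>

lemma vdiff_split:
  assumes v: "valuation p q v" and I: "c \<in> interval p q" "e \<in> interval p q" "z \<in> interval p q"
  shows "vdiff p v c e = vdiff p v (med p c z) e + vdiff p v c (med q e z)"
proof -
  have 1: "med p (med p c e) (med p c z) = med p (med p c z) e"
    by (rule interval_eqI[of _ p q]) (auto simp: med_endpoint_mem I separating_med_left)
  have 2: "med q (med p c e) (med p c z) = med p c (med q e z)"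
    by (rule interval_eqI[of _ p q]) (auto simp: med_endpoint_mem I separating_med_left separating_med_right)
  show ?thesis
    using valuation_modular[OF v med_endpoint_mem(1)[OF I(1,2)] med_endpoint_mem(1)[OF I(1,3)]]
    unfolding 1 2 vdiff_def by simp
qed

text \<open>The empty meet is the top \<open>q\<close> and the empty join, defined next, is the
  bottom \<open>p\<close>.\<close>

definition meet :: "'a \<Rightarrow> 'a \<Rightarrow> 'a set \<Rightarrow> 'a" where
  "meet p q S = (SOME x. x \<in> interval p q \<and> (\<forall>H\<in>separating p q. x \<in> H \<longleftrightarrow> S \<subseteq> H))"

definition join :: "'a \<Rightarrow> 'a \<Rightarrow> 'a set \<Rightarrow> 'a" where
  "join p q S = (SOME x. x \<in> interval p q \<and> (\<forall>H\<in>separating p q. x \<in> H \<longleftrightarrow> S \<inter> H \<noteq> {}))"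

lemma meet:
  assumes "finite S" "S \<subseteq> interval p q"
  shows "meet p q S \<in> interval p q" "H \<in> separating p q \<Longrightarrow> meet p q S \<in> H \<longleftrightarrow> S \<subseteq> H"
  using someI_ex[OF finite_meet[OF assms, unfolded Bex_def], folded meet_def] by blast+

lemma join:
  assumes "finite S" "S \<subseteq> interval p q"
  shows "join p q S \<in> interval p q" "H \<in> separating p q \<Longrightarrow> join p q S \<in> H \<longleftrightarrow> S \<inter> H \<noteq> {}"
  using someI_ex[OF finite_join[OF assms, unfolded Bex_def], folded join_def] by blast+

text \<open>Iterates \<open>vdiff_split\<close> over \<open>Z\<close>. Each point either cuts
  \<open>c\<close> down or enlarges \<open>e\<close>, so the induction must run over all
  \<open>c\<close> and \<open>e\<close> at once. The summands are the parts of \<open>c - e\<close>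
  in the atoms generated by \<open>Z\<close>.\<close>

lemma vdiff_sum:
  assumes v: "valuation p q v" and "finite Z" "Z \<subseteq> interval p q"
    and "c \<in> interval p q" "e \<in> interval p q"
  shows "vdiff p v c e =
    (\<Sum>S\<in>Pow Z. vdiff p v (med p c (meet p q S)) (med q e (join p q (Z - S))))"
  using assms(2-)
proof (induction Z arbitrary: c e)
  case empty
  have "meet p q {} = q" "join p q {} = p"
    by (rule interval_eqI[of _ p q]; simp add: meet join separatingD)+
  moreover have "med p c q = c" "med q e p = e"
    using empty.prems(2,3)[folded med_eq_iff] med_commute(2)[of p c q] med_rotate[of p q e] by simp_all
  ultimately show ?case by simp
next
  case (insert z Z)
  have I: "z \<in> interval p q" "Z \<subseteq> interval p q" using insert.prems by auto
  have fin: "finite S" "S \<subseteq> interval p q" if "S \<subseteq> Z" for S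
    using that insert.hyps(1) I finite_subset by auto
  let ?l = "\<lambda>c e S. vdiff p v (med p c (meet p q S)) (med q e (join p q (Z - S)))"
  let ?r = "\<lambda>S. vdiff p v (med p c (meet p q S)) (med q e (join p q (insert z Z - S)))"
  have "sum ?r (Pow (insert z Z)) = sum ?r (Pow Z) + sum ?r (insert z ` Pow Z)"
    unfolding Pow_insert using insert.hyps by (intro sum.union_disjoint) auto
  also have "sum ?r (insert z ` Pow Z) = (\<Sum>S\<in>Pow Z. ?r (insert z S))"
    using insert.hyps by (subst sum.reindex) (auto simp: inj_on_def)
  also have "\<dots> = (\<Sum>S\<in>Pow Z. ?l (med p c z) e S)"
  proof (rule sum.cong[OF refl])
    fix S assume "S \<in> Pow Z"
    then have S: "S \<subseteq> Z" by simp
    have "med p c (meet p q (insert z S)) = med p (med p c z) (meet p q S)"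
      by (rule interval_eqI[of _ p q])
        (auto simp: med_endpoint_mem meet fin[OF S] I insert.prems separating_med_left)
    moreover have "insert z Z - insert z S = Z - S" using insert.hyps by auto
    ultimately show "?r (insert z S) = ?l (med p c z) e S" by simp
  qed
  also have "\<dots> = vdiff p v (med p c z) e"
    using I insert.prems by (intro insert.IH[symmetric]) (auto simp: med_endpoint_mem)
  also have "sum ?r (Pow Z) = (\<Sum>S\<in>Pow Z. ?l c (med q e z) S)"
  proof (rule sum.cong[OF refl])
    fix S assume "S \<in> Pow Z"
    then have S: "S \<subseteq> Z" by simp
    have "med q e (join p q (insert z (Z - S))) = med q (med q e z) (join p q (Z - S))"
      by (rule interval_eqI[of _ p q])
        (auto simp: med_endpoint_mem join fin[of "Z - S"] I insert.prems separating_med_right)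
    moreover have "insert z Z - S = insert z (Z - S)" using insert.hyps S by auto
    ultimately show "?r S = ?l c (med q e z) S" by simp
  qed
  also have "\<dots> = vdiff p v c (med q e z)"
    using I insert.prems by (intro insert.IH[symmetric]) (auto simp: med_endpoint_mem)
  finally show ?case
    using vdiff_split[OF v insert.prems(2,3) I(1)] by simp
qed

text \<open>A subset \<open>S\<close> of \<open>Z\<close> indexes the atom \<open>\<Inter>S - \<Union>(Z - S)\<close> of the Boolean algebra generated
  by \<open>Z\<close>.\<close>

definition trace_weight :: "'a \<Rightarrow> 'a \<Rightarrow> ('a \<Rightarrow> real) \<Rightarrow> 'a set \<Rightarrow> 'a set \<Rightarrow> real" where
  "trace_weight p q v Z S = vdiff p v (meet p q S) (join p q (Z - S))"

lemma trace_weight_nonneg: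
  assumes "valuation p q v" "finite Z" "Z \<subseteq> interval p q" "S \<subseteq> Z"
  shows "0 \<le> trace_weight p q v Z S"
  unfolding trace_weight_def
  using assms by (intro vdiff_nonneg[of p q]) (auto intro!: meet intro: finite_subset)

text \<open>If \<open>S\<close> is not a trace, every separating halfspace that contains
  \<open>S\<close> contains a further point of \<open>Z\<close>, so the atom is empty. Only traces
  carry mass, and for them the rank bounds antichains.\<close>

lemma trace_weight_eq_0:
  assumes "finite Z" "Z \<subseteq> interval p q" "S \<subseteq> Z" "S \<notin> (\<inter>) Z ` separating p q"
  shows "trace_weight p q v Z S = 0"
proof -
  have S: "finite S" "S \<subseteq> interval p q" using assms finite_subset by auto
  have T: "finite (Z - S)" "Z - S \<subseteq> interval p q" using assms by auto
  have "join p q (Z - S) \<in> H" if H: "H \<in> separating p q" "meet p q S \<in> H" for H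
  proof (rule ccontr)
    assume "join p q (Z - S) \<notin> H"
    then have "(Z - S) \<inter> H = {}" "S \<subseteq> H" using H join(2)[OF T] meet(2)[OF S] by auto
    then have "S = Z \<inter> H" using assms(3) by auto
    then show False using H(1) assms(4) by blast
  qed
  then have "meet p q S \<in> interval p (join p q (Z - S))"
    by (subst interval_le_iff[of _ p q]) (auto simp: meet join S T)
  then show ?thesis by (simp add: trace_weight_def vdiff_eq_0)
qed

text \<open>As \<open>x\<close> and \<open>y\<close> belong to \<open>Z\<close>, an atom is
  contained in \<open>x - y\<close> or disjoint from it, according to whether
  \<open>x \<in> S\<close> and \<open>y \<notin> S\<close>.\<close>

lemma vdiff_eq_sum_trace_weight:
  assumes v: "valuation p q v" and Z: "finite Z" "Z \<subseteq> interval p q" and xy: "x \<in> Z" "y \<in> Z"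
  shows "vdiff p v x y = (\<Sum>S | S \<subseteq> Z \<and> x \<in> S \<and> y \<notin> S. trace_weight p q v Z S)"
proof -
  have I: "x \<in> interval p q" "y \<in> interval p q" using Z xy by auto
  have "vdiff p v x y =
      (\<Sum>S\<in>Pow Z. vdiff p v (med p x (meet p q S)) (med q y (join p q (Z - S))))"
    by (rule vdiff_sum[OF v Z I])
  also have "\<dots> = (\<Sum>S\<in>Pow Z. if x \<in> S \<and> y \<notin> S then trace_weight p q v Z S else 0)"
  proof (rule sum.cong[OF refl])
    fix S assume "S \<in> Pow Z"
    then have S: "finite S" "S \<subseteq> interval p q" and T: "finite (Z - S)" "Z - S \<subseteq> interval p q"
      using Z finite_subset by auto
    show "vdiff p v (med p x (meet p q S)) (med q y (join p q (Z - S))) =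
      (if x \<in> S \<and> y \<notin> S then trace_weight p q v Z S else 0)"
    proof (cases "x \<in> S \<and> y \<notin> S")
      case True
      have "med p x (meet p q S) = meet p q S"
        by (rule interval_eqI[of _ p q]) (use True in \<open>auto simp: med_endpoint_mem meet S I separating_med_left\<close>)
      moreover have "med q y (join p q (Z - S)) = join p q (Z - S)"
        by (rule interval_eqI[of _ p q])
          (use True xy in \<open>auto simp: med_endpoint_mem join T I separating_med_right\<close>)
      ultimately show ?thesis using True by (simp add: trace_weight_def)
    next
      case False
      have "med p x (meet p q S) \<in> interval p (med q y (join p q (Z - S)))"
        using False xy
        by (subst interval_le_iff[of _ p q])
          (auto simp: med_endpoint_mem meet join S T I separating_med_left separating_med_right)
      then show ?thesis using False by (auto simp: vdiff_eq_0)
    qed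
  qed
  also have "\<dots> = (\<Sum>S | S \<subseteq> Z \<and> x \<in> S \<and> y \<notin> S. trace_weight p q v Z S)"
    using Z(1) sum.inter_filter[of "Pow Z" "trace_weight p q v Z" "\<lambda>S. x \<in> S \<and> y \<notin> S"]
    by simp
  finally show ?thesis .
qed

text \<open>The private point for a trace \<open>S\<close> is \<open>meet p q S\<close>: it lies in
  the halfspace chosen for a trace \<open>T\<close> exactly if \<open>S \<subseteq> T\<close>, which
  in an antichain means \<open>S = T\<close>.\<close>

lemma trace_antichain_card:
  assumes rank: "\<forall>k. cube_embeds k ty \<longrightarrow> k \<le> n"
    and Z: "finite Z" "Z \<subseteq> interval p q"
    and A: "A \<subseteq> (\<inter>) Z ` separating p q" "\<And>S T. S \<in> A \<Longrightarrow> T \<in> A \<Longrightarrow> S \<subseteq> T \<Longrightarrow> S = T"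
  shows "card A \<le> n"
proof -
  have "A \<subseteq> Pow Z" using A(1) by auto
  then have "finite A" using Z(1) finite_subset by auto
  then obtain h where h: "bij_betw h {..<card A} A"
    using ex_bij_betw_nat_finite[of A] unfolding atLeast0LessThan by blast
  have hA: "h l \<in> A" if "l < card A" for l using h that by (auto simp: bij_betw_def)
  have "\<forall>S\<in>A. \<exists>H. H \<in> separating p q \<and> S = Z \<inter> H"
    using A(1) by blast
  from bchoice[OF this] obtain H where
    H: "\<And>S. S \<in> A \<Longrightarrow> H S \<in> separating p q" "\<And>S. S \<in> A \<Longrightarrow> S = Z \<inter> H S"
    by blast
  have "cube_embeds (card A) ty"
  proof (rule cube_embedsI)
    fix i l assume il: "i < card A" "l < card A"
    have S: "h i \<subseteq> Z" using \<open>A \<subseteq> Pow Z\<close> hA[OF il(1)] by blast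
    then have "finite (h i)" using Z(1) finite_subset by blast
    then have "meet p q (h i) \<in> H (h l) \<longleftrightarrow> h i \<subseteq> H (h l)"
      using Z S by (intro meet(2) H(1) hA il) auto
    also have "\<dots> \<longleftrightarrow> h i \<subseteq> h l" using S H(2)[OF hA[OF il(2)]] by auto
    also have "\<dots> \<longleftrightarrow> i = l"
      using A(2)[OF hA hA, OF il] h il by (auto simp: bij_betw_def inj_on_def)
    finally show "meet p q (h i) \<in> H (h l) \<longleftrightarrow> i = l" .
  qed (use H(1) hA in blast)
  then show ?thesis using rank by blast
qed

text \<open>\<open>f x\<close> is the weight of those members of a heavy chain that contain
  \<open>x\<close>. These sets of members are nested, which makes \<open>f\<close> a median
  homomorphism: the bounds for all orders of the three arguments pin \<open>f (med a b c)\<close> to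
  the median of the three values. Increments of \<open>f\<close> count chain members only, those of
  \<open>v\<close> count all traces. Every trace contains \<open>q\<close> and omits
  \<open>p\<close>, so \<open>f q\<close> is the full weight of the chain.\<close>

lemma finite_chain_valuation:
  fixes p q :: 'a
  assumes rank: "\<forall>k. cube_embeds k ty \<longrightarrow> k \<le> n"
    and v: "valuation p q v" and Z: "finite Z" "Z \<subseteq> interval p q" and pq: "p \<in> Z" "q \<in> Z"
  obtains f :: "'a \<Rightarrow> real" where
    "\<And>a b c. a \<in> Z \<Longrightarrow> b \<in> Z \<Longrightarrow> c \<in> Z \<Longrightarrow> med a b c \<in> Z \<Longrightarrow>
       min (f a) (f b) \<le> f (med a b c) \<and> f (med a b c) \<le> max (f a) (f b)"
    "\<And>x y. x \<in> Z \<Longrightarrow> y \<in> Z \<Longrightarrow> x \<in> interval p y \<Longrightarrow> f x \<le> f y \<and> f y - f x \<le> v y - v x"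
    "f p = 0" "v q - v p \<le> real n * f q"
proof -
  define w where "w = trace_weight p q v Z"
  define \<S> where "\<S> = (\<inter>) Z ` separating p q"
  have \<S>: "finite \<S>" "\<S> \<subseteq> Pow Z"
    using Z(1) by (auto simp: \<S>_def intro: finite_subset[of _ "Pow Z"])
  have w0: "0 \<le> w S" if "S \<subseteq> Z" for S
    unfolding w_def by (rule trace_weight_nonneg[OF v Z that])
  obtain C where C: "C \<subseteq> \<S>" and chain: "\<And>S T. S \<in> C \<Longrightarrow> T \<in> C \<Longrightarrow> S \<subseteq> T \<or> T \<subseteq> S"
    and heavy: "sum w \<S> \<le> real n * sum w C"
  proof (rule heavy_chain[OF \<S>(1)])
    show "0 \<le> w S" if "S \<in> \<S>" for S using w0 \<S>(2) that by blast
    show "card A \<le> n" if "A \<subseteq> \<S>" "\<And>S T. S \<in> A \<Longrightarrow> T \<in> A \<Longrightarrow> S \<subseteq> T \<Longrightarrow> S = T" for A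
      using trace_antichain_card[OF rank Z] that by (auto simp: \<S>_def)
  qed (rule that)
  have finC: "finite C" using C \<S>(1) finite_subset by blast
  have CZ: "S \<subseteq> Z" if "S \<in> C" for S using that C \<S>(2) by blast
  define U where "U x = {S \<in> C. x \<in> S}" for x
  define f where "f x = sum w (U x)" for x
  have mono: "f x \<le> f y" if "U x \<subseteq> U y" for x y
    unfolding f_def using that finC w0 CZ by (intro sum_mono2) (auto simp: U_def)
  have nested: "U a \<subseteq> U b \<or> U b \<subseteq> U a" for a b
    using chain by (fastforce simp: U_def)
  have U_med: "U a \<inter> U b \<subseteq> U (med a b c)" "U (med a b c) \<subseteq> U a \<union> U b" if "med a b c \<in> Z" "a \<in> Z" "b \<in> Z" for a b c
  proof -
    have "(a \<in> S \<and> b \<in> S \<longrightarrow> med a b c \<in> S) \<and> (med a b c \<in> S \<longrightarrow> a \<in> S \<or> b \<in> S)" if "S \<in> C" for S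
    proof -
      obtain H where "H \<in> separating p q" "S = Z \<inter> H" using \<open>S \<in> C\<close> C by (auto simp: \<S>_def)
      then show ?thesis
        using halfspace_med[of H a b c] separatingD(1) \<open>med a b c \<in> Z\<close> \<open>a \<in> Z\<close> \<open>b \<in> Z\<close> by blast
    qed
    then show "U a \<inter> U b \<subseteq> U (med a b c)" "U (med a b c) \<subseteq> U a \<union> U b"
      by (auto simp: U_def)
  qed
  show ?thesis
  proof
    fix a b c assume abc: "a \<in> Z" "b \<in> Z" "c \<in> Z" "med a b c \<in> Z"
    show "min (f a) (f b) \<le> f (med a b c) \<and> f (med a b c) \<le> max (f a) (f b)"
    proof (cases "U a \<subseteq> U b")
      case True
      then have "U a \<subseteq> U (med a b c)" "U (med a b c) \<subseteq> U b"
        using U_med[OF abc(4,1,2)] by blast+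
      then show ?thesis using mono by (simp add: min.coboundedI1 max.coboundedI2)
    next
      case False
      then have "U b \<subseteq> U a" using nested by blast
      then have "U b \<subseteq> U (med a b c)" "U (med a b c) \<subseteq> U a"
        using U_med[OF abc(4,1,2)] by blast+
      then show ?thesis using mono by (simp add: min.coboundedI2 max.coboundedI1)
    qed
  next
    fix x y assume xy: "x \<in> Z" "y \<in> Z" "x \<in> interval p y"
    have I: "x \<in> interval p q" "y \<in> interval p q" using xy Z by auto
    have "U x \<subseteq> U y"
    proof
      fix S assume "S \<in> U x"
      then obtain H where H: "S \<in> C" "H \<in> separating p q" "S = Z \<inter> H" "x \<in> H"
        using C by (auto simp: \<S>_def U_def)
      moreover have "y \<in> H" using H xy(3) interval_le_iff[OF I] by blast
      ultimately show "S \<in> U y" using xy by (auto simp: U_def)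
    qed
    moreover have "f y - f x \<le> v y - v x"
    proof -
      have "f y - f x = sum w (U y - U x)"
        unfolding f_def using \<open>U x \<subseteq> U y\<close> finC by (intro sum_diff[symmetric]) (auto simp: U_def)
      also have "\<dots> \<le> sum w {S. S \<subseteq> Z \<and> y \<in> S \<and> x \<notin> S}"
        using w0 CZ Z(1) by (intro sum_mono2) (auto simp: U_def)
      also have "\<dots> = vdiff p v y x"
        unfolding w_def by (rule vdiff_eq_sum_trace_weight[OF v Z xy(2,1), symmetric])
      also have "\<dots> = v y - v x"
        using xy(3) med_eq_iff[of p y x] by (simp add: vdiff_def)
      finally show ?thesis .
    qed
    ultimately show "f x \<le> f y \<and> f y - f x \<le> v y - v x" using mono by blast
  next
    have "U p = {}" using C by (auto simp: U_def \<S>_def separating_def)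
    then show "f p = 0" by (simp add: f_def)
    have "U q = C" using C pq by (auto simp: U_def \<S>_def separating_def)
    then have fq: "f q = sum w C" by (simp add: f_def)
    have "v q - v p = vdiff p v q p" by (simp add: vdiff_def)
    also have "\<dots> = sum w {S. S \<subseteq> Z \<and> q \<in> S \<and> p \<notin> S}"
      unfolding w_def by (rule vdiff_eq_sum_trace_weight[OF v Z pq(2,1)])
    also have "\<dots> = sum w \<S>"
    proof (rule sum.mono_neutral_right)
      show "finite {S. S \<subseteq> Z \<and> q \<in> S \<and> p \<notin> S}" using Z(1) by simp
      show "\<S> \<subseteq> {S. S \<subseteq> Z \<and> q \<in> S \<and> p \<notin> S}" using pq by (auto simp: \<S>_def separating_def)
      show "\<forall>S\<in>{S. S \<subseteq> Z \<and> q \<in> S \<and> p \<notin> S} - \<S>. w S = 0"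
        using trace_weight_eq_0[OF Z] by (auto simp: w_def \<S>_def)
    qed
    finally show "v q - v p \<le> real n * f q" using heavy fq by simp
  qed
qed

text \<open>Tychonoff's theorem passes from finite sets of points to the whole interval.\<close>

lemma chain_valuation:
  fixes p q :: 'a
  assumes rank: "\<forall>k. cube_embeds k ty \<longrightarrow> k \<le> n" and v: "valuation p q v"
  obtains f :: "'a \<Rightarrow> real" where
    "\<And>a b c. a \<in> interval p q \<Longrightarrow> b \<in> interval p q \<Longrightarrow> c \<in> interval p q \<Longrightarrow>
       min (f a) (f b) \<le> f (med a b c) \<and> f (med a b c) \<le> max (f a) (f b)"
    "\<And>x y. y \<in> interval p q \<Longrightarrow> x \<in> interval p y \<Longrightarrow> f x \<le> f y \<and> f y - f x \<le> v y - v x"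
    "f p = 0" "v q - v p \<le> real n * f q"
proof -
  \<comment> \<open>Projecting first lets the conditions be indexed by all triples of the type; on
    the interval \<open>\<pi>\<close> is the identity.\<close>
  define \<pi> where "\<pi> = med p q"
  have \<pi>: "\<pi> x \<in> interval p q" "x \<in> interval p q \<Longrightarrow> \<pi> x = x" for x
    by (simp_all add: \<pi>_def med_mem med_eq_iff)
  define M where "M = v q - v p"
  define B :: "('a \<Rightarrow> real) set" where "B = (\<Pi>\<^sub>E i\<in>UNIV. {0..M})"
  have "compactin (product_topology (\<lambda>_::'a. euclideanreal) UNIV) B"
    unfolding B_def by (subst compactin_PiE) simp
  then have "compact B" by (simp add: euclidean_product_topology)
  define K where "K = (\<lambda>(a, b, c). {f :: 'a \<Rightarrow> real.
     (min (f (\<pi> a)) (f (\<pi> b)) \<le> f (med (\<pi> a) (\<pi> b) (\<pi> c)) \<and> f (med (\<pi> a) (\<pi> b) (\<pi> c)) \<le> max (f (\<pi> a)) (f (\<pi> b))) \<and>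
     (\<pi> a \<in> interval p (\<pi> b) \<longrightarrow> f (\<pi> a) \<le> f (\<pi> b) \<and> f (\<pi> b) - f (\<pi> a) \<le> v (\<pi> b) - v (\<pi> a)) \<and>
     f p = 0 \<and> v q - v p \<le> real n * f q})"
  have "B \<inter> (\<Inter>i\<in>UNIV. K i) \<noteq> {}"
  proof (rule compact_imp_fip_image[OF \<open>compact B\<close>])
    fix i :: "'a \<times> 'a \<times> 'a"
    obtain a b c where i: "i = (a, b, c)" by (metis prod.exhaust)
    show "closed (K i)"
      unfolding i K_def prod.case
      by (intro closed_Collect_conj closed_Collect_imp closed_Collect_le closed_Collect_eq open_Collect_const
          continuous_intros continuous_on_product_coordinates)
  next
    fix T :: "('a \<times> 'a \<times> 'a) set" assume T: "finite T"
    define Z where "Z = {p, q} \<union> (\<Union>(a, b, c)\<in>T. {\<pi> a, \<pi> b, \<pi> c, med (\<pi> a) (\<pi> b) (\<pi> c)})"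
    have "finite Z" using T by (auto simp: Z_def)
    moreover have "Z \<subseteq> interval p q"
      using interval_convex[OF \<pi>(1) \<pi>(1)] med_mem(1) by (fastforce simp: Z_def \<pi>(1))
    moreover have "p \<in> Z" "q \<in> Z" by (auto simp: Z_def)
    ultimately obtain f where f:
      "\<And>a b c. a \<in> Z \<Longrightarrow> b \<in> Z \<Longrightarrow> c \<in> Z \<Longrightarrow> med a b c \<in> Z \<Longrightarrow>
         min (f a) (f b) \<le> f (med a b c) \<and> f (med a b c) \<le> max (f a) (f b)"
      "\<And>x y. x \<in> Z \<Longrightarrow> y \<in> Z \<Longrightarrow> x \<in> interval p y \<Longrightarrow> f x \<le> f y \<and> f y - f x \<le> v y - v x"
      "f p = 0" "v q - v p \<le> real n * f q"
      using finite_chain_valuation[OF rank v, of Z] by blast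
    \<comment> \<open>The finite solution is relevant on \<open>Z\<close> only; the value
      \<open>0\<close> elsewhere keeps it in the compact box \<open>B\<close>.\<close>
    define g where "g x = (if x \<in> Z then f x else 0)" for x
    have M0: "0 \<le> M" using valuation_mono[OF v, of q p] by (simp add: M_def)
    have "g \<in> B"
    proof -
      have "0 \<le> f x \<and> f x \<le> M" if "x \<in> Z" for x
      proof -
        have x: "x \<in> interval p q" using that \<open>Z \<subseteq> interval p q\<close> by blast
        then show ?thesis
          using f(2)[OF \<open>p \<in> Z\<close> that] f(2)[OF that \<open>q \<in> Z\<close> x] f(3)
            f(2)[OF \<open>p \<in> Z\<close> \<open>q \<in> Z\<close>] by (simp add: M_def)
      qed
      then show ?thesis using M0 by (auto simp: B_def g_def)
    qed
    moreover have "g \<in> K i" if "i \<in> T" for i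
    proof -
      obtain a b c where i: "i = (a, b, c)" by (metis prod.exhaust)
      have "\<pi> a \<in> Z" "\<pi> b \<in> Z" "\<pi> c \<in> Z" "med (\<pi> a) (\<pi> b) (\<pi> c) \<in> Z"
        using that unfolding i Z_def by blast+
      then show ?thesis
        using f(1)[of "\<pi> a" "\<pi> b" "\<pi> c"] f(2)[of "\<pi> a" "\<pi> b"] f(3,4) \<open>p \<in> Z\<close> \<open>q \<in> Z\<close>
        unfolding i K_def g_def by simp
    qed
    ultimately show "B \<inter> (\<Inter>i\<in>T. K i) \<noteq> {}" by blast
  qed
  then obtain f where f: "\<And>i. f \<in> K i" by blast
  show ?thesis
  proof
    fix a b c assume "a \<in> interval p q" "b \<in> interval p q" "c \<in> interval p q"
    then show "min (f a) (f b) \<le> f (med a b c) \<and> f (med a b c) \<le> max (f a) (f b)"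
      using f[of "(a, b, c)"] by (simp add: K_def \<pi>)
  next
    fix x y assume "y \<in> interval p q" "x \<in> interval p y"
    moreover from this have "x \<in> interval p q" using interval_trans(1) by blast
    ultimately show "f x \<le> f y \<and> f y - f x \<le> v y - v x"
      using f[of "(x, y, y)"] by (simp add: K_def \<pi>)
  next
    show "f p = 0" "v q - v p \<le> real n * f q"
      using f[of "(p, p, p)"] by (simp_all add: K_def)
  qed
qed

section \<open>Compactness of intervals\<close>

lemma valuation_dist: "valuation p q (dist p)"
proof -
  have "dist p (med p x y) + dist p (med q x y) = dist p x + dist p y"
    if xy: "x \<in> interval p q" "y \<in> interval p q" for x y
  proof -
    have "med q x y \<in> interval x q" "med q x y \<in> interval y q" by (rule med_mem)+
    then have "x \<in> interval p (med q x y)" "y \<in> interval p (med q x y)"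
      using xy interval_trans_right(2) by blast+
    \<comment> \<open>Meet and join both lie between \<open>x\<close> and \<open>y\<close>, so
      \<open>dist x y\<close> can be measured through either of them; comparing the two gives the
      modular identity.\<close>
    moreover have "med q x y \<in> interval x y" "med p x y \<in> interval x y"
      "med p x y \<in> interval p x" "med p x y \<in> interval p y" by (rule med_mem)+
    ultimately show ?thesis
      using dist_commute[of x "med p x y"] dist_commute[of y "med q x y"]
      unfolding mem_interval by linarith
  qed
  moreover have "dist p x \<le> dist p y" if "x \<in> interval p y" for x y
    using that zero_le_dist[of x y] unfolding mem_interval by linarith
  ultimately show ?thesis unfolding valuation_def by blast
qed

text \<open>The mass of the symmetric difference of \<open>x\<close> and \<open>y\<close>.\<close>

definition vdist :: "'a \<Rightarrow> ('a \<Rightarrow> real) \<Rightarrow> 'a \<Rightarrow> 'a \<Rightarrow> real" where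
  "vdist p v x y = v x + v y - 2 * v (med p x y)"

lemma vdist_dist: "vdist p (dist p) x y = dist x y"
proof -
  have "med p x y \<in> interval x y" "med p x y \<in> interval p x" "med p x y \<in> interval p y"
    by (rule med_mem)+
  then show ?thesis
    using dist_commute[of x "med p x y"] unfolding mem_interval vdist_def by linarith
qed

lemma vdist_le:
  assumes v: "valuation p q v" and xy: "x \<in> interval p q" "y \<in> interval p q"
  shows "vdist p v x y \<le> v q - v p"
proof -
  have "v p \<le> v (med p x y)" "v (med q x y) \<le> v q"
    using med_endpoint_mem[OF xy] by (auto intro!: valuation_mono[OF v])
  then show ?thesis
    using valuation_modular[OF v xy] by (simp add: vdist_def)
qed

text \<open>Splitting off chain valuations, each carrying a fixed proportion of the remaining mass,
  reduces total boundedness to that of a real interval.\<close>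

lemma valuation_cover:
  fixes p q :: 'a and n :: nat
  assumes rank: "\<forall>k. cube_embeds k ty \<longrightarrow> k \<le> n" and n: "1 \<le> n" and \<delta>: "0 < \<delta>"
    and v: "valuation p q v"
  shows "\<exists>\<C>. finite \<C> \<and> interval p q \<subseteq> \<Union>\<C> \<and>
    (\<forall>C\<in>\<C>. \<forall>x\<in>C. \<forall>y\<in>C. x \<in> interval p q \<longrightarrow> y \<in> interval p q \<longrightarrow>
       vdist p v x y \<le> (1 - 1 / n) ^ k * (v q - v p) + k * \<delta>)"
  using v
proof (induction k arbitrary: v)
  case 0
  then show ?case
    using vdist_le[OF 0] by (intro exI[of _ "{interval p q}"]) auto
next
  case (Suc k)
  define I where "I = interval p q"
  note v = Suc.prems
  obtain f where
    "\<And>a b c. a \<in> interval p q \<Longrightarrow> b \<in> interval p q \<Longrightarrow> c \<in> interval p q \<Longrightarrow>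
       min (f a) (f b) \<le> f (med a b c) \<and> f (med a b c) \<le> max (f a) (f b)"
    "\<And>x y. y \<in> interval p q \<Longrightarrow> x \<in> interval p y \<Longrightarrow> f x \<le> f y \<and> f y - f x \<le> v y - v x"
    "f p = 0" "v q - v p \<le> real n * f q"
    by (rule chain_valuation[OF rank v], rule that; simp)
  note f = this[folded I_def]
  have pq: "p \<in> I" "q \<in> I" by (simp_all add: I_def)
  \<comment> \<open>One inequality comes from monotonicity, the other from the median bound with
    \<open>p\<close> or \<open>q\<close> as the third argument.\<close>
  have minmax: "f (med p x y) = min (f x) (f y)" "f (med q x y) = max (f x) (f y)" if xy: "x \<in> I" "y \<in> I" for x y
  proof -
    have m: "med p x y \<in> interval p x" "med p x y \<in> interval p y" by (rule med_mem)+
    then have "f (med p x y) \<le> f x" "f (med p x y) \<le> f y" using f(2) xy by auto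
    moreover have "min (f x) (f y) \<le> f (med x y p)" using f(1) xy pq by blast
    ultimately show "f (med p x y) = min (f x) (f y)" by (simp add: med_rotate[of p])
    have "med q x y \<in> interval x q" "med q x y \<in> interval y q" by (rule med_mem)+
    then have "x \<in> interval p (med q x y)" "y \<in> interval p (med q x y)"
      using xy interval_trans_right(2) unfolding I_def by blast+
    moreover have "med q x y \<in> I" using med_endpoint_mem xy by (simp add: I_def)
    ultimately have "f x \<le> f (med q x y)" "f y \<le> f (med q x y)" using f(2) by auto
    moreover have "f (med x y q) \<le> max (f x) (f y)" using f(1) xy pq by blast
    ultimately show "f (med q x y) = max (f x) (f y)" by (simp add: med_rotate[of q])
  qed
  \<comment> \<open>Turning meet and join into \<open>min\<close> and \<open>max\<close>,
    \<open>f\<close> is modular, and its increments do not exceed those of \<open>v\<close>. So the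
    remainder is again a valuation, with at most the fraction \<open>1 - 1 / n\<close> of the total
    mass.\<close>
  define r where "r x = v x - f x" for x
  have r: "valuation p q r"
    unfolding valuation_def
  proof (intro conjI ballI)
    fix x y assume "x \<in> interval p q" "y \<in> interval p q"
    then show "r (med p x y) + r (med q x y) = r x + r y"
      using valuation_modular[OF v, of x y] minmax[of x y] by (simp add: r_def I_def)
  next
    fix y x assume "y \<in> interval p q" "x \<in> interval p y"
    then show "r x \<le> r y" using f(2)[of y x] by (simp add: r_def I_def)
  qed
  from Suc.IH[OF r, folded I_def] obtain \<C> where \<C>: "finite \<C>" "I \<subseteq> \<Union>\<C>"
    "\<forall>C\<in>\<C>. \<forall>x\<in>C. \<forall>y\<in>C. x \<in> I \<longrightarrow> y \<in> I \<longrightarrow>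
       vdist p r x y \<le> (1 - 1 / n) ^ k * (r q - r p) + k * \<delta>"
    by (elim exE conjE) (rule that)
  define J where "J = {0..\<lfloor>(v q - v p) / \<delta>\<rfloor>}"
  \<comment> \<open>The distance for \<open>v\<close> is the one for \<open>r\<close> plus
    \<open>\<bar>f x - f y\<bar>\<close>, so slicing by \<open>f\<close> at width
    \<open>\<delta>\<close> costs \<open>\<delta>\<close> in diameter.\<close>
  define E where "E C j = C \<inter> {x \<in> I. \<lfloor>f x / \<delta>\<rfloor> = j}" for C j
  have fx: "0 \<le> f x \<and> f x \<le> v q - v p" if "x \<in> I" for x
    using that f(2)[of x p] f(2)[of q x] f(2)[of q p] f(3) pq by (auto simp: I_def)
  have J: "\<lfloor>f x / \<delta>\<rfloor> \<in> J" if "x \<in> I" for x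
    using fx[OF that] \<delta> by (auto simp: J_def intro!: floor_mono divide_right_mono)
  show ?case
  proof (intro exI[of _ "(\<lambda>(C, j). E C j) ` (\<C> \<times> J)"] conjI ballI impI)
    show "finite ((\<lambda>(C, j). E C j) ` (\<C> \<times> J))" using \<C>(1) by (simp add: J_def)
    show "interval p q \<subseteq> \<Union> ((\<lambda>(C, j). E C j) ` (\<C> \<times> J))"
    proof
      fix x assume "x \<in> interval p q"
      then have x: "x \<in> I" by (simp add: I_def)
      then obtain C where "C \<in> \<C>" "x \<in> C" using \<C>(2) by blast
      then have "x \<in> E C \<lfloor>f x / \<delta>\<rfloor>" "(C, \<lfloor>f x / \<delta>\<rfloor>) \<in> \<C> \<times> J"
        using x J by (auto simp: E_def)
      then show "x \<in> \<Union> ((\<lambda>(C, j). E C j) ` (\<C> \<times> J))" by blast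
    qed
  next
    fix D x y assume "D \<in> (\<lambda>(C, j). E C j) ` (\<C> \<times> J)" "x \<in> D" "y \<in> D"
    then obtain C j where C: "C \<in> \<C>" "x \<in> C" "y \<in> C" "x \<in> I" "y \<in> I"
      and fl: "\<lfloor>f x / \<delta>\<rfloor> = j" "\<lfloor>f y / \<delta>\<rfloor> = j" by (auto simp: E_def)
    have "\<bar>f x / \<delta> - f y / \<delta>\<bar> \<le> 1" using fl by linarith
    then have "\<bar>f x - f y\<bar> \<le> \<delta>"
      using \<delta> by (simp add: diff_divide_distrib[symmetric] abs_div_pos[symmetric] divide_le_eq)
    moreover have "vdist p v x y = vdist p r x y + \<bar>f x - f y\<bar>"
      using minmax[OF C(4,5)] by (simp add: vdist_def r_def min_def)
    moreover have "vdist p r x y \<le> (1 - 1 / n) ^ k * (r q - r p) + k * \<delta>"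
      using \<C>(3) C by blast
    moreover have "(1 - 1 / n) ^ k * (r q - r p) \<le> (1 - 1 / n) ^ k * ((1 - 1 / n) * (v q - v p))"
    proof (rule mult_left_mono)
      have "(v q - v p) / n \<le> f q" using f(4) n by (simp add: divide_le_eq mult.commute)
      then show "r q - r p \<le> (1 - 1 / n) * (v q - v p)"
        using f(3) by (simp add: r_def left_diff_distrib)
    qed (use n in simp)
    moreover have "(1 - 1 / n) ^ Suc k * (v q - v p) = (1 - 1 / n) ^ k * ((1 - 1 / n) * (v q - v p))"
      "Suc k * \<delta> = k * \<delta> + \<delta>" by (simp_all add: distrib_right)
    ultimately show "vdist p v x y \<le> (1 - 1 / n) ^ Suc k * (v q - v p) + Suc k * \<delta>"
      by linarith
  qed
qed

lemma compact_interval: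
  fixes p q :: 'a
  assumes rank: "\<forall>k. cube_embeds k ty \<longrightarrow> k \<le> n" and complete: "complete (UNIV :: 'a set)"
  shows "compact (interval p q)"
  unfolding compact_eq_totally_bounded
proof (intro conjI allI impI)
  have "closed (interval p q)"
    unfolding interval_def by (intro closed_Collect_eq continuous_intros)
  then show "complete (interval p q)"
    using complete complete_Int_closed[OF complete, of "interval p q"] by simp
next
  fix \<epsilon> :: real assume \<epsilon>: "0 < \<epsilon>"
  \<comment> \<open>The successor guards against \<open>n = 0\<close> and makes
    \<open>1 - 1 / N\<close> a contraction factor.\<close>
  define N where "N = Suc n"
  have rank': "\<forall>k. cube_embeds k ty \<longrightarrow> k \<le> N" using rank by (force simp: N_def)
  have "(\<lambda>k. (1 - 1 / N) ^ k * dist p q) \<longlonglongrightarrow> 0 * dist p q"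
    by (intro tendsto_intros LIMSEQ_realpow_zero) (auto simp: N_def)
  then have "eventually (\<lambda>k. (1 - 1 / N) ^ k * dist p q < \<epsilon> / 2) sequentially"
    using \<epsilon> by (intro order_tendstoD) auto
  then obtain k where k: "(1 - 1 / N) ^ k * dist p q < \<epsilon> / 2"
    by (auto simp: eventually_sequentially)
  \<comment> \<open>Chosen after \<open>k\<close>, because each of the \<open>k\<close> splittings
    costs one \<open>\<delta>\<close>.\<close>
  define \<delta> where "\<delta> = \<epsilon> / (2 * Suc k)"
  have \<delta>: "0 < \<delta>" "k * \<delta> < \<epsilon> / 2" using \<epsilon> by (auto simp: \<delta>_def field_simps)
  have "1 \<le> N" by (simp add: N_def)
  from valuation_cover[OF rank' this \<delta>(1) valuation_dist, of p q k]
  obtain \<C> where \<C>: "finite \<C>" "interval p q \<subseteq> \<Union>\<C>"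
    "\<forall>C\<in>\<C>. \<forall>x\<in>C. \<forall>y\<in>C. x \<in> interval p q \<longrightarrow> y \<in> interval p q \<longrightarrow>
       vdist p (dist p) x y \<le> (1 - 1 / N) ^ k * (dist p q - dist p p) + k * \<delta>"
    by (elim exE conjE) (rule that)
  define pt where "pt C = (SOME x. x \<in> C \<inter> interval p q)" for C
  have pt: "pt C \<in> C \<inter> interval p q" if "x \<in> C" "x \<in> interval p q" for x C
    unfolding pt_def by (rule someI[of _ x]) (use that in blast)
  show "\<exists>k. finite k \<and> interval p q \<subseteq> (\<Union>x\<in>k. ball x \<epsilon>)"
  proof (intro exI[of _ "pt ` \<C>"] conjI subsetI)
    fix x assume x: "x \<in> interval p q"
    then obtain C where C: "C \<in> \<C>" "x \<in> C" using \<C>(2) by blast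
    have "vdist p (dist p) (pt C) x \<le> (1 - 1 / N) ^ k * (dist p q - dist p p) + k * \<delta>"
      using \<C>(3) C x pt[OF C(2) x] by blast
    then have "dist (pt C) x < \<epsilon>"
      using k \<delta>(2) by (simp add: vdist_dist)
    then show "x \<in> (\<Union>x\<in>pt ` \<C>. ball x \<epsilon>)" using C by auto
  qed (use \<C>(1) in simp)
qed

end

section \<open>The compactification\<close>

text \<open>The closure in the full function type. The conditions on the coordinates are closed, so
  it agrees with the closure inside \<open>interval_product\<close>; see
  \<open>rf_compactification_eq\<close>.\<close>

definition rf_space :: "('a::metric_space \<times> 'a \<Rightarrow> 'a) set" where
  "rf_space = closure (range rf_map)"

lemma closed_interval_coordinate: "closed {\<xi> :: 'a::metric_space \<times> 'a \<Rightarrow> 'a. \<xi> (x, y) \<in> interval x y}"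
  unfolding mem_interval
  by (intro closed_Collect_eq continuous_intros continuous_on_product_coordinates)

lemma interval_product_eq: "interval_product = top_of_set (\<Pi>\<^sub>E (x, y)\<in>UNIV. interval x y)"
proof -
  have "interval_product = product_topology (\<lambda>i. top_of_set (case i of (x, y) \<Rightarrow> interval x y)) UNIV"
    by (simp add: interval_product_def case_prod_beta')
  then show ?thesis
    by (simp flip: subtopology_product_topology add: euclidean_product_topology)
qed

context median_metric
begin

lemma range_rf_map: "range rf_map \<subseteq> (\<Pi>\<^sub>E (x, y)\<in>UNIV. interval x (y::'a))"
  by (auto simp: rf_map_def med_mem)

lemma rf_space_interval:
  fixes \<xi> :: "'a \<times> 'a \<Rightarrow> 'a"
  assumes "\<xi> \<in> rf_space"
  shows "\<xi> (x, y) \<in> interval x y"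
proof -
  have "rf_space \<subseteq> {\<xi> :: 'a \<times> 'a \<Rightarrow> 'a. \<xi> (x, y) \<in> interval x y}"
    unfolding rf_space_def using range_rf_map
    by (intro closure_minimal closed_interval_coordinate) (auto simp: rf_map_def med_mem)
  then show ?thesis using assms by blast
qed

lemma rf_compactification_eq: "rf_compactification = top_of_set (rf_space :: ('a \<times> 'a \<Rightarrow> 'a) set)"
proof -
  let ?P = "\<Pi>\<^sub>E (x, y)\<in>UNIV. interval x (y::'a)"
  have "interval_product closure_of range rf_map = ?P \<inter> closure (range rf_map)"
    using range_rf_map by (simp add: interval_product_eq closure_of_subtopology inf_absorb2)
  moreover have "rf_space \<subseteq> ?P"
    using rf_space_interval by (auto simp: PiE_UNIV_domain)
  ultimately show ?thesis
    by (simp add: rf_compactification_def interval_product_eq subtopology_subtopology rf_space_def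
        inf_absorb2 inf.absorb_iff2)
qed

lemma compact_rf_space:
  assumes "\<And>x y :: 'a. compact (interval x y)"
  shows "compact (rf_space :: ('a \<times> 'a \<Rightarrow> 'a) set)"
proof -
  let ?P = "\<Pi>\<^sub>E (x, y)\<in>UNIV. interval x (y::'a)"
  have "compactin (product_topology (\<lambda>_. euclidean) UNIV) ?P"
    by (subst compactin_PiE) (use assms in auto)
  then have "compact ?P" by (simp add: euclidean_product_topology)
  then have "compact (?P \<inter> rf_space)"
    unfolding rf_space_def by (intro compact_Int_closed) auto
  moreover have "?P \<inter> rf_space = rf_space"
    using rf_space_interval by (auto simp: PiE_UNIV_domain)
  ultimately show ?thesis by simp
qed

text \<open>A closed condition that holds on the image of \<open>X\<close>. It controls the change
  of the index \<open>(x, y)\<close>, which the action moves together with the value.\<close>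

lemma rf_space_lipschitz:
  fixes \<xi> :: "'a \<times> 'a \<Rightarrow> 'a"
  assumes "\<xi> \<in> rf_space"
  shows "dist (\<xi> (x, y)) (\<xi> (x', y')) \<le> dist x x' + dist y y'"
proof -
  have "rf_space \<subseteq> {\<xi> :: 'a \<times> 'a \<Rightarrow> 'a. dist (\<xi> (x, y)) (\<xi> (x', y')) \<le> dist x x' + dist y y'}"
    unfolding rf_space_def
    by (intro closure_minimal closed_Collect_le continuous_intros continuous_on_product_coordinates)
      (auto simp: rf_map_def dist_med_both)
  then show ?thesis using assms by blast
qed

text \<open>\<open>med_med_interval\<close> is the case of points of \<open>X\<close>, and the
  condition is closed. It allows replacing an index by the pair of values that two points take
  there; at the new index they take the endpoints as values.\<close>

lemma rf_space_proj:
  fixes \<xi> :: "'a \<times> 'a \<Rightarrow> 'a"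
  assumes "\<xi> \<in> rf_space" and pq: "p \<in> interval x y" "q \<in> interval x y"
  shows "\<xi> (p, q) = med p q (\<xi> (x, y))"
proof -
  have "rf_space \<subseteq> {\<xi> :: 'a \<times> 'a \<Rightarrow> 'a. dist (\<xi> (p, q)) (med p q (\<xi> (x, y))) = 0}"
    unfolding rf_space_def
  proof (intro closure_minimal closed_Collect_eq continuous_on_dist continuous_on_const
      continuous_on_product_coordinates)
    have "continuous_on UNIV (med p q)"
      unfolding continuous_on_iff using dist_med_le[of p q] by (metis le_less_trans)
    then show "continuous_on UNIV (\<lambda>\<xi> :: 'a \<times> 'a \<Rightarrow> 'a. med p q (\<xi> (x, y)))"
      by (rule continuous_on_compose2[OF _ continuous_on_product_coordinates]) simp
  qed (use pq in \<open>auto simp: rf_map_def med_med_interval\<close>)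
  then show ?thesis using assms(1) by auto
qed

text \<open>As \<open>med\<close> is symmetric, the two bounds for all triples say that
  \<open>f\<close> is a median homomorphism into the reals on the image of \<open>X\<close>. This
  image is dense, and the shattered halfspaces are subsets of \<open>X\<close>.\<close>

definition rf_median_functions :: "(('a \<times> 'a \<Rightarrow> 'a) \<Rightarrow> real) set" where
  "rf_median_functions = {f. continuous_on rf_space f \<and> (\<forall>\<xi>\<in>rf_space. \<bar>f \<xi>\<bar> \<le> 1) \<and>
     (\<forall>a b c. min (f (rf_map a)) (f (rf_map b)) \<le> f (rf_map (med a b c)) \<and>
       f (rf_map (med a b c)) \<le> max (f (rf_map a)) (f (rf_map b)))}"

lemma uminus_rf_median_functions:
  assumes "f \<in> rf_median_functions"
  shows "(\<lambda>\<xi>. - f \<xi>) \<in> rf_median_functions"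
proof -
  have "min (- x) (- y) \<le> - z \<and> - z \<le> max (- x) (- y) \<longleftrightarrow> min x y \<le> z \<and> z \<le> max x y" for x y z :: real
    by (auto simp: min_def max_def)
  then show ?thesis
    using assms unfolding rf_median_functions_def by (auto intro: continuous_intros)
qed

text \<open>At the index \<open>(p, q)\<close> the two points take the values \<open>p\<close> and
  \<open>q\<close>. A chain valuation of the metric on \<open>interval p q\<close> carries a
  positive share of \<open>dist p q\<close>, so after division by \<open>f q\<close> it is
  \<open>0\<close> at the one point and \<open>1\<close> at the other.\<close>

lemma rf_median_functions_separate:
  fixes \<xi> \<eta> :: "'a \<times> 'a \<Rightarrow> 'a"
  assumes rank: "\<forall>k. cube_embeds k ty \<longrightarrow> k \<le> n"
    and \<xi>\<eta>: "\<xi> \<in> rf_space" "\<eta> \<in> rf_space" "\<xi> \<noteq> \<eta>"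
  shows "\<exists>f\<in>rf_median_functions. f \<xi> \<noteq> f \<eta>"
proof -
  obtain x y where xy: "\<xi> (x, y) \<noteq> \<eta> (x, y)"
    using \<xi>\<eta>(3) by (force simp: fun_eq_iff)
  define p where "p = \<xi> (x, y)"
  define q where "q = \<eta> (x, y)"
  have I: "p \<in> interval x y" "q \<in> interval x y"
    unfolding p_def q_def by (intro rf_space_interval \<xi>\<eta>)+
  have vals: "\<xi> (p, q) = p" "\<eta> (p, q) = q"
    using rf_space_proj[OF \<xi>\<eta>(1) I] rf_space_proj[OF \<xi>\<eta>(2) I] by (simp_all flip: p_def q_def)
  obtain f where f:
    "\<And>a b c. a \<in> interval p q \<Longrightarrow> b \<in> interval p q \<Longrightarrow> c \<in> interval p q \<Longrightarrow>
       min (f a) (f b) \<le> f (med a b c) \<and> f (med a b c) \<le> max (f a) (f b)"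
    "\<And>x y. y \<in> interval p q \<Longrightarrow> x \<in> interval p y \<Longrightarrow> f x \<le> f y \<and> f y - f x \<le> dist p y - dist p x"
    "f p = 0" "dist p q - dist p p \<le> real n * f q"
    by (rule chain_valuation[OF rank valuation_dist], rule that; simp)
  have pos: "0 < dist p q" using xy by (simp add: p_def q_def)
  have fq: "0 < f q"
  proof (rule ccontr)
    assume "\<not> 0 < f q"
    then have "real n * f q \<le> 0" by (intro mult_nonneg_nonpos) auto
    with f(4) pos dist_self[of p] show False by linarith
  qed
  have bounds: "0 \<le> f z \<and> f z \<le> f q" if "z \<in> interval p q" for z
    using f(2)[OF that, of p] f(2)[of q z] f(3) that by simp
  have lip1: "f z - f w \<le> dist z w" if "z \<in> interval p q" "w \<in> interval p q" for z w
  proof -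
    have m: "med p z w \<in> interval p z" "med p z w \<in> interval p w" "med p z w \<in> interval z w"
      by (rule med_mem)+
    have "f z - f (med p z w) \<le> dist p z - dist p (med p z w)" "f (med p z w) \<le> f w"
      using f(2)[OF that(1) m(1)] f(2)[OF that(2) m(2)] by auto
    moreover have "dist p z - dist p (med p z w) = dist z (med p z w)" "dist z (med p z w) \<le> dist z w"
      using m zero_le_dist[of "med p z w" w] dist_commute[of z "med p z w"] unfolding mem_interval by linarith+
    ultimately show ?thesis by linarith
  qed
  have lip: "\<bar>f z - f w\<bar> \<le> dist z w" if "z \<in> interval p q" "w \<in> interval p q" for z w
    using lip1[OF that] lip1[OF that(2,1)] by (simp add: dist_commute abs_le_iff)
  have "continuous_on (interval p q) f"
    unfolding continuous_on_iff dist_real_def using lip by (metis le_less_trans)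
  then have cont: "continuous_on rf_space (\<lambda>\<zeta> :: 'a \<times> 'a \<Rightarrow> 'a. f (\<zeta> (p, q)))"
    by (rule continuous_on_compose2)
      (auto intro: continuous_on_subset[OF continuous_on_product_coordinates] rf_space_interval)
  define F where "F \<zeta> = f (\<zeta> (p, q)) / f q" for \<zeta> :: "'a \<times> 'a \<Rightarrow> 'a"
  have "F \<in> rf_median_functions"
    unfolding rf_median_functions_def
  proof (intro CollectI conjI allI ballI)
    show "continuous_on rf_space F"
      unfolding F_def using fq by (intro continuous_intros cont) auto
    show "\<bar>F \<zeta>\<bar> \<le> 1" if "\<zeta> \<in> rf_space" for \<zeta>
      using bounds[OF rf_space_interval[OF that]] fq by (simp add: F_def)
    fix a b c :: 'a
    have "min (f (med p q a)) (f (med p q b)) \<le> f (med p q (med a b c)) \<and>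
        f (med p q (med a b c)) \<le> max (f (med p q a)) (f (med p q b))"
      unfolding med_distrib[of p q] by (intro f(1) med_mem)
    then show "min (F (rf_map a)) (F (rf_map b)) \<le> F (rf_map (med a b c))"
      "F (rf_map (med a b c)) \<le> max (F (rf_map a)) (F (rf_map b))"
      using fq by (auto simp: F_def rf_map_def min_def max_def divide_le_cancel split: if_splits)
  qed
  moreover have "F \<xi> \<noteq> F \<eta>" using vals f(3) fq by (simp add: F_def)
  ultimately show ?thesis by blast
qed

end

section \<open>The induced action on the compactification\<close>

locale isometric_action = median_metric ty for ty :: "'a::metric_space itself" +
  fixes act :: "'g::topological_group_add \<Rightarrow> 'a \<Rightarrow> 'a"
  assumes act: "continuous_action act euclidean"
    and isometry: "\<And>g x y. dist (act g x) (act g y) = dist x y"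
begin

lemma act_add: "act (g + h) x = act g (act h x)" and act_zero: "act 0 x = x"
  using act by (auto simp: continuous_action_def)

lemma continuous_act: "continuous_on UNIV (\<lambda>z. act (fst z) (snd z))"
proof -
  have "continuous_map (prod_topology euclidean euclidean) euclidean (\<lambda>(g, x). act g x)"
    using act by (simp add: continuous_action_def)
  then show ?thesis by (simp add: case_prod_beta')
qed

lemma continuous_act_intro [continuous_intros]:
  assumes "continuous_on S f" "continuous_on S h"
  shows "continuous_on S (\<lambda>z. act (f z) (h z))"
  using continuous_on_compose2[OF continuous_act continuous_on_Pair[OF assms]] by simp

lemma rf_action_rf_map': "rf_action act g (rf_map z) = rf_map (act g z)"
  using median_space act isometry
  by (intro rf_action_rf_map) (simp_all add: median_space_def)

lemma act_med: "act g (med a b c) = med (act g a) (act g b) (act g c)"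
proof -
  have "act (- g) (act g x) = x" for x
    using act_add[of "- g" g x] act_zero by simp
  then show ?thesis
    using fun_cong[OF rf_action_rf_map'[of g c], of "(act g a, act g b)"]
    by (simp add: rf_action_def rf_map_def)
qed

lemma continuous_rf_action: "continuous_on S (rf_action act g)"
  unfolding rf_action_def
proof (rule continuous_on_coordinatewise_then_product)
  fix i :: "'a \<times> 'a"
  show "continuous_on S (\<lambda>\<xi> :: 'a \<times> 'a \<Rightarrow> 'a. case i of (x, y) \<Rightarrow> act g (\<xi> (act (- g) x, act (- g) y)))"
    unfolding case_prod_beta
    by (intro continuous_intros continuous_on_subset[OF continuous_on_product_coordinates]) auto
qed

lemma rf_action_rf_space:
  assumes "\<xi> \<in> rf_space"
  shows "rf_action act g \<xi> \<in> rf_space"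
proof -
  have "rf_action act g ` closure (range rf_map) \<subseteq> closure (range rf_map)"
    by (intro image_closure_subset continuous_rf_action) (auto simp: rf_action_rf_map' intro: subsetD[OF closure_subset])
  then show ?thesis using assms by (auto simp: rf_space_def)
qed

lemma continuous_action_rf: "continuous_action (rf_action act) rf_compactification"
  unfolding continuous_action_def
proof (intro conjI allI ballI)
  fix \<xi> :: "'a \<times> 'a \<Rightarrow> 'a" and g h
  show "rf_action act 0 \<xi> = \<xi>" by (auto simp: rf_action_def act_zero)
  show "rf_action act (g + h) \<xi> = rf_action act g (rf_action act h \<xi>)"
    unfolding rf_action_def minus_add act_add by simp
next
  let ?S = "UNIV \<times> rf_space :: ('g \<times> ('a \<times> 'a \<Rightarrow> 'a)) set"
  have "continuous_on ?S (\<lambda>z. rf_action act (fst z) (snd z))"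
  proof (rule continuous_on_coordinatewise_then_product)
    fix i :: "'a \<times> 'a"
    obtain x y where i: "i = (x, y)" by (cases i)
    define \<Psi> where "\<Psi> z = act (fst z) (snd z (act (- fst z) x, act (- fst z) y))"
      for z :: "'g \<times> ('a \<times> 'a \<Rightarrow> 'a)"
    have "continuous_on ?S \<Psi>"
      unfolding continuous_on_def
    proof
      fix z0 assume z0: "z0 \<in> ?S"
      obtain g0 \<xi>0 where z0_eq: "z0 = (g0, \<xi>0)" by (cases z0)
      define c where "c = (act (- g0) x, act (- g0) y)"
      \<comment> \<open>The group element moves both the index and the value. The Lipschitz bound in
        the index and the isometry of the action separate the effects; each summand moves only a
        fixed point of \<open>X\<close> or reads only the fixed coordinate \<open>c\<close>, and is
        therefore continuous.\<close>
      define bd where "bd z = dist (act (- fst z) x) (act (- g0) x) + dist (act (- fst z) y) (act (- g0) y)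
        + dist (snd z c) (\<xi>0 c) + dist (act (fst z) (\<xi>0 c)) (act g0 (\<xi>0 c))"
        for z :: "'g \<times> ('a \<times> 'a \<Rightarrow> 'a)"
      have le: "dist (\<Psi> z) (\<Psi> z0) \<le> bd z" if z: "z \<in> ?S" for z
      proof -
        obtain g \<xi> where zz: "z = (g, \<xi>)" "\<xi> \<in> rf_space" using z by auto
        have "dist (\<Psi> z) (act g (\<xi> c)) = dist (\<xi> (act (- g) x, act (- g) y)) (\<xi> c)"
          by (simp add: \<Psi>_def zz isometry)
        also have "\<dots> \<le> dist (act (- g) x) (act (- g0) x) + dist (act (- g) y) (act (- g0) y)"
          unfolding c_def by (rule rf_space_lipschitz[OF zz(2)])
        finally have 1: "dist (\<Psi> z) (act g (\<xi> c)) \<le> dist (act (- g) x) (act (- g0) x) + dist (act (- g) y) (act (- g0) y)" .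
        have 2: "dist (act g (\<xi> c)) (act g (\<xi>0 c)) = dist (\<xi> c) (\<xi>0 c)" by (rule isometry)
        have "\<Psi> z0 = act g0 (\<xi>0 c)" by (simp add: \<Psi>_def z0_eq c_def)
        then show ?thesis
          using 1 2 dist_triangle[of "\<Psi> z" "act g0 (\<xi>0 c)" "act g (\<xi> c)"]
            dist_triangle[of "act g (\<xi> c)" "act g0 (\<xi>0 c)" "act g (\<xi>0 c)"]
          by (simp add: bd_def zz)
      qed
      have "continuous_on ?S bd"
        unfolding bd_def
        by (intro continuous_intros continuous_on_compose2[OF continuous_on_product_coordinates continuous_on_snd]) auto
      then have "(bd \<longlongrightarrow> bd z0) (at z0 within ?S)"
        using z0 unfolding continuous_on_def by blast
      then have "(bd \<longlongrightarrow> 0) (at z0 within ?S)" by (simp add: bd_def z0_eq)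
      then have "((\<lambda>z. dist (\<Psi> z) (\<Psi> z0)) \<longlongrightarrow> 0) (at z0 within ?S)"
        by (rule Lim_null_comparison[rotated]) (auto simp: eventually_at_topological intro!: exI[of _ UNIV] le)
      then show "(\<Psi> \<longlongrightarrow> \<Psi> z0) (at z0 within ?S)"
        by (subst tendsto_dist_iff)
    qed
    then show "continuous_on ?S (\<lambda>z. rf_action act (fst z) (snd z) i)"
      by (simp add: i rf_action_def \<Psi>_def[abs_def])
  qed
  then have "continuous_map (top_of_set ?S) (top_of_set rf_space) (\<lambda>z. rf_action act (fst z) (snd z))"
    using rf_action_rf_space by (auto simp: continuous_map_in_subtopology)
  moreover have "prod_topology euclidean (top_of_set rf_space) = top_of_set ?S"
    using prod_topology_subtopology_eu[of "UNIV :: 'g set" rf_space] by simp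
  ultimately show "continuous_map (prod_topology euclidean rf_compactification) rf_compactification
      (\<lambda>(g, x). rf_action act g x)"
    unfolding rf_compactification_eq case_prod_beta' by argo
qed

lemma rf_median_functions_invariant:
  assumes "f \<in> rf_median_functions"
  shows "(\<lambda>\<xi>. f (rf_action act g \<xi>)) \<in> rf_median_functions"
proof -
  have "continuous_on rf_space f"
    using assms by (simp add: rf_median_functions_def)
  then have "continuous_on rf_space (\<lambda>\<xi>. f (rf_action act g \<xi>))"
    using continuous_on_compose2[of rf_space f rf_space "rf_action act g"] rf_action_rf_space
      continuous_rf_action by auto
  then show ?thesis
    using assms unfolding rf_median_functions_def
    by (auto simp: rf_action_rf_map' act_med rf_action_rf_space)
qed

end

section \<open>Shattering and covering numbers\<close>

definition shatters :: "'b set set \<Rightarrow> 'b set \<Rightarrow> bool" where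
  "shatters A T \<longleftrightarrow> (\<forall>S\<subseteq>T. \<exists>X\<in>A. X \<inter> T = S)"

text \<open>Pajor's form of the Sauer--Shelah lemma. The family is split by membership of
  \<open>x\<close>. A set shattered by both halves is counted twice, and then the family shatters it
  both with and without \<open>x\<close>.\<close>

lemma card_le_card_shattered:
  assumes "finite U" "A \<subseteq> Pow U"
  shows "card A \<le> card {T. T \<subseteq> U \<and> shatters A T}"
  using assms
proof (induction U arbitrary: A rule: finite_induct)
  case empty
  then have "A = {} \<or> A = {{}}" by auto
  then show ?case
  proof
    assume "A = {{}}"
    then have "{T. T \<subseteq> {} \<and> shatters A T} = {{}}" by (auto simp: shatters_def)
    then show ?thesis using \<open>A = {{}}\<close> by simp
  qed simp
next
  case (insert x U)
  define A0 where "A0 = {X \<in> A. x \<notin> X}"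
  define A1 where "A1 = (\<lambda>X. X - {x}) ` {X \<in> A. x \<in> X}"
  have finA: "finite A" using insert finite_subset by (metis finite_Pow_iff finite_insert)
  have "A = A0 \<union> {X \<in> A. x \<in> X}" "A0 \<inter> {X \<in> A. x \<in> X} = {}" by (auto simp: A0_def)
  then have "card A = card A0 + card {X \<in> A. x \<in> X}"
    using finA by (metis card_Un_disjoint finite_Un)
  also have "card {X \<in> A. x \<in> X} = card A1"
    unfolding A1_def by (intro card_image[symmetric]) (auto simp: inj_on_def)
  finally have cardA: "card A = card A0 + card A1" .
  have sub: "A0 \<subseteq> Pow U" "A1 \<subseteq> Pow U" using insert.prems by (auto simp: A0_def A1_def)
  define S0 where "S0 = {T. T \<subseteq> U \<and> shatters A0 T}"
  define S1 where "S1 = {T. T \<subseteq> U \<and> shatters A1 T}"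
  have fin: "finite S0" "finite S1" using insert.hyps(1) by (auto simp: S0_def S1_def)
  have S0: "shatters A T" if "T \<in> S0" for T
    using that unfolding S0_def shatters_def A0_def by blast
  have S1: "shatters A T" if "T \<in> S1" for T
    unfolding shatters_def
  proof (intro allI impI)
    fix S assume "S \<subseteq> T"
    with that obtain X where "X \<in> A" "(X - {x}) \<inter> T = S"
      unfolding S1_def shatters_def A1_def by blast
    moreover have "x \<notin> T" using that insert.hyps(2) by (auto simp: S1_def)
    ultimately show "\<exists>X\<in>A. X \<inter> T = S" by blast
  qed
  have S01: "shatters A (insert x T)" if "T \<in> S0" "T \<in> S1" for T
    unfolding shatters_def
  proof (intro allI impI)
    fix S assume S: "S \<subseteq> insert x T"
    have xT: "x \<notin> T" using that insert.hyps(2) by (auto simp: S1_def)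
    show "\<exists>X\<in>A. X \<inter> insert x T = S"
    proof (cases "x \<in> S")
      case True
      have "S - {x} \<subseteq> T" using S by blast
      with that(2) obtain X where "X \<in> A" "x \<in> X" "(X - {x}) \<inter> T = S - {x}"
        unfolding S1_def shatters_def A1_def by blast
      then have "X \<inter> insert x T = S" using True xT by blast
      then show ?thesis using \<open>X \<in> A\<close> by blast
    next
      case False
      then have "S \<subseteq> T" using S by blast
      with that(1) obtain X where "X \<in> A" "x \<notin> X" "X \<inter> T = S"
        unfolding S0_def shatters_def A0_def by blast
      then have "X \<inter> insert x T = S" by blast
      then show ?thesis using \<open>X \<in> A\<close> by blast
    qed
  qed
  have notin: "x \<notin> T" if "T \<in> S0 \<union> S1" for T using that insert.hyps(2) by (auto simp: S0_def S1_def)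
  have "card A \<le> card S0 + card S1"
    using insert.IH[OF sub(1)] insert.IH[OF sub(2)] cardA by (simp add: S0_def S1_def)
  also have "\<dots> = card (S0 \<union> S1) + card (S0 \<inter> S1)"
    using fin by (rule card_Un_Int)
  also have "card (S0 \<inter> S1) = card (insert x ` (S0 \<inter> S1))"
    using notin by (intro card_image[symmetric] inj_onI) (metis UnCI IntD1 insert_ident)
  also have "card (S0 \<union> S1) + \<dots> = card ((S0 \<union> S1) \<union> insert x ` (S0 \<inter> S1))"
    using notin fin by (intro card_Un_disjoint[symmetric]) auto
  also have "\<dots> \<le> card {T. T \<subseteq> insert x U \<and> shatters A T}"
  proof (rule card_mono)
    show "finite {T. T \<subseteq> insert x U \<and> shatters A T}" using insert.hyps(1) by simp
    have "T \<subseteq> U" if "T \<in> S0 \<union> S1" for T using that by (auto simp: S0_def S1_def)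
    then show "(S0 \<union> S1) \<union> insert x ` (S0 \<inter> S1) \<subseteq> {T. T \<subseteq> insert x U \<and> shatters A T}"
      using S0 S1 S01 by blast
  qed
  finally show ?case .
qed

lemma card_small_subsets:
  assumes "finite U"
  shows "card {T. T \<subseteq> U \<and> card T \<le> n} \<le> (card U + 1) ^ n"
proof (induction n)
  case 0
  have "{T. T \<subseteq> U \<and> card T \<le> 0} = {{}}" using assms finite_subset by fastforce
  then show ?case by simp
next
  case (Suc n)
  let ?P = "\<lambda>n. {T. T \<subseteq> U \<and> card T \<le> n}"
  have fin: "finite (?P n)" for n using assms by simp
  have "?P (Suc n) \<subseteq> ?P n \<union> (\<lambda>(u, T). insert u T) ` (U \<times> ?P n)"
  proof
    fix T assume T: "T \<in> ?P (Suc n)"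
    show "T \<in> ?P n \<union> (\<lambda>(u, T). insert u T) ` (U \<times> ?P n)"
    proof (cases "card T \<le> n")
      case False
      then have "T \<noteq> {}" by auto
      then obtain u where u: "u \<in> T" by blast
      have "finite T" using T assms finite_subset by blast
      then have "T - {u} \<in> ?P n" using T u by auto
      moreover have "T = insert u (T - {u})" "u \<in> U" using T u by auto
      ultimately show ?thesis by (intro UnI2 image_eqI[of _ _ "(u, T - {u})"]) auto
    qed (use T in auto)
  qed
  then have "card (?P (Suc n)) \<le> card (?P n \<union> (\<lambda>(u, T). insert u T) ` (U \<times> ?P n))"
    using fin assms by (intro card_mono) auto
  also have "\<dots> \<le> card (?P n) + card ((\<lambda>(u, T). insert u T) ` (U \<times> ?P n))"
    by (rule card_Un_le)
  also have "card ((\<lambda>(u, T). insert u T) ` (U \<times> ?P n)) \<le> card U * card (?P n)"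
    using card_image_le[of "U \<times> ?P n" "\<lambda>(u, T). insert u T"] fin assms by (simp add: card_cartesian_product)
  also have "card (?P n) + card U * card (?P n) \<le> (card U + 1) ^ Suc n"
    using mult_left_mono[OF Suc.IH, of "card U + 1"] by (simp add: algebra_simps)
  finally show ?case by simp
qed

lemma sauer_shelah:
  assumes "finite U" "A \<subseteq> Pow U" "\<And>T. T \<subseteq> U \<Longrightarrow> shatters A T \<Longrightarrow> card T \<le> n"
  shows "card A \<le> (card U + 1) ^ n"
proof -
  have "card A \<le> card {T. T \<subseteq> U \<and> shatters A T}"
    using assms(1,2) by (rule card_le_card_shattered)
  also have "\<dots> \<le> card {T. T \<subseteq> U \<and> card T \<le> n}"
    using assms(1,3) by (intro card_mono) auto
  also have "\<dots> \<le> (card U + 1) ^ n" by (rule card_small_subsets[OF assms(1)])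
  finally show ?thesis .
qed

definition coverable :: "'k set \<Rightarrow> ('k \<Rightarrow> real) set \<Rightarrow> real \<Rightarrow> nat \<Rightarrow> bool" where
  "coverable B \<Phi> \<delta> k \<longleftrightarrow> (\<exists>\<P>. finite \<P> \<and> card \<P> \<le> k \<and> B \<subseteq> \<Union>\<P> \<and>
     (\<forall>P\<in>\<P>. \<forall>x\<in>P. \<forall>y\<in>P. \<forall>f\<in>\<Phi>. \<bar>f x - f y\<bar> \<le> \<delta>))"

text \<open>\<open>D\<close> may depend on \<open>\<delta>\<close> but not on the finite subfamily;
  it serves as coefficient and as degree.\<close>

definition polynomial_covering :: "'k set \<Rightarrow> ('k \<Rightarrow> real) set \<Rightarrow> bool" where
  "polynomial_covering B F \<longleftrightarrow> (\<forall>\<delta>>0. \<exists>D. \<forall>\<Phi>\<subseteq>F. finite \<Phi> \<longrightarrow>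
     coverable B \<Phi> \<delta> (D * (card \<Phi> + 1) ^ D))"

context median_metric
begin

text \<open>The empty subset gives \<open>p\<close>, the full one gives \<open>q\<close>, and the
  singletons give the private points of \<open>cube_embedsI\<close>.\<close>

lemma shattered_halfspaces_card:
  fixes H :: "'b \<Rightarrow> 'a set"
  assumes rank: "\<forall>k. cube_embeds k ty \<longrightarrow> k \<le> n"
    and H: "\<And>u. u \<in> T \<Longrightarrow> halfspace (H u)" and "finite T"
    and shat: "\<And>S. S \<subseteq> T \<Longrightarrow> \<exists>z. \<forall>u\<in>T. z \<in> H u \<longleftrightarrow> u \<in> S"
  shows "card T \<le> n"
proof -
  obtain h where h: "bij_betw h {..<card T} T"
    using ex_bij_betw_nat_finite[OF \<open>finite T\<close>] unfolding atLeast0LessThan by blast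
  have hT: "h l \<in> T" if "l < card T" for l using h that by (auto simp: bij_betw_def)
  have inj: "h i = h l \<longleftrightarrow> i = l" if "i < card T" "l < card T" for i l
    using h that by (auto simp: bij_betw_def inj_on_def)
  obtain p where p: "\<And>u. u \<in> T \<Longrightarrow> p \<notin> H u" using shat[of "{}"] by auto
  obtain q where q: "\<And>u. u \<in> T \<Longrightarrow> q \<in> H u" using shat[of T] by auto
  have "\<forall>v\<in>T. \<exists>z. \<forall>u\<in>T. z \<in> H u \<longleftrightarrow> u = v" using shat[of "{_}"] by auto
  then obtain e where e: "\<And>v u. v \<in> T \<Longrightarrow> u \<in> T \<Longrightarrow> e v \<in> H u \<longleftrightarrow> u = v" by metis
  have "cube_embeds (card T) ty"
  proof (rule cube_embedsI)
    show "H (h l) \<in> separating p q" if "l < card T" for l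
      using H p q hT[OF that] by (simp add: separating_def)
    show "e (h i) \<in> H (h l) \<longleftrightarrow> i = l" if "i < card T" "l < card T" for i l
      using e[OF hT hT, OF that] inj[OF that] by auto
  qed
  then show ?thesis using rank by blast
qed

text \<open>The cells are indexed by the patterns of threshold halfspaces to which a point of
  \<open>X\<close> belongs. Sauer--Shelah counts the patterns, and density of \<open>X\<close>
  carries the cells over to the closure.\<close>

lemma polynomial_covering_rf:
  assumes rank: "\<forall>k. cube_embeds k ty \<longrightarrow> k \<le> n"
  shows "polynomial_covering rf_space rf_median_functions"
  unfolding polynomial_covering_def
proof (intro allI impI)
  fix \<delta> :: real assume "0 < \<delta>"
  \<comment> \<open>Three errors add up: from either point of the closure to \<open>X\<close>, and
    between two points of \<open>X\<close> with equal patterns.\<close>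
  define \<eta> where "\<eta> = \<delta> / 3"
  have \<eta>: "0 < \<eta>" using \<open>0 < \<delta>\<close> by (simp add: \<eta>_def)
  \<comment> \<open>The thresholds \<open>\<theta> j\<close> with \<open>j < r\<close> form a grid
    of mesh \<open>\<eta>\<close> from \<open>-1\<close> up to at least \<open>1\<close>.\<close>
  define r where "r = nat \<lceil>2 / \<eta>\<rceil> + 1"
  define \<theta> where "\<theta> j = -1 + real j * \<eta>" for j
  show "\<exists>D. \<forall>\<Phi>\<subseteq>rf_median_functions. finite \<Phi> \<longrightarrow>
     coverable rf_space \<Phi> \<delta> (D * (card \<Phi> + 1) ^ D)"
  \<comment> \<open>The coefficient \<open>r ^ n\<close> and the degree \<open>n\<close> are merged
    into one constant dominating both.\<close>
  proof (intro exI[of _ "r ^ n + n"] allI impI)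
    fix \<Phi> assume \<Phi>: "\<Phi> \<subseteq> rf_median_functions" and fin: "finite \<Phi>"
    define U where "U = \<Phi> \<times> {..<r}"
    define H where "H = (\<lambda>(\<phi>, j). {z :: 'a. \<phi> (rf_map z) > \<theta> j})"
    define pat where "pat z = {u \<in> U. z \<in> H u}" for z
    define A where "A = range pat"
    have half: "halfspace (H u)" if uU: "u \<in> U" for u
    proof -
      obtain \<phi> j where u: "u = (\<phi>, j)" "\<phi> \<in> \<Phi>" using uU by (auto simp: U_def)
      have hom: "min (\<phi> (rf_map a)) (\<phi> (rf_map b)) \<le> \<phi> (rf_map (med a b c)) \<and>
          \<phi> (rf_map (med a b c)) \<le> max (\<phi> (rf_map a)) (\<phi> (rf_map b))" for a b c
        using \<Phi> u(2) by (auto simp: rf_median_functions_def)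
      show ?thesis
      proof (rule halfspaceI)
        fix a b c
        show "med a b c \<in> H u" if "a \<in> H u" "b \<in> H u"
          using that hom[of a b c] by (auto simp: u H_def min_def split: if_splits)
        show "med a b c \<notin> H u" if "a \<notin> H u" "b \<notin> H u"
          using that hom[of a b c] by (auto simp: u H_def max_def split: if_splits)
      qed
    qed
    have finU: "finite U" using fin by (simp add: U_def)
    have "card A \<le> (card U + 1) ^ n"
    proof (rule sauer_shelah[OF finU])
      show "A \<subseteq> Pow U" by (auto simp: A_def pat_def)
      fix T assume T: "T \<subseteq> U" "shatters A T"
      show "card T \<le> n"
      proof (rule shattered_halfspaces_card[OF rank, where H = H])
        show "finite T" using T(1) finU finite_subset by blast
        fix S assume "S \<subseteq> T"
        then obtain z where "pat z \<inter> T = S" using T(2) by (auto simp: shatters_def A_def)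
        then show "\<exists>z. \<forall>u\<in>T. z \<in> H u \<longleftrightarrow> u \<in> S" using T(1) by (auto simp: pat_def)
      qed (use half T(1) in blast)
    qed
    moreover have "card U + 1 \<le> r * (card \<Phi> + 1)" by (simp add: U_def card_cartesian_product r_def)
    ultimately have "card A \<le> (r * (card \<Phi> + 1)) ^ n"
      by (meson le_trans power_mono zero_le)
    also have "\<dots> = r ^ n * (card \<Phi> + 1) ^ n" by (rule power_mult_distrib)
    also have "\<dots> \<le> (r ^ n + n) * (card \<Phi> + 1) ^ (r ^ n + n)"
      by (intro mult_mono power_increasing) auto
    finally have cardA: "card A \<le> (r ^ n + n) * (card \<Phi> + 1) ^ (r ^ n + n)" .
    have finA: "finite A"
      using finU by (intro finite_subset[of A "Pow U"]) (auto simp: A_def pat_def)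
    define P where "P \<alpha> = {x \<in> rf_space. \<exists>z. pat z = \<alpha> \<and> (\<forall>\<phi>\<in>\<Phi>. \<bar>\<phi> x - \<phi> (rf_map z)\<bar> \<le> \<eta>)}" for \<alpha>
    have rf_map_in: "rf_map z \<in> rf_space" for z :: 'a
      unfolding rf_space_def by (rule subsetD[OF closure_subset rangeI])
    have close: "\<phi> (rf_map z) - \<phi> (rf_map z') \<le> \<eta>" if pat: "pat z = pat z'" and \<phi>: "\<phi> \<in> \<Phi>" for z z' \<phi>
    proof (rule ccontr)
      assume "\<not> ?thesis"
      then have gt: "\<phi> (rf_map z) > \<phi> (rf_map z') + \<eta>" by simp
      have b: "\<bar>\<phi> (rf_map z)\<bar> \<le> 1" "\<bar>\<phi> (rf_map z')\<bar> \<le> 1"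
        using \<Phi> \<phi> rf_map_in by (auto simp: rf_median_functions_def)
      define j where "j = nat \<lceil>(\<phi> (rf_map z') + 1) / \<eta>\<rceil>"
      have j: "(\<phi> (rf_map z') + 1) / \<eta> \<le> real j" "real j < (\<phi> (rf_map z') + 1) / \<eta> + 1"
      proof -
        have "0 \<le> (\<phi> (rf_map z') + 1) / \<eta>" using b \<eta> by simp
        then have "real j = real_of_int \<lceil>(\<phi> (rf_map z') + 1) / \<eta>\<rceil>" by (simp add: j_def)
        then show "(\<phi> (rf_map z') + 1) / \<eta> \<le> real j" "real j < (\<phi> (rf_map z') + 1) / \<eta> + 1"
          by linarith+
      qed
      have "\<phi> (rf_map z') \<le> \<theta> j" using j(1) \<eta> by (simp add: \<theta>_def divide_le_eq)
      moreover have "\<theta> j < \<phi> (rf_map z)"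
      proof -
        have "real j * \<eta> < ((\<phi> (rf_map z') + 1) / \<eta> + 1) * \<eta>"
          using j(2) \<eta> by (intro mult_strict_right_mono)
        also have "\<dots> = \<phi> (rf_map z') + 1 + \<eta>" using \<eta> by (simp add: field_simps)
        finally show ?thesis using gt by (simp add: \<theta>_def)
      qed
      moreover have "j < r"
      proof -
        have "(\<phi> (rf_map z') + 1) / \<eta> \<le> 2 / \<eta>"
          using b \<eta> by (intro divide_right_mono) auto
        then show ?thesis
          unfolding j_def r_def using nat_mono[OF ceiling_mono] by (metis Suc_eq_plus1 le_imp_less_Suc)
      qed
      ultimately have "(\<phi>, j) \<in> pat z" "(\<phi>, j) \<notin> pat z'" using \<phi> by (auto simp: pat_def U_def H_def)
      then show False using pat by simp
    qed
    show "coverable rf_space \<Phi> \<delta> ((r ^ n + n) * (card \<Phi> + 1) ^ (r ^ n + n))"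
      unfolding coverable_def
    proof (intro exI[of _ "P ` A"] conjI ballI)
      show "finite (P ` A)" using finA by simp
      show "card (P ` A) \<le> (r ^ n + n) * (card \<Phi> + 1) ^ (r ^ n + n)"
        using card_image_le[OF finA, of P] cardA by (rule le_trans)
    next
      show "rf_space \<subseteq> \<Union> (P ` A)"
      proof
        fix x :: "'a \<times> 'a \<Rightarrow> 'a" assume x: "x \<in> rf_space"
        have "openin (top_of_set rf_space) (\<Inter>\<phi>\<in>\<Phi>. {y \<in> rf_space. \<phi> y \<in> ball (\<phi> x) \<eta>})" if "\<Phi> \<noteq> {}"
        proof (rule openin_INT2[OF fin that])
          fix \<phi> assume "\<phi> \<in> \<Phi>"
          then have "continuous_on rf_space \<phi>" using \<Phi> by (auto simp: rf_median_functions_def)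
          then show "openin (top_of_set rf_space) {y \<in> rf_space. \<phi> y \<in> ball (\<phi> x) \<eta>}"
            using continuous_openin_preimage_gen[of rf_space \<phi> "ball (\<phi> x) \<eta>"]
            by (simp add: vimage_def Int_def conj_commute)
        qed
        then obtain W where W: "open W" "x \<in> W" "\<And>y \<phi>. y \<in> W \<Longrightarrow> y \<in> rf_space \<Longrightarrow> \<phi> \<in> \<Phi> \<Longrightarrow> \<phi> y \<in> ball (\<phi> x) \<eta>"
        proof (cases "\<Phi> = {}")
          case False
          then obtain W where "open W" "(\<Inter>\<phi>\<in>\<Phi>. {y \<in> rf_space. \<phi> y \<in> ball (\<phi> x) \<eta>}) = rf_space \<inter> W"
            using \<open>\<Phi> \<noteq> {} \<Longrightarrow> openin _ _\<close> unfolding openin_open by blast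
          then show ?thesis using x \<eta> by (intro that[of W]) auto
        qed (use that[of UNIV] in auto)
        then have "W \<inter> range rf_map \<noteq> {}"
          using x open_Int_closure_eq_empty[of W "range rf_map"] by (auto simp: rf_space_def)
        then obtain z where "rf_map z \<in> W" by blast
        then have "\<bar>\<phi> x - \<phi> (rf_map z)\<bar> \<le> \<eta>" if "\<phi> \<in> \<Phi>" for \<phi>
          using W(3)[OF _ rf_map_in that, of z] by (simp add: dist_real_def)
        then have "x \<in> P (pat z)" using x by (auto simp: P_def)
        then show "x \<in> \<Union> (P ` A)" by (auto simp: A_def)
      qed
    next
      fix Q x y f assume "Q \<in> P ` A" and xy: "x \<in> Q" "y \<in> Q" and f: "f \<in> \<Phi>"
      then obtain \<alpha> where "Q = P \<alpha>" by blast
      have near: "\<exists>z. pat z = \<alpha> \<and> \<bar>f w - f (rf_map z)\<bar> \<le> \<eta>" if "w \<in> Q" for w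
        using that f unfolding \<open>Q = P \<alpha>\<close> P_def by blast
      obtain z z' where z: "pat z = \<alpha>" "\<bar>f x - f (rf_map z)\<bar> \<le> \<eta>"
        "pat z' = \<alpha>" "\<bar>f y - f (rf_map z')\<bar> \<le> \<eta>"
        using near[OF xy(1)] near[OF xy(2)] by blast
      have "\<delta> = \<eta> + \<eta> + \<eta>" by (simp add: \<eta>_def)
      moreover have "f (rf_map z) - f (rf_map z') \<le> \<eta>" "f (rf_map z') - f (rf_map z) \<le> \<eta>"
        using close f z by simp_all
      ultimately show "\<bar>f x - f y\<bar> \<le> \<delta>"
        using z by linarith
    qed
  qed
qed

end

section \<open>Rademacher averages\<close>

definition subset_sign :: "nat set \<Rightarrow> nat \<Rightarrow> real" where
  "subset_sign E i = (if i \<in> E then 1 else - 1)"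

lemma abs_subset_sign [simp]: "\<bar>subset_sign E i\<bar> = 1"
  by (simp add: subset_sign_def)

text \<open>For \<open>0 \<le> s \<le> 1\<close> the bounds
  \<open>exp s \<le> 1 + s + s\<^sup>2\<close> and
  \<open>exp (- s) \<le> 1 / (1 + s) \<le> 1 - s + s\<^sup>2\<close> add up to
  \<open>2 * (1 + s\<^sup>2)\<close>.\<close>

lemma exp_add_exp_minus_le:
  fixes t :: real
  assumes "\<bar>t\<bar> \<le> 1"
  shows "exp t + exp (- t) \<le> 2 * exp (t\<^sup>2)"
proof -
  have *: "exp s + exp (- s) \<le> 2 * exp (s\<^sup>2)" if s: "0 \<le> s" "s \<le> 1" for s :: real
  proof -
    have "(1 + s) * (1 - s + s\<^sup>2) = 1 + s ^ 3"
      by (simp add: algebra_simps power2_eq_square power3_eq_cube)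
    then have "1 / (1 + s) \<le> 1 - s + s\<^sup>2"
      using s by (simp add: divide_le_eq mult.commute)
    moreover have "exp (- s) \<le> 1 / (1 + s)"
      using s exp_ge_add_one_self[of s] by (simp add: exp_minus inverse_eq_divide frac_le)
    ultimately have "exp (- s) \<le> 1 - s + s\<^sup>2" by linarith
    moreover have "exp s \<le> 1 + s + s\<^sup>2" using s by (rule exp_bound)
    ultimately show ?thesis using exp_ge_add_one_self[of "s\<^sup>2"] by linarith
  qed
  show ?thesis
    using *[of t] *[of "- t"] assms by (cases "0 \<le> t") auto
qed

text \<open>The exponential moment of a Rademacher sum: the sum over all sign sets factors into a
  product over the indices.\<close>

lemma sum_exp_signs_le:
  fixes y :: "nat \<Rightarrow> real"
  assumes "\<And>i. i < N \<Longrightarrow> \<bar>y i\<bar> \<le> 1" and s: "0 \<le> s" "s \<le> 1"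
  shows "(\<Sum>E\<in>Pow {..<N}. exp (s * (\<Sum>i<N. subset_sign E i * y i))) \<le> 2 ^ N * exp (s\<^sup>2 * N)"
proof -
  have "(\<Sum>E\<in>Pow {..<N}. exp (s * (\<Sum>i<N. subset_sign E i * y i))) =
      (\<Sum>E\<in>Pow {..<N}. (\<Prod>i\<in>E. exp (s * y i)) * (\<Prod>i\<in>{..<N} - E. exp (- (s * y i))))"
  proof (rule sum.cong[OF refl])
    fix E assume "E \<in> Pow {..<N}"
    then have E: "E \<subseteq> {..<N}" "finite E" using finite_subset by auto
    have "s * (\<Sum>i<N. subset_sign E i * y i) = (\<Sum>i<N. subset_sign E i * (s * y i))"
      by (simp add: sum_distrib_left mult_ac)
    also have "\<dots> = (\<Sum>i\<in>{..<N} - E. subset_sign E i * (s * y i)) + (\<Sum>i\<in>E. subset_sign E i * (s * y i))"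
      by (rule sum.subset_diff[OF E(1)]) simp
    also have "\<dots> = (\<Sum>i\<in>E. s * y i) + (\<Sum>i\<in>{..<N} - E. - (s * y i))"
      by (simp add: subset_sign_def)
    finally show "exp (s * (\<Sum>i<N. subset_sign E i * y i)) =
        (\<Prod>i\<in>E. exp (s * y i)) * (\<Prod>i\<in>{..<N} - E. exp (- (s * y i)))"
      using E by (simp add: exp_add exp_sum)
  qed
  also have "\<dots> = (\<Prod>i<N. exp (s * y i) + exp (- (s * y i)))"
    by (rule prod_add[symmetric]) simp
  also have "\<dots> \<le> (\<Prod>i<N. 2 * exp (s\<^sup>2))"
  proof (rule prod_mono)
    fix i assume "i \<in> {..<N}"
    then have y: "\<bar>y i\<bar> \<le> 1" using assms by simp
    have "\<bar>s * y i\<bar> \<le> s * 1"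
      unfolding abs_mult using y s by (intro mult_mono) auto
    then have a: "\<bar>s * y i\<bar> \<le> s" by simp
    then have "exp (s * y i) + exp (- (s * y i)) \<le> 2 * exp ((s * y i)\<^sup>2)"
      using s by (intro exp_add_exp_minus_le) auto
    also have "(s * y i)\<^sup>2 \<le> s\<^sup>2"
      using a by (metis abs_le_square_iff abs_of_nonneg s(1))
    finally show "0 \<le> exp (s * y i) + exp (- (s * y i)) \<and> exp (s * y i) + exp (- (s * y i)) \<le> 2 * exp (s\<^sup>2)"
      by (simp add: add_nonneg_nonneg)
  qed
  also have "\<dots> = 2 ^ N * exp (s\<^sup>2 * N)"
    by (simp add: power_mult_distrib exp_of_nat2_mult)
  finally show ?thesis .
qed

text \<open>Chernoff's bound at \<open>s = \<delta> / 2\<close>, which minimizes the exponent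
  \<open>s\<^sup>2 - s * \<delta>\<close>. The two tails give the factor \<open>2\<close>.\<close>

lemma card_signs_large_le:
  fixes y :: "nat \<Rightarrow> real"
  assumes "\<And>i. i < N \<Longrightarrow> \<bar>y i\<bar> \<le> 1" and \<delta>: "0 \<le> \<delta>" "\<delta> \<le> 1"
  shows "real (card {E \<in> Pow {..<N}. \<delta> * N < \<bar>\<Sum>i<N. subset_sign E i * y i\<bar>})
    \<le> 2 * (2 ^ N * exp (- (\<delta>\<^sup>2 / 4) * N))"
proof -
  have one: "real (card {E \<in> Pow {..<N}. \<delta> * N < (\<Sum>i<N. subset_sign E i * z i)})
    \<le> 2 ^ N * exp (- (\<delta>\<^sup>2 / 4) * N)" if z: "\<And>i. i < N \<Longrightarrow> \<bar>z i\<bar> \<le> 1" for z :: "nat \<Rightarrow> real"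
  proof -
    let ?X = "{E \<in> Pow {..<N}. \<delta> * N < (\<Sum>i<N. subset_sign E i * z i)}"
    let ?e = "\<lambda>E. exp (\<delta> / 2 * (\<Sum>i<N. subset_sign E i * z i))"
    have "real (card ?X) * exp (\<delta> / 2 * (\<delta> * N)) = (\<Sum>E\<in>?X. exp (\<delta> / 2 * (\<delta> * N)))" by simp
    also have "\<dots> \<le> (\<Sum>E\<in>?X. ?e E)"
      using \<delta> by (intro sum_mono) (auto intro!: mult_left_mono)
    also have "\<dots> \<le> (\<Sum>E\<in>Pow {..<N}. ?e E)"
      by (intro sum_mono2) auto
    also have "\<dots> \<le> 2 ^ N * exp ((\<delta> / 2)\<^sup>2 * N)"
      using \<delta> by (intro sum_exp_signs_le z) auto
    finally have "real (card ?X) \<le> 2 ^ N * exp ((\<delta> / 2)\<^sup>2 * N) / exp (\<delta> / 2 * (\<delta> * N))"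
      by (simp add: le_divide_eq)
    also have "\<dots> = 2 ^ N * exp (- (\<delta>\<^sup>2 / 4) * N)"
    proof -
      have "(\<delta> / 2)\<^sup>2 * N - \<delta> / 2 * (\<delta> * N) = - (\<delta>\<^sup>2 / 4) * N"
        by (simp add: power2_eq_square field_simps)
      then show ?thesis by (metis exp_diff times_divide_eq_right)
    qed
    finally show ?thesis .
  qed
  have "{E \<in> Pow {..<N}. \<delta> * N < \<bar>\<Sum>i<N. subset_sign E i * y i\<bar>} \<subseteq>
     {E \<in> Pow {..<N}. \<delta> * N < (\<Sum>i<N. subset_sign E i * y i)} \<union>
     {E \<in> Pow {..<N}. \<delta> * N < (\<Sum>i<N. subset_sign E i * (- y i))}"
    by (auto simp: sum_negf abs_if split: if_splits)
  then have "card {E \<in> Pow {..<N}. \<delta> * N < \<bar>\<Sum>i<N. subset_sign E i * y i\<bar>} \<le>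
     card ({E \<in> Pow {..<N}. \<delta> * N < (\<Sum>i<N. subset_sign E i * y i)} \<union>
     {E \<in> Pow {..<N}. \<delta> * N < (\<Sum>i<N. subset_sign E i * (- y i))})"
    by (intro card_mono) auto
  also have "\<dots> \<le> card {E \<in> Pow {..<N}. \<delta> * N < (\<Sum>i<N. subset_sign E i * y i)} +
     card {E \<in> Pow {..<N}. \<delta> * N < (\<Sum>i<N. subset_sign E i * (- y i))}"
    by (rule card_Un_le)
  finally have "real (card {E \<in> Pow {..<N}. \<delta> * N < \<bar>\<Sum>i<N. subset_sign E i * y i\<bar>}) \<le>
     real (card {E \<in> Pow {..<N}. \<delta> * N < (\<Sum>i<N. subset_sign E i * y i)}) +
     real (card {E \<in> Pow {..<N}. \<delta> * N < (\<Sum>i<N. subset_sign E i * (- y i))})"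
    by linarith
  also have "\<dots> \<le> 2 ^ N * exp (- (\<delta>\<^sup>2 / 4) * N) + 2 ^ N * exp (- (\<delta>\<^sup>2 / 4) * N)"
    using assms(1) by (intro add_mono one) auto
  finally show ?thesis by simp
qed

lemma eventually_polynomial_exp_le:
  fixes c \<epsilon> :: real
  assumes "0 < c" "0 < \<epsilon>"
  shows "eventually (\<lambda>N. D * (real N + 1) ^ k * exp (- c * N) \<le> \<epsilon>) sequentially"
proof -
  have "filterlim (\<lambda>N. c * (real N + 1)) at_top sequentially"
    using assms(1)
    using filterlim_compose[OF filterlim_real_sequentially filterlim_Suc]
    by (intro filterlim_tendsto_pos_mult_at_top[OF tendsto_const]) (auto simp: add.commute)
  from filterlim_compose[OF tendsto_power_div_exp_0[of k] this]
  have "(\<lambda>N. D * exp c / c ^ k * ((c * (real N + 1)) ^ k / exp (c * (real N + 1)))) \<longlonglongrightarrow> D * exp c / c ^ k * 0"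
    by (intro tendsto_intros)
  moreover have "D * exp c / c ^ k * ((c * (real N + 1)) ^ k / exp (c * (real N + 1))) =
      D * (real N + 1) ^ k * exp (- c * N)" for N
  proof -
    have "exp (c * (real N + 1)) = exp c * exp (c * N)" "exp (- c * N) = 1 / exp (c * N)"
      by (simp_all add: distrib_left exp_add mult.commute exp_minus inverse_eq_divide)
    then show ?thesis unfolding power_mult_distrib using assms(1) by simp
  qed
  ultimately have "(\<lambda>N. D * (real N + 1) ^ k * exp (- c * N)) \<longlonglongrightarrow> 0" by simp
  then have "eventually (\<lambda>N. D * (real N + 1) ^ k * exp (- c * N) < \<epsilon>) sequentially"
    using assms(2) by (rule order_tendstoD)
  then show ?thesis by (rule eventually_mono) simp
qed

text \<open>Polynomial covering numbers are beaten by the Chernoff bound for a single point.\<close>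

lemma rademacher_average_small:
  fixes m :: real
  assumes cov: "polynomial_covering B F" and bounded: "\<forall>f\<in>F. \<forall>x\<in>B. \<bar>f x\<bar> \<le> 1"
    and "0 < m"
  shows "\<exists>N\<ge>1. \<forall>f x. (\<forall>i<N. f i \<in> F) \<longrightarrow> (\<forall>E. x E \<in> B) \<longrightarrow>
    (\<Sum>E\<in>Pow {..<N}. \<bar>\<Sum>i<N. subset_sign E i * f i (x E)\<bar>) \<le> m * N * 2 ^ N"
proof -
  \<comment> \<open>Good sign sets have sums of at most \<open>2 * \<delta> * N\<close>; bad ones, a
    proportion of at most \<open>\<delta>\<close>, have sums of at most \<open>N\<close>. The cap at
    \<open>1\<close> is for Chernoff's bound.\<close>
  define \<delta> where "\<delta> = min (m / 3) 1"
  have \<delta>: "0 < \<delta>" "\<delta> \<le> 1" "3 * \<delta> \<le> m" using \<open>0 < m\<close> by (auto simp: \<delta>_def min_def)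
  from cov[unfolded polynomial_covering_def, rule_format, OF \<delta>(1)]
  obtain D where D: "\<forall>\<Phi>\<subseteq>F. finite \<Phi> \<longrightarrow> coverable B \<Phi> \<delta> (D * (card \<Phi> + 1) ^ D)" ..
  have "eventually (\<lambda>N. (2 * real D) * (real N + 1) ^ D * exp (- (\<delta>\<^sup>2 / 4) * N) \<le> \<delta>) sequentially"
    using \<delta> by (intro eventually_polynomial_exp_le) auto
  then have "eventually (\<lambda>N. N \<ge> 1 \<and> (2 * real D) * (real N + 1) ^ D * exp (- (\<delta>\<^sup>2 / 4) * N) \<le> \<delta>) sequentially"
    using eventually_ge_at_top[of 1] by eventually_elim simp
  then obtain N where N: "N \<ge> 1" "(2 * real D) * (real N + 1) ^ D * exp (- (\<delta>\<^sup>2 / 4) * N) \<le> \<delta>"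
    by (auto simp: eventually_sequentially)
  show ?thesis
  proof (intro exI[of _ N] conjI allI impI)
    fix f and x :: "nat set \<Rightarrow> 'a" assume f: "\<forall>i<N. f i \<in> F" and x: "\<forall>E. x E \<in> B"
    define \<Phi> where "\<Phi> = f ` {..<N}"
    have \<Phi>: "\<Phi> \<subseteq> F" "finite \<Phi>" using f by (auto simp: \<Phi>_def)
    have "card \<Phi> \<le> N" using card_image_le[of "{..<N}" f] by (simp add: \<Phi>_def)
    from D[rule_format, OF \<Phi>, unfolded coverable_def]
    obtain \<P> where \<P>: "finite \<P>" "card \<P> \<le> D * (card \<Phi> + 1) ^ D" "B \<subseteq> \<Union>\<P>"
       "\<forall>P\<in>\<P>. \<forall>x\<in>P. \<forall>y\<in>P. \<forall>f\<in>\<Phi>. \<bar>f x - f y\<bar> \<le> \<delta>"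
      by (elim exE conjE) (rule that)
    have card\<P>: "real (card \<P>) \<le> real D * (real N + 1) ^ D"
    proof -
      have "card \<P> \<le> D * (N + 1) ^ D"
        using \<P>(2) \<open>card \<Phi> \<le> N\<close> by (meson add_le_mono1 le_trans mult_le_mono2 power_mono zero_le)
      then have "real (card \<P>) \<le> real (D * (N + 1) ^ D)" by (rule of_nat_mono)
      then show ?thesis by (simp add: add.commute)
    qed
    \<comment> \<open>Since \<open>x E\<close> varies with \<open>E\<close>, Chernoff's bound is
      applied to one fixed representative of each cell, and the polynomially many bad events are
      united.\<close>
    define \<Q> where "\<Q> = {P \<in> \<P>. P \<inter> B \<noteq> {}}"
    have "\<forall>P\<in>\<Q>. \<exists>y. y \<in> P \<inter> B" by (auto simp: \<Q>_def)
    then obtain rep where rep: "\<And>P. P \<in> \<Q> \<Longrightarrow> rep P \<in> P \<inter> B" by metis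
    define S where "S E y = (\<Sum>i<N. subset_sign E i * f i y)" for E y
    define bad where "bad = (\<Union>P\<in>\<Q>. {E \<in> Pow {..<N}. \<delta> * N < \<bar>S E (rep P)\<bar>})"
    have "bad \<subseteq> Pow {..<N}" by (auto simp: bad_def)
    have "finite \<Q>" "card \<Q> \<le> card \<P>" using \<P>(1) by (auto simp: \<Q>_def intro: card_mono)
    have "real (card bad) \<le> (\<Sum>P\<in>\<Q>. real (card {E \<in> Pow {..<N}. \<delta> * N < \<bar>S E (rep P)\<bar>}))"
      unfolding bad_def of_nat_sum[symmetric] of_nat_le_iff
      by (rule card_UN_le[OF \<open>finite \<Q>\<close>])
    also have "\<dots> \<le> (\<Sum>P\<in>\<Q>. 2 * (2 ^ N * exp (- (\<delta>\<^sup>2 / 4) * N)))"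
      unfolding S_def using f rep \<delta> bounded by (intro sum_mono card_signs_large_le) auto
    also have "\<dots> = real (card \<Q>) * (2 * (2 ^ N * exp (- (\<delta>\<^sup>2 / 4) * N)))" by simp
    also have "\<dots> \<le> real D * (real N + 1) ^ D * (2 * (2 ^ N * exp (- (\<delta>\<^sup>2 / 4) * N)))"
      using card\<P> \<open>card \<Q> \<le> card \<P>\<close> by (intro mult_right_mono) auto
    also have "\<dots> = 2 ^ N * ((2 * real D) * (real N + 1) ^ D * exp (- (\<delta>\<^sup>2 / 4) * N))"
      by (simp add: mult_ac)
    also have "\<dots> \<le> 2 ^ N * \<delta>" using N(2) by (intro mult_left_mono) auto
    finally have bad: "real (card bad) \<le> 2 ^ N * \<delta>" .
    have le: "\<bar>S E (x E)\<bar> \<le> 2 * \<delta> * N + (if E \<in> bad then real N else 0)" if E: "E \<in> Pow {..<N}" for E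
    proof (cases "E \<in> bad")
      case True
      have "\<bar>S E (x E)\<bar> \<le> (\<Sum>i<N. \<bar>subset_sign E i * f i (x E)\<bar>)" unfolding S_def by (rule sum_abs)
      also have "\<dots> \<le> (\<Sum>i<N. 1)" using f x bounded by (intro sum_mono) (auto simp: abs_mult)
      finally have "\<bar>S E (x E)\<bar> \<le> N" by simp
      moreover have "0 \<le> 2 * \<delta> * N" using \<delta>(1) by simp
      ultimately show ?thesis using True by (simp only: if_True)
    next
      case False
      obtain P where P: "P \<in> \<P>" "x E \<in> P" using \<P>(3) x by blast
      then have PQ: "P \<in> \<Q>" using x by (auto simp: \<Q>_def)
      have "\<bar>S E (rep P)\<bar> \<le> \<delta> * N" using False PQ E by (auto simp: bad_def)
      moreover have "\<bar>S E (x E) - S E (rep P)\<bar> \<le> (\<Sum>i<N. \<bar>subset_sign E i * (f i (x E) - f i (rep P))\<bar>)"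
        unfolding S_def sum_subtractf[symmetric] right_diff_distrib[symmetric] by (rule sum_abs)
      moreover have "\<dots> \<le> (\<Sum>i<N. \<delta>)"
        using \<P>(4) P rep[OF PQ] by (intro sum_mono) (auto simp: abs_mult \<Phi>_def)
      moreover have "(\<Sum>i<N. \<delta>) = \<delta> * N" by simp
      ultimately have "\<bar>S E (x E)\<bar> \<le> 2 * (\<delta> * N)" by linarith
      then show ?thesis using False by simp
    qed
    have "(\<Sum>E\<in>Pow {..<N}. \<bar>\<Sum>i<N. subset_sign E i * f i (x E)\<bar>) = (\<Sum>E\<in>Pow {..<N}. \<bar>S E (x E)\<bar>)"
      by (simp add: S_def)
    also have "\<dots> \<le> (\<Sum>E\<in>Pow {..<N}. 2 * \<delta> * N + (if E \<in> bad then real N else 0))"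
      by (intro sum_mono le)
    also have "\<dots> = 2 ^ N * (2 * \<delta> * N) + card bad * real N"
    proof -
      have "(\<Sum>E\<in>Pow {..<N}. if E \<in> bad then real N else 0) = (\<Sum>E\<in>bad. real N)"
        using \<open>bad \<subseteq> Pow {..<N}\<close> by (intro sum.mono_neutral_cong_right) auto
      then show ?thesis by (simp add: sum.distrib card_Pow)
    qed
    also have "\<dots> \<le> 2 ^ N * (2 * \<delta> * N) + 2 ^ N * \<delta> * real N"
      using bad by (intro add_left_mono mult_right_mono) auto
    also have "\<dots> = (3 * \<delta>) * (N * 2 ^ N)" by (simp add: algebra_simps)
    also have "\<dots> \<le> m * (N * 2 ^ N)" using \<delta>(3) by (intro mult_right_mono) auto
    finally show "(\<Sum>E\<in>Pow {..<N}. \<bar>\<Sum>i<N. subset_sign E i * f i (x E)\<bar>) \<le> m * N * 2 ^ N"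
      by (simp add: mult_ac)
  qed (rule N)
qed

inductive_set function_hull :: "('k \<Rightarrow> real) set \<Rightarrow> ('k \<Rightarrow> real) set" for F where
  base: "f \<in> F \<Longrightarrow> f \<in> function_hull F"
| comb: "u \<in> function_hull F \<Longrightarrow> w \<in> function_hull F \<Longrightarrow> 0 \<le> t \<Longrightarrow> t \<le> 1 \<Longrightarrow>
    (\<lambda>x. t * u x + (1 - t) * w x) \<in> function_hull F"

text \<open>For a fixed choice of points, the average is convex in each function separately, so it is
  maximised over the hull at the generators.\<close>

lemma rademacher_average_hull:
  assumes F: "\<And>f. \<forall>i<N. f i \<in> F \<Longrightarrow>
      (\<Sum>E\<in>Pow {..<N}. \<bar>\<Sum>i<N. subset_sign E i * f i (x E)\<bar>) \<le> M"
    and "\<forall>i<N. g i \<in> function_hull F"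
  shows "(\<Sum>E\<in>Pow {..<N}. \<bar>\<Sum>i<N. subset_sign E i * g i (x E)\<bar>) \<le> M"
proof -
  define \<Psi> where "\<Psi> g = (\<Sum>E\<in>Pow {..<N}. \<bar>\<Sum>i<N. subset_sign E i * g i (x E)\<bar>)" for g
  \<comment> \<open>Slots below \<open>j\<close> range over the hull, the others still over the
    generators; one slot is released at a time.\<close>
  have "\<forall>g. (\<forall>i<j. g i \<in> function_hull F) \<and> (\<forall>i. j \<le> i \<and> i < N \<longrightarrow> g i \<in> F) \<longrightarrow> \<Psi> g \<le> M"
    if "j \<le> N" for j
    using that
  proof (induction j)
    case 0
    then show ?case using F by (simp add: \<Psi>_def)
  next
    case (Suc j)
    show ?case
    proof (intro allI impI)
      fix g assume g: "(\<forall>i<Suc j. g i \<in> function_hull F) \<and> (\<forall>i. Suc j \<le> i \<and> i < N \<longrightarrow> g i \<in> F)"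
      have "\<Psi> (g(j := u)) \<le> M" if "u \<in> function_hull F" for u
        using that
      proof (induction u rule: function_hull.induct)
        case (base f)
        have "(\<forall>i<j. (g(j := f)) i \<in> function_hull F) \<and> (\<forall>i. j \<le> i \<and> i < N \<longrightarrow> (g(j := f)) i \<in> F)"
          using g base by (simp add: Suc_le_eq)
        moreover have "j \<le> N" using Suc.prems by simp
        ultimately show ?case using Suc.IH by blast
      next
        case (comb u w t)
        let ?S = "\<lambda>u E. \<Sum>i<N. subset_sign E i * (g(j := u)) i (x E)"
        have "?S (\<lambda>x. t * u x + (1 - t) * w x) E = t * ?S u E + (1 - t) * ?S w E" for E
          unfolding sum_distrib_left sum.distrib[symmetric]
          by (intro sum.cong) (auto simp: algebra_simps)
        then have "\<bar>?S (\<lambda>x. t * u x + (1 - t) * w x) E\<bar> \<le> t * \<bar>?S u E\<bar> + (1 - t) * \<bar>?S w E\<bar>" for E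
          using abs_triangle_ineq[of "t * ?S u E" "(1 - t) * ?S w E"] comb.hyps(3,4) by (simp add: abs_mult)
        then have "\<Psi> (g(j := (\<lambda>x. t * u x + (1 - t) * w x))) \<le> t * \<Psi> (g(j := u)) + (1 - t) * \<Psi> (g(j := w))"
          unfolding \<Psi>_def sum_distrib_left sum.distrib[symmetric] by (intro sum_mono)
        also have "\<dots> \<le> t * M + (1 - t) * M"
          using comb.hyps(3,4) by (intro add_mono mult_left_mono comb.IH) simp_all
        also have "\<dots> = M" by (simp add: algebra_simps)
        finally show ?case .
      qed
      from this[of "g j"] show "\<Psi> g \<le> M" using g by simp
    qed
  qed
  moreover have "(\<forall>i<N. g i \<in> function_hull F) \<and> (\<forall>i. N \<le> i \<and> i < N \<longrightarrow> g i \<in> F)"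
    using assms(2) by auto
  ultimately show ?thesis unfolding \<Psi>_def by blast
qed

text \<open>If every sign set failed at some point, choosing such a point for each set would make
  the average too large. This is why the averages above let the point depend on the sign
  set.\<close>

lemma function_hull_small_signs:
  fixes m :: real
  assumes cov: "polynomial_covering B F" and bounded: "\<forall>f\<in>F. \<forall>x\<in>B. \<bar>f x\<bar> \<le> 1"
    and "0 < m"
  shows "\<exists>N\<ge>1. \<forall>g. (\<forall>i<N. g i \<in> function_hull F) \<longrightarrow>
    (\<exists>E. \<forall>x\<in>B. \<bar>\<Sum>i<N. subset_sign E i * g i x\<bar> \<le> m * N)"
proof -
  obtain N where N: "N \<ge> 1" "\<And>f x. \<lbrakk>\<forall>i<N. f i \<in> F; \<forall>E. x E \<in> B\<rbrakk> \<Longrightarrow>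
    (\<Sum>E\<in>Pow {..<N}. \<bar>\<Sum>i<N. subset_sign E i * f i (x E)\<bar>) \<le> m * N * 2 ^ N"
    using rademacher_average_small[OF assms] by blast
  show ?thesis
  proof (intro exI[of _ N] conjI allI impI)
    fix g assume g: "\<forall>i<N. g i \<in> function_hull F"
    show "\<exists>E. \<forall>x\<in>B. \<bar>\<Sum>i<N. subset_sign E i * g i x\<bar> \<le> m * N"
    proof (rule ccontr)
      assume "\<not> ?thesis"
      then have "\<forall>E. \<exists>x. x \<in> B \<and> m * N < \<bar>\<Sum>i<N. subset_sign E i * g i x\<bar>"
        by (simp add: not_le) blast
      then obtain x where x: "\<And>E. x E \<in> B" "\<And>E. m * N < \<bar>\<Sum>i<N. subset_sign E i * g i (x E)\<bar>"
        by metis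
      have "(\<Sum>E\<in>Pow {..<N}. m * N) < (\<Sum>E\<in>Pow {..<N}. \<bar>\<Sum>i<N. subset_sign E i * g i (x E)\<bar>)"
      proof (rule sum_strict_mono)
        show "finite (Pow {..<N})" by simp
        show "Pow {..<N} \<noteq> {}" by blast
      qed (rule x(2))
      also have "\<dots> \<le> m * N * 2 ^ N"
      proof (rule rademacher_average_hull[OF _ g])
        show "(\<Sum>E\<in>Pow {..<N}. \<bar>\<Sum>i<N. subset_sign E i * f i (x E)\<bar>) \<le> m * N * 2 ^ N"
          if "\<forall>i<N. f i \<in> F" for f
          using that by (rule N(2)) (simp add: x(1))
      qed
      also have "\<dots> = (\<Sum>E\<in>Pow {..<N}. m * N)" by (simp add: card_Pow)
      finally show False by simp
    qed
  qed (rule N)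
qed

section \<open>The interpolation space\<close>

lemma cring_real_ring: "cring real_ring"
proof (rule cringI)
  show "abelian_group real_ring"
    by (rule abelian_groupI) (auto simp: real_ring_def intro: exI[of _ "- _"])
  show "comm_monoid real_ring"
    by (rule comm_monoidI) (auto simp: real_ring_def)
qed (simp add: real_ring_def distrib_right)

text \<open>All that the functional analysis retains of the geometry; no medians occur from here
  on.\<close>

locale rosenthal_family =
  fixes B :: "'k::topological_space set" and F :: "('k \<Rightarrow> real) set"
    and act :: "'g::topological_group_add \<Rightarrow> 'k \<Rightarrow> 'k"
  assumes compact: "compact B"
    and F_continuous: "\<And>f. f \<in> F \<Longrightarrow> continuous_on B f"
    and F_bounded: "\<And>f x. f \<in> F \<Longrightarrow> x \<in> B \<Longrightarrow> \<bar>f x\<bar> \<le> 1"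
    and F_zero: "(\<lambda>_. 0) \<in> F"
    and F_uminus: "\<And>f. f \<in> F \<Longrightarrow> (\<lambda>x. - f x) \<in> F"
    and F_invariant: "\<And>f g. f \<in> F \<Longrightarrow> (\<lambda>x. f (act g x)) \<in> F"
    and F_separates: "\<And>x y. x \<in> B \<Longrightarrow> y \<in> B \<Longrightarrow> x \<noteq> y \<Longrightarrow> \<exists>f\<in>F. f x \<noteq> f y"
    and covering: "polynomial_covering B F"
    and action: "continuous_action act (top_of_set B)"
begin

abbreviation "W \<equiv> function_hull F"

lemma act_mem: "x \<in> B \<Longrightarrow> act g x \<in> B"
  using action unfolding continuous_action_def
  by (force simp: continuous_map_def Pi_iff)

lemma act_plus: "x \<in> B \<Longrightarrow> act (g + h) x = act g (act h x)"
  and act_0: "x \<in> B \<Longrightarrow> act 0 x = x"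
  using action unfolding continuous_action_def by auto

lemma act_inverse: "x \<in> B \<Longrightarrow> act g (act (- g) x) = x" "x \<in> B \<Longrightarrow> act (- g) (act g x) = x"
  using act_plus[of x g "- g"] act_plus[of x "- g" g] act_0 by simp_all

lemma continuous_act: "continuous_on (UNIV \<times> B) (\<lambda>z. act (fst z) (snd z))"
proof -
  have "prod_topology euclidean (top_of_set B) = top_of_set (UNIV \<times> B :: ('g \<times> 'k) set)"
    using prod_topology_subtopology_eu[of "UNIV :: 'g set" B] by simp
  then show ?thesis
    using action unfolding continuous_action_def
    by (simp add: case_prod_beta' continuous_map_in_subtopology)
qed

lemma continuous_act_left: "continuous_on B (act g)"
proof -
  have "continuous_on B (\<lambda>x. (g, x))" by (intro continuous_intros)
  from continuous_on_compose2[OF continuous_act this] show ?thesis by auto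
qed

lemma W_bounded:
  assumes "w \<in> W" "x \<in> B"
  shows "\<bar>w x\<bar> \<le> 1"
  using assms
proof (induction rule: function_hull.induct)
  case (base f)
  then show ?case by (simp add: F_bounded)
next
  case (comb u w t)
  have "\<bar>t * u x + (1 - t) * w x\<bar> \<le> t * \<bar>u x\<bar> + (1 - t) * \<bar>w x\<bar>"
    using abs_triangle_ineq[of "t * u x" "(1 - t) * w x"] comb.hyps by (simp add: abs_mult)
  also have "\<dots> \<le> t * 1 + (1 - t) * 1"
    using comb by (intro add_mono mult_left_mono) auto
  finally show ?case by simp
qed

lemma W_zero: "(\<lambda>_. 0) \<in> W"
  by (rule function_hull.base[OF F_zero])

lemma W_uminus: "w \<in> W \<Longrightarrow> (\<lambda>x. - w x) \<in> W"
proof (induction rule: function_hull.induct)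
  case (base f)
  then show ?case by (intro function_hull.base F_uminus)
next
  case (comb u w t)
  from function_hull.comb[OF comb.IH comb.hyps(3,4)]
  show ?case by (simp add: algebra_simps)
qed

lemma W_invariant: "w \<in> W \<Longrightarrow> (\<lambda>x. w (act g x)) \<in> W"
  by (induction rule: function_hull.induct)
    (auto intro: function_hull.base F_invariant function_hull.comb)

lemma W_scale:
  assumes "w \<in> W" "\<bar>c\<bar> \<le> 1"
  shows "(\<lambda>x. c * w x) \<in> W"
proof -
  have pos: "(\<lambda>x. c * u x) \<in> W" if "u \<in> W" "0 \<le> c" "c \<le> 1" for u c
    using function_hull.comb[OF that(1) W_zero that(2,3)] by simp
  show ?thesis
  proof (cases "0 \<le> c")
    case True
    then show ?thesis using pos assms by simp
  next
    case False
    then show ?thesis using pos[OF W_uminus[OF assms(1)], of "- c"] assms(2) by simp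
  qed
qed

text \<open>The \<open>n\<close>-th gauge interpolates between the hull and the supremum norm, as in the
  Davis--Figiel--Johnson--Pelczynski construction.\<close>

definition costs :: "nat \<Rightarrow> ('k \<Rightarrow> real) \<Rightarrow> real set" where
  "costs n v = {t / 2 ^ n + 2 ^ n * s | t s. 0 \<le> t \<and> 0 \<le> s \<and> (\<exists>w\<in>W. \<forall>x\<in>B. \<bar>v x - t * w x\<bar> \<le> s)}"

text \<open>Up to a factor of two on \<open>B\<close>, the Minkowski functional of
  \<open>2 ^ n\<close> times the hull plus \<open>1 / 2 ^ n\<close> times the supremum ball. Adding
  the two costs instead of taking their maximum gives a functional of the type used in real
  interpolation.\<close>

definition gauge :: "nat \<Rightarrow> ('k \<Rightarrow> real) \<Rightarrow> real" where
  "gauge n v = Inf (costs n v)"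

lemma gauge_cong: "(\<And>x. x \<in> B \<Longrightarrow> v x = u x) \<Longrightarrow> gauge n v = gauge n u"
  by (simp add: gauge_def costs_def)

lemma costs_nonneg: "c \<in> costs n v \<Longrightarrow> 0 \<le> c"
  by (auto simp: costs_def)

lemma gauge_le:
  assumes "0 \<le> t" "0 \<le> s" "w \<in> W" "\<And>x. x \<in> B \<Longrightarrow> \<bar>v x - t * w x\<bar> \<le> s"
  shows "gauge n v \<le> t / 2 ^ n + 2 ^ n * s"
  unfolding gauge_def
proof (rule cInf_lower)
  show "bdd_below (costs n v)" using costs_nonneg by (rule bdd_belowI)
qed (use assms in \<open>auto simp: costs_def\<close>)

lemma gauge_le_sup:
  assumes "0 \<le> s" "\<And>x. x \<in> B \<Longrightarrow> \<bar>v x\<bar> \<le> s"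
  shows "gauge n v \<le> 2 ^ n * s"
  using gauge_le[OF order_refl assms(1) W_zero, of v n] assms(2) by simp

lemma gauge_W: "w \<in> W \<Longrightarrow> gauge n w \<le> 1 / 2 ^ n"
  using gauge_le[of 1 0 w w n] by simp

lemma continuous_bounded:
  assumes "continuous_on B v"
  shows "\<exists>s\<ge>0::real. \<forall>x\<in>B. \<bar>v x\<bar> \<le> s"
proof -
  have "bounded (v ` B)" by (intro compact_imp_bounded compact_continuous_image assms compact)
  then obtain s where "\<forall>y\<in>v ` B. norm y \<le> s" unfolding bounded_iff by blast
  then have "\<bar>v x\<bar> \<le> \<bar>s\<bar>" if "x \<in> B" for x using that by fastforce
  then show ?thesis by (intro exI[of _ "\<bar>s\<bar>"]) simp
qed

lemma costs_nonempty:
  assumes "continuous_on B v"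
  shows "costs n v \<noteq> {}"
proof -
  obtain s where "0 \<le> s" "\<forall>x\<in>B. \<bar>v x\<bar> \<le> s" using continuous_bounded[OF assms] by blast
  then have "0 / 2 ^ n + 2 ^ n * s \<in> costs n v"
    using W_zero unfolding costs_def by fastforce
  then show ?thesis by blast
qed

lemma gauge_nonneg: "continuous_on B v \<Longrightarrow> 0 \<le> gauge n v"
  unfolding gauge_def by (intro cInf_greatest costs_nonempty costs_nonneg)

lemma gauge_lessE:
  assumes "continuous_on B v" "gauge n v < r"
  obtains t s w where "0 \<le> t" "0 \<le> s" "w \<in> W" "\<And>x. x \<in> B \<Longrightarrow> \<bar>v x - t * w x\<bar> \<le> s"
    "t / 2 ^ n + 2 ^ n * s < r"
  using cInf_lessD[OF costs_nonempty[OF assms(1)] assms(2)[unfolded gauge_def]] that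
  unfolding costs_def by blast

text \<open>By convexity, \<open>t * w + t' * w'\<close> is \<open>t + t'\<close> times a single
  member of the hull, so near-optimal decompositions can be added.\<close>

lemma gauge_add:
  assumes v: "continuous_on B v" and u: "continuous_on B u"
  shows "gauge n (\<lambda>x. v x + u x) \<le> gauge n v + gauge n u"
proof (rule field_le_epsilon)
  fix \<epsilon> :: real assume "0 < \<epsilon>"
  then obtain t s w where 1: "0 \<le> t" "0 \<le> s" "w \<in> W" "\<And>x. x \<in> B \<Longrightarrow> \<bar>v x - t * w x\<bar> \<le> s"
    "t / 2 ^ n + 2 ^ n * s < gauge n v + \<epsilon> / 2"
    by (elim gauge_lessE[OF v, of n "gauge n v + \<epsilon> / 2", rotated]) simp
  obtain t' s' w' where 2: "0 \<le> t'" "0 \<le> s'" "w' \<in> W" "\<And>x. x \<in> B \<Longrightarrow> \<bar>u x - t' * w' x\<bar> \<le> s'"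
    "t' / 2 ^ n + 2 ^ n * s' < gauge n u + \<epsilon> / 2"
    using \<open>0 < \<epsilon>\<close> by (elim gauge_lessE[OF u, of n "gauge n u + \<epsilon> / 2", rotated]) simp
  have "\<exists>z\<in>W. \<forall>x. t * w x + t' * w' x = (t + t') * z x"
  proof (cases "t + t' = 0")
    case True
    then have "t = 0" "t' = 0" using 1(1) 2(1) by linarith+
    then show ?thesis using W_zero by (intro bexI[of _ "\<lambda>_. 0"]) auto
  next
    case False
    define r where "r = t / (t + t')"
    have r: "0 \<le> r" "r \<le> 1"
      using False 1(1) 2(1) by (auto simp: r_def field_simps)
    have "(t + t') * r = t" using False by (simp add: r_def)
    moreover from this have "(t + t') * (1 - r) = t'" by (simp add: right_diff_distrib)
    ultimately have "t * w x + t' * w' x = (t + t') * (r * w x + (1 - r) * w' x)" for x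
      by (simp only: distrib_left mult.assoc[symmetric])
    then show ?thesis by (intro bexI[OF _ function_hull.comb[OF 1(3) 2(3) r]] allI)
  qed
  then obtain z where z: "z \<in> W" "\<And>x. t * w x + t' * w' x = (t + t') * z x" by blast
  have "gauge n (\<lambda>x. v x + u x) \<le> (t + t') / 2 ^ n + 2 ^ n * (s + s')"
  proof (rule gauge_le[OF _ _ z(1)])
    fix x assume "x \<in> B"
    then show "\<bar>v x + u x - (t + t') * z x\<bar> \<le> s + s'"
      using 1(4)[of x] 2(4)[of x] unfolding z(2)[symmetric] by linarith
  qed (use 1 2 in auto)
  also have "\<dots> = (t / 2 ^ n + 2 ^ n * s) + (t' / 2 ^ n + 2 ^ n * s')"
    by (simp add: add_divide_distrib distrib_left)
  finally show "gauge n (\<lambda>x. v x + u x) \<le> gauge n v + gauge n u + \<epsilon>"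
    using 1(5) 2(5) by linarith
qed

lemma gauge_scale_le:
  assumes v: "continuous_on B v"
  shows "gauge n (\<lambda>x. c * v x) \<le> \<bar>c\<bar> * gauge n v"
proof (cases "c = 0")
  case True
  then show ?thesis using gauge_le_sup[of 0 "\<lambda>_. 0" n] by simp
next
  case False
  have "gauge n (\<lambda>x. c * v x) / \<bar>c\<bar> \<le> gauge n v"
    unfolding gauge_def[of n v]
  proof (rule cInf_greatest[OF costs_nonempty[OF v]])
    fix a assume "a \<in> costs n v"
    then obtain t s w where a: "a = t / 2 ^ n + 2 ^ n * s" "0 \<le> t" "0 \<le> s" "w \<in> W"
      "\<And>x. x \<in> B \<Longrightarrow> \<bar>v x - t * w x\<bar> \<le> s" unfolding costs_def by blast
    have "gauge n (\<lambda>x. c * v x) \<le> (\<bar>c\<bar> * t) / 2 ^ n + 2 ^ n * (\<bar>c\<bar> * s)"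
    proof (rule gauge_le)
      show "(\<lambda>x. sgn c * w x) \<in> W" using a(4) by (rule W_scale) (simp add: sgn_if)
      fix x assume "x \<in> B"
      have "c * v x - \<bar>c\<bar> * t * (sgn c * w x) = c * (v x - t * w x)"
        by (simp add: sgn_if algebra_simps)
      then show "\<bar>c * v x - \<bar>c\<bar> * t * (sgn c * w x)\<bar> \<le> \<bar>c\<bar> * s"
        using a(5)[OF \<open>x \<in> B\<close>] by (simp add: abs_mult mult_left_mono)
    qed (use a in auto)
    also have "\<dots> = \<bar>c\<bar> * a" unfolding a by (simp add: algebra_simps)
    finally show "gauge n (\<lambda>x. c * v x) / \<bar>c\<bar> \<le> a"
      using False by (simp add: divide_le_eq mult.commute)
  qed
  then show ?thesis using False by (simp add: divide_le_eq mult.commute)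
qed

lemma gauge_scale:
  assumes v: "continuous_on B v"
  shows "gauge n (\<lambda>x. c * v x) = \<bar>c\<bar> * gauge n v"
proof (cases "c = 0")
  case True
  then show ?thesis
    using gauge_scale_le[OF v, of n 0] gauge_nonneg[of "\<lambda>_. 0" n] by simp
next
  case False
  have "gauge n (\<lambda>x. inverse c * (c * v x)) \<le> \<bar>inverse c\<bar> * gauge n (\<lambda>x. c * v x)"
    using v by (intro gauge_scale_le continuous_intros)
  then have "gauge n v \<le> \<bar>inverse c\<bar> * gauge n (\<lambda>x. c * v x)"
    using False by (simp flip: mult.assoc)
  then have "\<bar>c\<bar> * gauge n v \<le> gauge n (\<lambda>x. c * v x)"
    using False by (simp add: field_simps)
  then show ?thesis using gauge_scale_le[OF v, of n c] by linarith
qed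

lemma gauge_diff_commute:
  "continuous_on B v \<Longrightarrow> continuous_on B u \<Longrightarrow> gauge n (\<lambda>x. v x - u x) = gauge n (\<lambda>x. u x - v x)"
  using gauge_scale[of "\<lambda>x. u x - v x" n "- 1"] by (simp add: continuous_intros)

text \<open>Members of the hull are bounded by \<open>1\<close> on \<open>B\<close>, so a
  decomposition bounds the values by \<open>t + s\<close>, which is at most \<open>2 ^ n\<close>
  times its cost.\<close>

lemma abs_le_gauge:
  assumes v: "continuous_on B v" and "x \<in> B"
  shows "\<bar>v x\<bar> \<le> 2 ^ n * gauge n v"
proof -
  have "\<bar>v x\<bar> / 2 ^ n \<le> gauge n v"
    unfolding gauge_def
  proof (rule cInf_greatest[OF costs_nonempty[OF v]])
    fix a assume "a \<in> costs n v"
    then obtain t s w where a: "a = t / 2 ^ n + 2 ^ n * s" "0 \<le> t" "0 \<le> s" "w \<in> W"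
      "\<And>x. x \<in> B \<Longrightarrow> \<bar>v x - t * w x\<bar> \<le> s" unfolding costs_def by blast
    have "\<bar>t * w x\<bar> \<le> t * 1"
      unfolding abs_mult using W_bounded[OF a(4) assms(2)] a(2) by (intro mult_mono) auto
    then have "\<bar>v x\<bar> \<le> t + s" using a(5)[OF assms(2)] by linarith
    then have "\<bar>v x\<bar> / 2 ^ n \<le> (t + s) / 2 ^ n" by (simp add: divide_right_mono)
    also have "\<dots> = t / 2 ^ n + s / 2 ^ n" by (rule add_divide_distrib)
    also have "s / 2 ^ n \<le> s / 1" using a(3) by (intro divide_left_mono) auto
    also have "s / 1 \<le> 2 ^ n * s" using a(3) mult_right_mono[of 1 "2 ^ n" s] by simp
    finally show "\<bar>v x\<bar> / 2 ^ n \<le> a" by (simp add: a(1))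
  qed
  then show ?thesis by (simp add: divide_le_eq mult.commute)
qed

lemma gauge_invariant:
  assumes v: "continuous_on B v"
  shows "gauge n (\<lambda>x. v (act g x)) = gauge n v"
proof (rule antisym)
  have le: "gauge n (\<lambda>x. u (act g x)) \<le> gauge n u" if u: "continuous_on B u" for u g
    unfolding gauge_def[of n u]
  proof (rule cInf_greatest[OF costs_nonempty[OF u]])
    fix a assume "a \<in> costs n u"
    then obtain t s w where a: "a = t / 2 ^ n + 2 ^ n * s" "0 \<le> t" "0 \<le> s" "w \<in> W"
      "\<And>x. x \<in> B \<Longrightarrow> \<bar>u x - t * w x\<bar> \<le> s" unfolding costs_def by blast
    then show "gauge n (\<lambda>x. u (act g x)) \<le> a"
      using gauge_le[OF a(2,3) W_invariant[OF a(4)], of "\<lambda>x. u (act g x)" g n] act_mem by simp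
  qed
  show "gauge n (\<lambda>x. v (act g x)) \<le> gauge n v" by (rule le[OF v])
  have "continuous_on B (\<lambda>x. v (act g x))"
    using continuous_on_compose2[OF v continuous_act_left] act_mem by auto
  from le[OF this, of "- g"] have "gauge n (\<lambda>x. v (act g (act (- g) x))) \<le> gauge n (\<lambda>x. v (act g x))" .
  moreover have "gauge n (\<lambda>x. v (act g (act (- g) x))) = gauge n v"
    by (rule gauge_cong) (simp add: act_inverse)
  ultimately show "gauge n v \<le> gauge n (\<lambda>x. v (act g x))" by simp
qed

text \<open>A sum of \<open>c0\<close> type over the gauges, in place of the customary
  square-summable one: convergence to \<open>0\<close> controls all high gauges of an element at
  once. Vanishing off \<open>B\<close> makes \<open>gnorm\<close> definite.\<close>

definition space :: "('k \<Rightarrow> real) set" where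
  "space = {v. (\<forall>x. x \<notin> B \<longrightarrow> v x = 0) \<and> continuous_on B v \<and> (\<lambda>n. gauge n v) \<longlonglongrightarrow> 0}"

definition gnorm :: "('k \<Rightarrow> real) \<Rightarrow> real" where
  "gnorm v = (SUP n. gauge n v)"

lemma spaceD: "v \<in> space \<Longrightarrow> continuous_on B v" "v \<in> space \<Longrightarrow> (\<lambda>n. gauge n v) \<longlonglongrightarrow> 0"
  "v \<in> space \<Longrightarrow> x \<notin> B \<Longrightarrow> v x = 0"
  by (auto simp: space_def)

lemma gauge_le_gnorm:
  assumes "v \<in> space"
  shows "gauge n v \<le> gnorm v"
  unfolding gnorm_def
proof (rule cSUP_upper)
  have "Bseq (\<lambda>n. gauge n v)"
    using spaceD(2)[OF assms] convergentI Bseq_eq_bounded convergent_imp_Bseq by blast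
  then show "bdd_above (range (\<lambda>n. gauge n v))"
    by (simp add: Bseq_eq_bounded bounded_imp_bdd_above)
qed simp

lemma gnorm_le: "(\<And>n. gauge n v \<le> r) \<Longrightarrow> gnorm v \<le> r"
  unfolding gnorm_def by (rule cSUP_least) auto

lemma abs_le_gnorm: "v \<in> space \<Longrightarrow> x \<in> B \<Longrightarrow> \<bar>v x\<bar> \<le> gnorm v"
  using abs_le_gauge[OF spaceD(1), of v x 0] gauge_le_gnorm[of v 0] by simp

lemma space_zero: "(\<lambda>_. 0) \<in> space"
proof -
  have "gauge n (\<lambda>_. 0) = 0" for n
    using gauge_scale[of "\<lambda>_. 0" n 0] by simp
  then show ?thesis by (simp add: space_def)
qed

lemma space_add:
  assumes "v \<in> space" "u \<in> space"
  shows "(\<lambda>x. v x + u x) \<in> space"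
proof -
  have "(\<lambda>n. gauge n (\<lambda>x. v x + u x)) \<longlonglongrightarrow> 0"
  proof (rule tendsto_sandwich[where f = "\<lambda>_. 0"])
    show "(\<lambda>n. gauge n v + gauge n u) \<longlonglongrightarrow> 0"
      using tendsto_add[OF spaceD(2)[OF assms(1)] spaceD(2)[OF assms(2)]] by simp
    show "\<forall>\<^sub>F n in sequentially. gauge n (\<lambda>x. v x + u x) \<le> gauge n v + gauge n u"
      using assms spaceD(1) by (intro always_eventually allI gauge_add)
    show "\<forall>\<^sub>F n in sequentially. 0 \<le> gauge n (\<lambda>x. v x + u x)"
      using assms spaceD(1) by (intro always_eventually allI gauge_nonneg continuous_intros)
  qed simp
  then show ?thesis using assms by (auto simp: space_def intro: continuous_intros)
qed

lemma space_scale: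
  assumes "v \<in> space"
  shows "(\<lambda>x. c * v x) \<in> space"
proof -
  have "(\<lambda>n. \<bar>c\<bar> * gauge n v) \<longlonglongrightarrow> \<bar>c\<bar> * 0"
    by (intro tendsto_intros spaceD(2) assms)
  then show ?thesis
    using assms by (auto simp: space_def gauge_scale intro: continuous_intros)
qed

lemma space_diff: "v \<in> space \<Longrightarrow> u \<in> space \<Longrightarrow> (\<lambda>x. v x - u x) \<in> space"
  using space_add[of v "\<lambda>x. - 1 * u x"] space_scale[of u "- 1"] by simp

lemma gnorm_nonneg: "v \<in> space \<Longrightarrow> 0 \<le> gnorm v"
  using gauge_nonneg[OF spaceD(1), of v 0] gauge_le_gnorm[of v 0] by linarith

lemma gnorm_add: "v \<in> space \<Longrightarrow> u \<in> space \<Longrightarrow> gnorm (\<lambda>x. v x + u x) \<le> gnorm v + gnorm u"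
  by (intro gnorm_le order_trans[OF gauge_add] add_mono gauge_le_gnorm spaceD(1))

lemma gnorm_scale_le: "v \<in> space \<Longrightarrow> gnorm (\<lambda>x. c * v x) \<le> \<bar>c\<bar> * gnorm v"
  by (intro gnorm_le) (simp add: gauge_scale spaceD(1) gauge_le_gnorm mult_left_mono)

lemma gnorm_scale:
  assumes v: "v \<in> space"
  shows "gnorm (\<lambda>x. c * v x) = \<bar>c\<bar> * gnorm v"
proof (cases "c = 0")
  case True
  then show ?thesis
    using gnorm_scale_le[OF v, of 0] gnorm_nonneg[OF space_zero] by simp
next
  case False
  have "gnorm (\<lambda>x. inverse c * (c * v x)) \<le> \<bar>inverse c\<bar> * gnorm (\<lambda>x. c * v x)"
    by (intro gnorm_scale_le space_scale v)
  then have "gnorm v \<le> \<bar>inverse c\<bar> * gnorm (\<lambda>x. c * v x)"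
    using False by (simp flip: mult.assoc)
  then have "\<bar>c\<bar> * gnorm v \<le> gnorm (\<lambda>x. c * v x)"
    using False by (simp add: field_simps)
  then show ?thesis using gnorm_scale_le[OF v, of c] by linarith
qed

lemma gnorm_eq_0:
  assumes "v \<in> space"
  shows "gnorm v = 0 \<longleftrightarrow> v = (\<lambda>_. 0)"
proof
  assume "gnorm v = 0"
  then have "v x = 0" for x
    using abs_le_gnorm[OF assms, of x] spaceD(3)[OF assms, of x] by (cases "x \<in> B") auto
  then show "v = (\<lambda>_. 0)" by auto
next
  assume "v = (\<lambda>_. 0)"
  then show "gnorm v = 0" using gnorm_scale[OF assms, of 0] by simp
qed

section \<open>The Banach space structure\<close>

definition V :: "('k \<Rightarrow> real) normed_module" where
  "V = \<lparr>carrier = space, mult = (\<lambda>u v. u), one = (\<lambda>_. 0), zero = (\<lambda>_. 0),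
        add = (\<lambda>u v x. u x + v x), smult = (\<lambda>c v x. c * v x), nrm = gnorm\<rparr>"

lemma V_simps [simp]: "carrier V = space" "zero V = (\<lambda>_. 0)" "add V u v = (\<lambda>x. u x + v x)"
  "smult V c v = (\<lambda>x. c * v x)" "nrm V = gnorm"
  by (simp_all add: V_def)

lemma abelian_group_V: "abelian_group V"
proof (rule abelian_groupI)
  fix u assume "u \<in> carrier V"
  then show "\<exists>y\<in>carrier V. y \<oplus>\<^bsub>V\<^esub> u = \<zero>\<^bsub>V\<^esub>"
    using space_scale[of u "- 1"] by (intro bexI[of _ "\<lambda>x. - 1 * u x"]) auto
qed (auto simp: space_add space_zero add_ac)

lemma minus_V:
  assumes "u \<in> space" "v \<in> space"
  shows "u \<ominus>\<^bsub>V\<^esub> v = (\<lambda>x. u x - v x)"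
proof -
  have "\<ominus>\<^bsub>V\<^esub> v = (\<lambda>x. - 1 * v x)"
    using assms(2) space_scale[of v "- 1"]
    by (intro abelian_group.minus_equality[OF abelian_group_V]) auto
  then show ?thesis by (simp add: a_minus_def)
qed

lemma norm_dist_V: "u \<in> space \<Longrightarrow> v \<in> space \<Longrightarrow> norm_dist V u v = gnorm (\<lambda>x. u x - v x)"
  by (simp add: norm_dist_def minus_V)

lemma gnorm_diff_commute: "u \<in> space \<Longrightarrow> v \<in> space \<Longrightarrow> gnorm (\<lambda>x. u x - v x) = gnorm (\<lambda>x. v x - u x)"
  using gnorm_scale[OF space_diff[of v u], of "- 1"] by simp

lemma Metric_space_V: "Metric_space space (norm_dist V)"
proof
  fix u v w
  show "0 \<le> norm_dist V u v"
    by (simp add: norm_dist_def minus_V gnorm_nonneg space_diff)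
  show "norm_dist V u v = norm_dist V v u"
    by (cases "u \<in> space \<and> v \<in> space")
      (auto simp: norm_dist_V norm_dist_def[of V u v] norm_dist_def[of V v u] gnorm_diff_commute[of u v] minus_V)
  assume uv: "u \<in> space" "v \<in> space"
  have "(\<lambda>x. u x - v x) = (\<lambda>_. 0) \<longleftrightarrow> u = v" by (auto simp: fun_eq_iff)
  then show "norm_dist V u v = 0 \<longleftrightarrow> u = v"
    using uv by (simp add: norm_dist_V gnorm_eq_0 space_diff)
  assume "w \<in> space"
  then show "norm_dist V u w \<le> norm_dist V u v + norm_dist V v w"
    using gnorm_add[OF space_diff[OF uv] space_diff[OF uv(2), of w]] uv by (simp add: norm_dist_V)
qed


lemma mcomplete_V: "Metric_space.mcomplete space (norm_dist V)"
proof -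
  interpret M: Metric_space space "norm_dist V" by (rule Metric_space_V)
  show ?thesis
    unfolding M.mcomplete_def
  proof (intro allI impI)
    fix \<sigma> assume \<sigma>: "M.MCauchy \<sigma>"
    then have sp: "\<sigma> n \<in> space" for n by (auto simp: M.MCauchy_def)
    have cont: "continuous_on B (\<sigma> n)" for n by (rule spaceD(1)[OF sp])
    have Cauchy: "\<exists>N. \<forall>n\<ge>N. \<forall>n'\<ge>N. gnorm (\<lambda>x. \<sigma> n x - \<sigma> n' x) < \<epsilon>" if "0 < \<epsilon>" for \<epsilon>
      using \<sigma> that sp unfolding M.MCauchy_def by (auto simp: norm_dist_V)
    have "uniformly_Cauchy_on B \<sigma>"
      unfolding uniformly_Cauchy_on_def
    proof (intro allI impI)
      fix e :: real assume "0 < e"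
      then obtain N where N: "\<forall>n\<ge>N. \<forall>n'\<ge>N. gnorm (\<lambda>x. \<sigma> n x - \<sigma> n' x) < e" using Cauchy by blast
      have "dist (\<sigma> m x) (\<sigma> n x) < e" if "x \<in> B" "m \<ge> N" "n \<ge> N" for x m n
      proof -
        have "\<bar>\<sigma> m x - \<sigma> n x\<bar> \<le> gnorm (\<lambda>x. \<sigma> m x - \<sigma> n x)"
          by (rule abs_le_gnorm[OF space_diff[OF sp sp] that(1)])
        also have "\<dots> < e" using N that by blast
        finally show ?thesis by (simp add: dist_real_def)
      qed
      then show "\<exists>M. \<forall>x\<in>B. \<forall>m\<ge>M. \<forall>n\<ge>M. dist (\<sigma> m x) (\<sigma> n x) < e" by blast
    qed
    then have "uniformly_convergent_on B \<sigma>" by (rule Cauchy_uniformly_convergent)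
    then obtain l0 where l0: "uniform_limit B \<sigma> l0 sequentially"
      unfolding uniformly_convergent_on_def by blast
    define l where "l x = (if x \<in> B then l0 x else 0)" for x
    have "continuous_on B l0"
      by (rule uniform_limit_theorem[OF always_eventually l0]) (auto simp: cont)
    then have contl: "continuous_on B l"
      by (subst continuous_on_cong[OF refl, of B l l0]) (auto simp: l_def)
    have unif: "\<exists>N. \<forall>n\<ge>N. \<forall>x\<in>B. \<bar>\<sigma> n x - l x\<bar> \<le> e" if "0 < e" for e
    proof -
      have "\<forall>\<^sub>F n in sequentially. \<forall>x\<in>B. dist (\<sigma> n x) (l0 x) < e"
        using l0 that by (rule uniform_limitD)
      then obtain N where "\<forall>n\<ge>N. \<forall>x\<in>B. dist (\<sigma> n x) (l0 x) < e"
        unfolding eventually_sequentially by blast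
      then show ?thesis
        by (intro exI[of _ N]) (auto simp: l_def dist_real_def intro: less_imp_le)
    qed
    \<comment> \<open>Uniform in \<open>k\<close>: for each \<open>k\<close> a late index
      \<open>n'\<close> makes the \<open>k\<close>-th gauge of the error negligible. It may depend
      on \<open>k\<close>, because the Cauchy condition bounds all gauges from the same
      \<open>N\<close> on.\<close>
    have close: "\<exists>N. \<forall>n\<ge>N. \<forall>k. gauge k (\<lambda>x. \<sigma> n x - l x) \<le> \<epsilon>" if "0 < \<epsilon>" for \<epsilon>
    proof -
      obtain N where N: "\<forall>n\<ge>N. \<forall>n'\<ge>N. gnorm (\<lambda>x. \<sigma> n x - \<sigma> n' x) < \<epsilon>" using Cauchy \<open>0 < \<epsilon>\<close> by blast
      have "gauge k (\<lambda>x. \<sigma> n x - l x) \<le> \<epsilon>" if "n \<ge> N" for n k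
      proof (rule field_le_epsilon)
        fix e :: real assume "0 < e"
        then have e: "0 < e / 2 ^ k" by simp
        obtain N' where N': "\<forall>n\<ge>N'. \<forall>x\<in>B. \<bar>\<sigma> n x - l x\<bar> \<le> e / 2 ^ k" using unif[OF e] by blast
        define n' where "n' = max N N'"
        have "gauge k (\<lambda>x. (\<sigma> n x - \<sigma> n' x) + (\<sigma> n' x - l x)) \<le>
            gauge k (\<lambda>x. \<sigma> n x - \<sigma> n' x) + gauge k (\<lambda>x. \<sigma> n' x - l x)"
          by (intro gauge_add continuous_intros cont contl)
        moreover have "gauge k (\<lambda>x. \<sigma> n x - \<sigma> n' x) \<le> \<epsilon>"
          using gauge_le_gnorm[OF space_diff[OF sp sp], of k n n'] N that
          by (metis less_imp_le max.cobounded1 n'_def order_trans)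
        moreover have "gauge k (\<lambda>x. \<sigma> n' x - l x) \<le> 2 ^ k * (e / 2 ^ k)"
          using N' e by (intro gauge_le_sup) (auto simp: n'_def)
        ultimately show "gauge k (\<lambda>x. \<sigma> n x - l x) \<le> \<epsilon> + e" by simp
      qed
      then show ?thesis by blast
    qed
    have "(\<lambda>k. gauge k l) \<longlonglongrightarrow> 0"
    proof (rule LIMSEQ_I)
      fix r :: real assume "0 < r"
      then have "0 < r / 2" by simp
      then obtain n where n: "\<And>k. gauge k (\<lambda>x. \<sigma> n x - l x) \<le> r / 2" using close by blast
      have "\<forall>\<^sub>F k in sequentially. gauge k (\<sigma> n) < r / 2"
        using spaceD(2)[OF sp] \<open>0 < r / 2\<close> by (rule order_tendstoD)
      then obtain N where N: "\<forall>k\<ge>N. gauge k (\<sigma> n) < r / 2" by (auto simp: eventually_sequentially)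
      have "norm (gauge k l - 0) < r" if "k \<ge> N" for k
      proof -
        have "gauge k (\<lambda>x. (l x - \<sigma> n x) + \<sigma> n x) \<le> gauge k (\<lambda>x. l x - \<sigma> n x) + gauge k (\<sigma> n)"
          by (intro gauge_add continuous_intros cont contl)
        moreover have "gauge k (\<lambda>x. l x - \<sigma> n x) \<le> r / 2"
          using n[of k] gauge_diff_commute[OF contl cont] by simp
        ultimately have "gauge k l < r" using N that by fastforce
        then show ?thesis using gauge_nonneg[OF contl, of k] by simp
      qed
      then show "\<exists>no. \<forall>n\<ge>no. norm (gauge n l - 0) < r" by blast
    qed
    then have lsp: "l \<in> space" using contl by (simp add: space_def l_def)
    have "limitin M.mtopology \<sigma> l sequentially"
      unfolding M.limit_metric_sequentially
    proof (intro conjI lsp allI impI)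
      fix \<epsilon> :: real assume "0 < \<epsilon>"
      then have "0 < \<epsilon> / 2" by simp
      then obtain N where "\<forall>n\<ge>N. \<forall>k. gauge k (\<lambda>x. \<sigma> n x - l x) \<le> \<epsilon> / 2" using close by blast
      then have "gnorm (\<lambda>x. \<sigma> n x - l x) \<le> \<epsilon> / 2" if "n \<ge> N" for n
        using that by (intro gnorm_le) blast
      then have "\<sigma> n \<in> space \<and> norm_dist V (\<sigma> n) l < \<epsilon>" if "n \<ge> N" for n
        using that sp lsp \<open>0 < \<epsilon>\<close> by (fastforce simp: norm_dist_V)
      then show "\<exists>N. \<forall>n\<ge>N. \<sigma> n \<in> space \<and> norm_dist V (\<sigma> n) l < \<epsilon>" by blast
    qed
    then show "\<exists>x. limitin M.mtopology \<sigma> x sequentially" by blast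
  qed
qed

lemma banach_space_V: "banach_space V"
  unfolding banach_space_def
proof (intro conjI)
  show "Module.module real_ring V"
    by (rule moduleI[OF cring_real_ring abelian_group_V])
      (auto simp: real_ring_def space_scale algebra_simps)
qed (auto simp: gnorm_nonneg gnorm_eq_0 gnorm_scale gnorm_add mcomplete_V)

section \<open>Absence of copies of \<open>ell1\<close>\<close>

lemma space_sum:
  assumes "\<And>i. v i \<in> space"
  shows "finite I \<Longrightarrow> (\<lambda>x. \<Sum>i\<in>I. c i * v i x) \<in> space"
  by (induction rule: finite_induct) (simp_all add: space_zero space_add space_scale assms)

lemma gnorm_sum_le:
  assumes "\<And>i. v i \<in> space" "\<And>i. gnorm (v i) \<le> M"
  shows "finite I \<Longrightarrow> gnorm (\<lambda>x. \<Sum>i\<in>I. c i * v i x) \<le> (\<Sum>i\<in>I. \<bar>c i\<bar>) * M"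
proof (induction rule: finite_induct)
  case empty
  then show ?case using gnorm_eq_0[OF space_zero] by simp
next
  case (insert j I)
  have "gnorm (\<lambda>x. c j * v j x + (\<Sum>i\<in>I. c i * v i x)) \<le>
      gnorm (\<lambda>x. c j * v j x) + gnorm (\<lambda>x. \<Sum>i\<in>I. c i * v i x)"
    by (intro gnorm_add space_scale space_sum assms insert.hyps)
  also have "gnorm (\<lambda>x. c j * v j x) = \<bar>c j\<bar> * gnorm (v j)" by (intro gnorm_scale assms)
  also have "\<bar>c j\<bar> * gnorm (v j) \<le> \<bar>c j\<bar> * M" by (intro mult_left_mono assms) simp
  finally show ?case using insert by (simp add: distrib_right)
qed

text \<open>In a high gauge, elements of bounded norm are bounded multiples of hull members up to a
  small uniform error, and signed averages of hull members can be made uniformly small. The block is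
  placed beyond \<open>k\<close> to keep it disjoint from earlier ones.\<close>

lemma small_block:
  fixes v :: "nat \<Rightarrow> 'k \<Rightarrow> real"
  assumes v: "\<And>i. v i \<in> space" and M: "\<And>i. gnorm (v i) \<le> M" and \<epsilon>: "0 < \<epsilon>"
  shows "\<exists>I c. finite I \<and> I \<subseteq> {k..} \<and> (\<Sum>i\<in>I. \<bar>c i\<bar>) = 1 \<and> (\<forall>x\<in>B. \<bar>\<Sum>i\<in>I. c i * v i x\<bar> \<le> \<epsilon>)"
proof -
  \<comment> \<open>Strictly above every gauge, so that decompositions of cost below
    \<open>M'\<close> exist.\<close>
  define M' where "M' = \<bar>M\<bar> + 1"
  have M': "0 < M'" "M < M'" by (auto simp: M'_def)
  \<comment> \<open>This \<open>n\<close> forces the uniform errors \<open>s i\<close> below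
    \<open>\<epsilon> / 2\<close>, while the multiples \<open>t i\<close> are at most
    \<open>L\<close>.\<close>
  obtain n where n: "2 * M' / \<epsilon> < 2 ^ n" using real_arch_pow[of 2] by auto
  define L where "L = 2 ^ n * M'"
  have L: "0 < L" using M' by (simp add: L_def)
  have "\<forall>i. \<exists>t s w. 0 \<le> t \<and> 0 \<le> s \<and> w \<in> W \<and> (\<forall>x\<in>B. \<bar>v i x - t * w x\<bar> \<le> s) \<and> t / 2 ^ n + 2 ^ n * s < M'"
  proof
    fix i
    have "gauge n (v i) < M'" using gauge_le_gnorm[OF v, of n i] M[of i] M'(2) by linarith
    then show "\<exists>t s w. 0 \<le> t \<and> 0 \<le> s \<and> w \<in> W \<and> (\<forall>x\<in>B. \<bar>v i x - t * w x\<bar> \<le> s) \<and> t / 2 ^ n + 2 ^ n * s < M'"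
      using gauge_lessE[OF spaceD(1)[OF v[of i]]] by metis
  qed
  then obtain t s w where tsw: "\<And>i. 0 \<le> t i" "\<And>i. 0 \<le> s i" "\<And>i. w i \<in> W"
    "\<And>i x. x \<in> B \<Longrightarrow> \<bar>v i x - t i * w i x\<bar> \<le> s i" "\<And>i. t i / 2 ^ n + 2 ^ n * s i < M'"
    by metis
  have tL: "t i \<le> L" for i
  proof -
    have "0 \<le> 2 ^ n * s i" using tsw(2) by simp
    then have "t i / 2 ^ n \<le> M'" using tsw(5)[of i] by linarith
    then show ?thesis by (simp add: L_def divide_le_eq mult.commute)
  qed
  have s\<epsilon>: "s i \<le> \<epsilon> / 2" for i
  proof -
    have "0 \<le> t i / 2 ^ n" using tsw(1) by simp
    then have "2 ^ n * s i \<le> M'" using tsw(5)[of i] by linarith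
    also have "\<dots> \<le> 2 ^ n * (\<epsilon> / 2)" using n \<epsilon> by (simp add: field_simps)
    finally show ?thesis by simp
  qed
  \<comment> \<open>Undoing the division by \<open>L\<close> turns \<open>m\<close> into the other
    \<open>\<epsilon> / 2\<close>.\<close>
  define m where "m = \<epsilon> / (2 * L)"
  have "0 < m" using \<epsilon> L by (simp add: m_def)
  then obtain N where N: "N \<ge> 1" "\<And>g. \<forall>i<N. g i \<in> W \<Longrightarrow>
    \<exists>E. \<forall>x\<in>B. \<bar>\<Sum>i<N. subset_sign E i * g i x\<bar> \<le> m * N"
    using function_hull_small_signs[OF covering, of m] F_bounded by metis
  define g where "g i = (\<lambda>x. t (i + k) / L * w (i + k) x)" for i
  have "\<forall>i<N. g i \<in> W"
    unfolding g_def by (intro allI impI W_scale tsw(3)) (use tsw(1) tL L in simp)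
  then obtain E where E: "\<And>x. x \<in> B \<Longrightarrow> \<bar>\<Sum>i<N. subset_sign E i * g i x\<bar> \<le> m * N"
    using N(2) by blast
  define I where "I = (\<lambda>i. i + k) ` {..<N}"
  define c where "c i = subset_sign E (i - k) / N" for i
  have sumI: "(\<Sum>i\<in>I. h i) = (\<Sum>i<N. h (i + k))" for h :: "nat \<Rightarrow> real"
    unfolding I_def by (subst sum.reindex) (auto simp: inj_on_def)
  have N0: "0 < real N" using N(1) by simp
  have "\<bar>\<Sum>i\<in>I. c i * v i x\<bar> \<le> \<epsilon>" if x: "x \<in> B" for x
  proof -
    let ?A = "\<Sum>i<N. subset_sign E i * g i x"
    let ?R = "\<Sum>i<N. subset_sign E i * (v (i + k) x - t (i + k) * w (i + k) x)"
    have "(\<Sum>i\<in>I. c i * v i x) * N = (\<Sum>i<N. subset_sign E i * v (i + k) x)"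
      unfolding sumI sum_distrib_right c_def using N0 by (intro sum.cong) auto
    also have "\<dots> = L * ?A + ?R"
      unfolding sum_distrib_left sum.distrib[symmetric] g_def
      using L by (intro sum.cong) (auto simp: algebra_simps)
    finally have eq: "(\<Sum>i\<in>I. c i * v i x) * N = L * ?A + ?R" .
    have "\<bar>L * ?A\<bar> \<le> L * (m * N)"
      unfolding abs_mult using E[OF x] L by (intro mult_mono) auto
    also have "\<dots> = \<epsilon> / 2 * N" using L by (simp add: m_def)
    finally have 1: "\<bar>L * ?A\<bar> \<le> \<epsilon> / 2 * N" .
    have "\<bar>?R\<bar> \<le> (\<Sum>i<N. \<bar>subset_sign E i * (v (i + k) x - t (i + k) * w (i + k) x)\<bar>)"
      by (rule sum_abs)
    also have "\<dots> \<le> (\<Sum>i<N. \<epsilon> / 2)"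
      using order_trans[OF tsw(4)[OF x] s\<epsilon>] by (intro sum_mono) (simp add: abs_mult)
    finally have "\<bar>?R\<bar> \<le> \<epsilon> / 2 * N" by (simp add: mult.commute)
    then have "\<bar>(\<Sum>i\<in>I. c i * v i x) * N\<bar> \<le> \<epsilon> * N"
      unfolding eq using 1 by linarith
    then show ?thesis using N0 by (simp add: abs_mult)
  qed
  moreover have "(\<Sum>i\<in>I. \<bar>c i\<bar>) = 1" unfolding sumI c_def using N0 by (simp add: abs_divide)
  moreover have "finite I" "I \<subseteq> {k..}" by (auto simp: I_def)
  ultimately show ?thesis by blast
qed

text \<open>Gliding hump: successive blocks are so small in the supremum norm that, for each \<open>n\<close>, at
  most one of them contributes substantially to the \<open>n\<close>-th gauge.\<close>

lemma gliding_hump: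
  fixes v :: "nat \<Rightarrow> 'k \<Rightarrow> real"
  assumes v: "\<And>i. v i \<in> space" and M: "\<And>i. gnorm (v i) \<le> M"
  shows "\<exists>I c. finite I \<and> (\<Sum>i\<in>I. \<bar>c i\<bar>) = real J \<and>
    (\<forall>n. gauge n (\<lambda>x. \<Sum>i\<in>I. c i * v i x) \<le> \<bar>M\<bar> + 2 - (1 / 2) ^ J)"
proof (induction J)
  case 0
  have "gauge n (\<lambda>_. 0) = 0" for n using gauge_scale[of "\<lambda>_. 0" n 0] by simp
  then show ?case by (intro exI[of _ "{}"]) auto
next
  case (Suc J)
  then obtain I c where I: "finite I" "(\<Sum>i\<in>I. \<bar>c i\<bar>) = real J"
    "\<And>n. gauge n (\<lambda>x. \<Sum>i\<in>I. c i * v i x) \<le> \<bar>M\<bar> + 2 - (1 / 2) ^ J" by blast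
  define U where "U = (\<lambda>x. \<Sum>i\<in>I. c i * v i x)"
  have U: "U \<in> space" unfolding U_def by (rule space_sum[OF v I(1)])
  have "\<forall>\<^sub>F n in sequentially. gauge n U < 1"
    using spaceD(2)[OF U] by (rule order_tendstoD) simp
  then obtain n0 where n0: "\<And>n. n \<ge> n0 \<Longrightarrow> gauge n U < 1" by (auto simp: eventually_sequentially)
  \<comment> \<open>Below \<open>n0\<close> the new block adds at most
    \<open>2 ^ n0 * \<epsilon> = (1 / 2) ^ Suc J\<close>, the amount by which the bound grows. From
    \<open>n0\<close> on the old sum counts less than \<open>1\<close> and the new block at most
    \<open>\<bar>M\<bar>\<close>, which stays below the bound.\<close>
  define \<epsilon> :: real where "\<epsilon> = (1 / 2) ^ Suc J / 2 ^ n0"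
  have \<epsilon>: "0 < \<epsilon>" by (simp add: \<epsilon>_def)
  define k where "k = Suc (Max (insert 0 I))"
  obtain I' c' where I': "finite I'" "I' \<subseteq> {k..}" "(\<Sum>i\<in>I'. \<bar>c' i\<bar>) = 1"
    "\<And>x. x \<in> B \<Longrightarrow> \<bar>\<Sum>i\<in>I'. c' i * v i x\<bar> \<le> \<epsilon>"
    using small_block[of v M \<epsilon> k, OF v M \<epsilon>] by blast
  define U' where "U' = (\<lambda>x. \<Sum>i\<in>I'. c' i * v i x)"
  have U': "U' \<in> space" unfolding U'_def by (rule space_sum[OF v I'(1)])
  have disj: "I \<inter> I' = {}"
  proof -
    have "i < k" if "i \<in> I" for i using that I(1) by (simp add: k_def less_Suc_eq_le)
    then show ?thesis using I'(2) by force
  qed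
  define c'' where "c'' i = (if i \<in> I then c i else c' i)" for i
  have split: "(\<Sum>i\<in>I \<union> I'. h (c'' i) i) = (\<Sum>i\<in>I. h (c i) i) + (\<Sum>i\<in>I'. h (c' i) i)"
    for h :: "real \<Rightarrow> nat \<Rightarrow> real"
  proof -
    have "(\<Sum>i\<in>I \<union> I'. h (c'' i) i) = (\<Sum>i\<in>I. h (c'' i) i) + (\<Sum>i\<in>I'. h (c'' i) i)"
      by (rule sum.union_disjoint[OF I(1) I'(1) disj])
    also have "(\<Sum>i\<in>I. h (c'' i) i) = (\<Sum>i\<in>I. h (c i) i)" by (simp add: c''_def)
    also have "(\<Sum>i\<in>I'. h (c'' i) i) = (\<Sum>i\<in>I'. h (c' i) i)"
      using disj by (intro sum.cong) (auto simp: c''_def)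
    finally show ?thesis .
  qed
  have "gauge n (\<lambda>x. U x + U' x) \<le> \<bar>M\<bar> + 2 - (1 / 2) ^ Suc J" for n
  proof -
    have le: "gauge n (\<lambda>x. U x + U' x) \<le> gauge n U + gauge n U'"
      by (intro gauge_add spaceD(1) U U')
    show ?thesis
    proof (cases "n \<ge> n0")
      case True
      have "gauge n U' \<le> gnorm U'" by (rule gauge_le_gnorm[OF U'])
      also have "\<dots> \<le> (\<Sum>i\<in>I'. \<bar>c' i\<bar>) * M"
        unfolding U'_def by (rule gnorm_sum_le[OF v M I'(1)])
      finally have "gauge n U' \<le> \<bar>M\<bar>" using I'(3) by simp
      moreover have "(1 / 2 :: real) ^ Suc J \<le> 1" by (rule power_le_one) auto
      ultimately show ?thesis using le n0[OF True] by linarith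
    next
      case False
      have "gauge n U' \<le> 2 ^ n * \<epsilon>"
        unfolding U'_def using I'(4) \<epsilon> by (intro gauge_le_sup) auto
      also have "\<dots> \<le> 2 ^ n0 * \<epsilon>"
        using False \<epsilon> by (intro mult_right_mono power_increasing) auto
      also have "\<dots> = (1 / 2) ^ Suc J" by (simp add: \<epsilon>_def)
      finally show ?thesis using le I(3)[of n, folded U_def] by simp
    qed
  qed
  moreover have "(\<lambda>x. \<Sum>i\<in>I \<union> I'. c'' i * v i x) = (\<lambda>x. U x + U' x)"
    unfolding U_def U'_def using split[of "\<lambda>a i. a * v i _"] by simp
  moreover have "(\<Sum>i\<in>I \<union> I'. \<bar>c'' i\<bar>) = real (Suc J)"
    using split[of "\<lambda>a i. \<bar>a\<bar>"] I(2) I'(3) by simp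
  ultimately show ?case using I(1) I'(1) by (intro exI[of _ "I \<union> I'"] exI[of _ c'']) simp
qed

text \<open>The images of the unit vectors are bounded, so \<open>gliding_hump\<close> yields
  combinations with coefficient sum \<open>J\<close> and norm at most
  \<open>\<bar>M\<bar> + 2\<close> for every \<open>J\<close>, against the lower estimate
  \<open>m * J\<close>.\<close>

lemma not_contains_ell1_V: "\<not> contains_ell1 V"
proof
  assume "contains_ell1 V"
  then obtain T m M where T: "T \<in> ell1 \<rightarrow> space"
    and add: "\<forall>c\<in>ell1. \<forall>d\<in>ell1. T (\<lambda>n. c n + d n) = (\<lambda>x. T c x + T d x)"
    and scale: "\<forall>r. \<forall>c\<in>ell1. T (\<lambda>n. r * c n) = (\<lambda>x. r * T c x)"
    and m: "0 < m"
    and bounds: "\<forall>c\<in>ell1. m * ell1_norm c \<le> gnorm (T c) \<and> gnorm (T c) \<le> M * ell1_norm c"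
    unfolding contains_ell1_def V_simps by (elim bexE conjE exE) (rule that)
  define fin where "fin I c = (\<lambda>n. if n \<in> I then c n else 0)" for I and c :: "nat \<Rightarrow> real"
  have fin_ell1: "fin I c \<in> ell1" if "finite I" for I c
    unfolding ell1_def fin_def using that by (auto intro!: summable_finite)
  have fin_norm: "ell1_norm (fin I c) = (\<Sum>i\<in>I. \<bar>c i\<bar>)" if "finite I" for I c
    unfolding ell1_norm_def fin_def using that by (subst suminf_finite[of I]) auto
  define v where "v i = T (fin {i} (\<lambda>_. 1))" for i
  have v: "v i \<in> space" for i unfolding v_def using T fin_ell1 by auto
  have vM: "gnorm (v i) \<le> M" for i
    unfolding v_def using bounds[rule_format, OF fin_ell1, of "{i}" "\<lambda>_. 1"] fin_norm[of "{i}" "\<lambda>_. 1"] by simp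
  have T_fin: "T (fin I c) = (\<lambda>x. \<Sum>i\<in>I. c i * v i x)" if "finite I" for I c
    using that
  proof (induction rule: finite_induct)
    case empty
    have "T (\<lambda>n. 0 * fin {} c n) = (\<lambda>x. 0 * T (fin {} c) x)" using scale fin_ell1 by blast
    then show ?case by (simp add: fin_def)
  next
    case (insert j I)
    have "fin (insert j I) c = (\<lambda>n. fin {j} c n + fin I c n)"
      using insert.hyps by (auto simp: fin_def)
    then have "T (fin (insert j I) c) = (\<lambda>x. T (fin {j} c) x + T (fin I c) x)"
      using add[rule_format, OF fin_ell1 fin_ell1, of "{j}" I c c] insert.hyps by simp
    moreover have "(\<lambda>n. c j * fin {j} (\<lambda>_. 1) n) = fin {j} c" by (auto simp: fin_def)
    then have "T (fin {j} c) = (\<lambda>x. c j * v j x)"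
      using scale[rule_format, OF fin_ell1, of "{j}" "c j" "\<lambda>_. 1"] by (simp add: v_def)
    ultimately show ?case using insert by simp
  qed
  obtain J where J: "(\<bar>M\<bar> + 2) / m < real J" using reals_Archimedean2 by blast
  obtain I c where I: "finite I" "(\<Sum>i\<in>I. \<bar>c i\<bar>) = real J"
    "\<And>n. gauge n (\<lambda>x. \<Sum>i\<in>I. c i * v i x) \<le> \<bar>M\<bar> + 2 - (1 / 2) ^ J"
    using gliding_hump[of v M J, OF v vM] by blast
  have "m * real J \<le> gnorm (\<lambda>x. \<Sum>i\<in>I. c i * v i x)"
    using bounds[rule_format, OF fin_ell1[OF I(1)], of c] I fin_norm T_fin by simp
  also have "\<dots> \<le> \<bar>M\<bar> + 2"
  proof (rule gnorm_le)
    fix n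
    have "0 \<le> (1 / 2 :: real) ^ J" by simp
    then show "gauge n (\<lambda>x. \<Sum>i\<in>I. c i * v i x) \<le> \<bar>M\<bar> + 2" using I(3)[of n] by linarith
  qed
  finally show False using J m by (simp add: divide_less_eq mult.commute)
qed

lemma rosenthal_space_V: "rosenthal_space V"
  by (simp add: rosenthal_space_def banach_space_V not_contains_ell1_V)

section \<open>Representation and tameness\<close>


definition translate :: "'g \<Rightarrow> ('k \<Rightarrow> real) \<Rightarrow> 'k \<Rightarrow> real" where
  "translate g = (\<lambda>v\<in>space. \<lambda>x. if x \<in> B then v (act (- g) x) else 0)"

lemma translate_apply: "v \<in> space \<Longrightarrow> x \<in> B \<Longrightarrow> translate g v x = v (act (- g) x)"
  by (simp add: translate_def)

lemma translate_outside: "v \<in> space \<Longrightarrow> x \<notin> B \<Longrightarrow> translate g v x = 0"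
  by (simp add: translate_def)

lemma gauge_translate:
  assumes "v \<in> space"
  shows "gauge n (translate g v) = gauge n v"
proof -
  have "gauge n (translate g v) = gauge n (\<lambda>x. v (act (- g) x))"
    using assms by (intro gauge_cong) (simp add: translate_apply)
  then show ?thesis using gauge_invariant[OF spaceD(1)[OF assms]] by simp
qed

lemma translate_space:
  assumes "v \<in> space"
  shows "translate g v \<in> space"
proof -
  have "continuous_on B (\<lambda>x. v (act (- g) x))"
    using continuous_on_compose2[OF spaceD(1)[OF assms] continuous_act_left] act_mem by auto
  then have "continuous_on B (translate g v)"
    by (subst continuous_on_cong[OF refl translate_apply[OF assms]])
  then show ?thesis
    using spaceD(2)[OF assms]
    by (simp add: space_def gauge_translate[OF assms] translate_outside[OF assms])
qed

lemma translate_plus: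
  assumes v: "v \<in> space"
  shows "translate (g + h) v = translate g (translate h v)"
proof
  fix x
  have "act (- (g + h)) x = act (- h) (act (- g) x)" if "x \<in> B"
    unfolding minus_add using act_plus[OF that, of "- h" "- g"] by simp
  then show "translate (g + h) v x = translate g (translate h v) x"
    using v by (cases "x \<in> B") (simp_all add: translate_apply translate_outside translate_space act_mem)
qed

lemma translate_zero: "v \<in> space \<Longrightarrow> translate 0 v = v"
  by (rule ext) (metis act_0 minus_zero spaceD(3) translate_apply translate_outside)

lemma translate_inverse: "v \<in> space \<Longrightarrow> translate (- g) (translate g v) = v"
  "v \<in> space \<Longrightarrow> translate g (translate (- g) v) = v"
  using translate_plus[of v "- g" g] translate_plus[of v g "- g"] translate_zero by simp_all

lemma bij_betw_translate: "bij_betw (translate g) space space"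
  by (rule bij_betw_byWitness[where f' = "translate (- g)"])
    (auto simp: translate_inverse translate_space)

lemma translate_Iso: "translate g \<in> Iso V"
proof -
  have "translate g \<in> extensional space" by (simp add: translate_def)
  moreover have "gnorm (translate g v) = gnorm v" if "v \<in> space" for v
    unfolding gnorm_def by (simp add: gauge_translate that)
  moreover have "translate g (\<lambda>x. v x + w x) = (\<lambda>x. translate g v x + translate g w x)"
    if "v \<in> space" "w \<in> space" for v w
    using that by (auto simp: translate_def space_add)
  moreover have "translate g (\<lambda>x. c * v x) = (\<lambda>x. c * translate g v x)" if "v \<in> space" for c v
    using that by (auto simp: translate_def space_scale)
  ultimately show ?thesis
    by (simp add: Iso_def Bij_def bij_betw_translate)
qed

text \<open>High gauges of the difference of two translates are at most twice those of
  \<open>v\<close>, hence small. Low gauges are bounded by the supremum norm, which is small near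
  \<open>g0\<close> because \<open>B\<close> is compact and the action is jointly
  continuous.\<close>

lemma continuous_translate: "continuous_map euclidean (strong_topology V) translate"
proof -
  interpret M: Metric_space space "norm_dist V" by (rule Metric_space_V)
  have "continuous_map euclidean M.mtopology (\<lambda>g. translate g v)" if v: "v \<in> space" for v
    unfolding M.continuous_map_to_metric
  proof (intro ballI allI impI)
    fix g0 :: 'g and \<epsilon> :: real assume \<epsilon>: "0 < \<epsilon>"
    have "\<forall>\<^sub>F n in sequentially. gauge n v < \<epsilon> / 4"
      using spaceD(2)[OF v] by (rule order_tendstoD) (use \<epsilon> in simp)
    then obtain n0 where n0: "\<And>n. n \<ge> n0 \<Longrightarrow> gauge n v < \<epsilon> / 4" by (auto simp: eventually_sequentially)
    define e where "e = \<epsilon> / 2 / 2 ^ n0"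
    have e: "0 < e" using \<epsilon> by (simp add: e_def)
    have "continuous_on (UNIV \<times> B) (\<lambda>z :: 'g \<times> 'k. (- fst z, snd z))" by (intro continuous_intros)
    moreover have "(\<lambda>z :: 'g \<times> 'k. (- fst z, snd z)) ` (UNIV \<times> B) \<subseteq> UNIV \<times> B" by auto
    ultimately have "continuous_on (UNIV \<times> B) (\<lambda>z :: 'g \<times> 'k. act (- fst z) (snd z))"
      using continuous_on_compose2[OF continuous_act] by fastforce
    moreover have "(\<lambda>z :: 'g \<times> 'k. act (- fst z) (snd z)) ` (UNIV \<times> B) \<subseteq> B"
      using act_mem by auto
    ultimately have cont: "continuous_on (UNIV \<times> B) (\<lambda>z :: 'g \<times> 'k. v (act (- fst z) (snd z)))"
      by (rule continuous_on_compose2[OF spaceD(1)[OF v]])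
    obtain U where U: "g0 \<in> U" "open U"
      "\<forall>g\<in>U \<inter> UNIV. \<forall>x\<in>B. dist (v (act (- fst (g, x)) (snd (g, x)))) (v (act (- fst (g0, x)) (snd (g0, x)))) \<le> e"
      using continuous_on_prod_compactE[OF cont compact UNIV_I e, of g0] by metis
    have "translate g v \<in> M.mball (translate g0 v) \<epsilon>" if "g \<in> U" for g
    proof -
      have "gauge n (\<lambda>x. translate g0 v x - translate g v x) \<le> \<epsilon> / 2" for n
      proof (cases "n \<ge> n0")
        case True
        have c: "continuous_on B (translate g0 v)" "continuous_on B (\<lambda>x. - 1 * translate g v x)"
          using spaceD(1)[OF translate_space[OF v]] by (auto intro: continuous_intros)
        have "gauge n (\<lambda>x. - 1 * translate g v x) = gauge n v"
          using gauge_scale[OF spaceD(1)[OF translate_space[OF v]], of n "- 1" g]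
          by (simp add: gauge_translate v)
        moreover have "gauge n (translate g0 v) = gauge n v" by (rule gauge_translate[OF v])
        ultimately have "gauge n (\<lambda>x. translate g0 v x - translate g v x) \<le> gauge n v + gauge n v"
          using gauge_add[OF c, of n] by simp
        then show ?thesis using n0[OF True] by simp
      next
        case False
        have "gauge n (\<lambda>x. translate g0 v x - translate g v x) \<le> 2 ^ n * e"
        proof (rule gauge_le_sup)
          fix x assume x: "x \<in> B"
          then have "dist (v (act (- g) x)) (v (act (- g0) x)) \<le> e"
            using U(3) \<open>g \<in> U\<close> by simp
          then show "\<bar>translate g0 v x - translate g v x\<bar> \<le> e"
            using x by (simp add: translate_apply v dist_commute flip: dist_real_def)
        qed (use e in simp)
        also have "\<dots> \<le> 2 ^ n0 * e" using False e by (intro mult_right_mono power_increasing) auto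
        also have "\<dots> = \<epsilon> / 2" by (simp add: e_def)
        finally show ?thesis .
      qed
      then have "gnorm (\<lambda>x. translate g0 v x - translate g v x) \<le> \<epsilon> / 2" by (rule gnorm_le)
      then show ?thesis
        using \<epsilon> by (simp add: M.in_mball translate_space v norm_dist_V)
    qed
    then show "\<exists>U. openin euclidean U \<and> g0 \<in> U \<and> (\<forall>g\<in>U. translate g v \<in> M.mball (translate g0 v) \<epsilon>)"
      using U by auto
  qed
  then show ?thesis
    unfolding strong_topology_def norm_topology_def V_simps
    by (auto simp: continuous_map_in_subtopology continuous_map_componentwise translate_Iso)
      (auto simp: translate_def)
qed

definition evaluation :: "'k \<Rightarrow> ('k \<Rightarrow> real) \<Rightarrow> real" where
  "evaluation x = (\<lambda>v\<in>space. v x)"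

lemma evaluation_dual_ball: "x \<in> B \<Longrightarrow> evaluation x \<in> dual_ball V"
  by (auto simp: dual_ball_def evaluation_def space_add space_scale abs_le_gnorm)

text \<open>Cut off outside \<open>B\<close>, a member of \<open>F\<close> belongs to the space
  because its \<open>n\<close>-th gauge is at most \<open>1 / 2 ^ n\<close>; so evaluations separate
  whatever \<open>F\<close> separates.\<close>

lemma inj_on_evaluation: "inj_on evaluation B"
proof (rule inj_onI, rule ccontr)
  fix x y assume xy: "x \<in> B" "y \<in> B" "evaluation x = evaluation y" "x \<noteq> y"
  then obtain f where f: "f \<in> F" "f x \<noteq> f y" using F_separates by blast
  define v where "v z = (if z \<in> B then f z else 0)" for z
  have "continuous_on B v"
    by (subst continuous_on_cong[OF refl, of B v f]) (auto simp: v_def F_continuous f)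
  have "gauge n v = gauge n f" for n by (rule gauge_cong) (simp add: v_def)
  then have le: "gauge n v \<le> (1 / 2) ^ n" for n
    using gauge_W[OF function_hull.base[OF f(1)], of n] by (simp add: power_divide)
  have "(\<lambda>n. gauge n v) \<longlonglongrightarrow> 0"
  proof (rule tendsto_sandwich[where f = "\<lambda>_. 0"])
    show "(\<lambda>n. (1 / 2 :: real) ^ n) \<longlonglongrightarrow> 0" by (rule LIMSEQ_realpow_zero) auto
  qed (auto simp: le gauge_nonneg \<open>continuous_on B v\<close>)
  then have "v \<in> space" using \<open>continuous_on B v\<close> by (simp add: space_def v_def)
  then have "v x = v y" using fun_cong[OF xy(3), of v] by (simp add: evaluation_def)
  then show False using f xy by (simp add: v_def)
qed

lemma embedding_evaluation: "embedding_map (top_of_set B) (weak_star_ball V) evaluation"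
proof (rule continuous_imp_embedding_map)
  show "continuous_map (top_of_set B) (weak_star_ball V) evaluation"
    unfolding weak_star_ball_def V_simps continuous_map_in_subtopology continuous_map_componentwise
    using evaluation_dual_ball by (auto simp: evaluation_def spaceD(1) Pi_iff)
  show "compact_space (top_of_set B)" using compact by (simp add: compact_space_subtopology)
  show "Hausdorff_space (weak_star_ball V)"
    unfolding weak_star_ball_def
    by (intro Hausdorff_space_subtopology) (simp add: Hausdorff_space_product_topology)
  show "inj_on evaluation (topspace (top_of_set B))" by (simp add: inj_on_evaluation)
qed

lemma evaluation_equivariant:
  assumes x: "x \<in> B"
  shows "evaluation (act g x) = dual_action V (translate g) (evaluation x)"
proof -
  have "evaluation x (inv_into space (translate g) v) = v (act g x)" if v: "v \<in> space" for v
  proof -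
    have "inv_into space (translate g) v = translate (- g) v"
      using bij_betw_translate v
      by (intro inv_into_f_eq) (auto simp: bij_betw_def translate_space translate_inverse)
    then show ?thesis
      using x v by (simp add: evaluation_def translate_space translate_apply)
  qed
  then show ?thesis by (auto simp: dual_action_def evaluation_def)
qed

lemma rosenthal_representable: "rosenthal_representable act (top_of_set B)"
  unfolding rosenthal_representable_def
proof (intro exI[of _ V] exI[of _ translate] exI[of _ evaluation] conjI allI ballI)
  fix g g'
  show "translate (g + g') = compose (carrier V) (translate g) (translate g')"
  proof
    fix v
    show "translate (g + g') v = compose (carrier V) (translate g) (translate g') v"
      by (cases "v \<in> space") (simp_all add: compose_def translate_plus, simp add: translate_def)
  qed
qed (simp_all add: rosenthal_space_V continuous_translate embedding_evaluation evaluation_equivariant)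

text \<open>As \<open>F\<close> separates points, \<open>B \<times> B\<close> is covered by the open
  set where \<open>f\<close> varies by less than \<open>c\<close> and the open sets where some
  member of \<open>F\<close> varies by more than \<open>1 / (k + 1)\<close>. A finite subcover
  yields \<open>\<Phi>\<close> and \<open>\<eta>\<close>. This carries the counting from
  \<open>F\<close> to arbitrary continuous functions.\<close>

lemma finite_control:
  assumes f: "continuous_on B f" and c: "(0::real) < c"
  obtains \<Phi> \<eta> where "finite \<Phi>" "\<Phi> \<subseteq> F" "(0::real) < \<eta>"
    "\<And>x y. x \<in> B \<Longrightarrow> y \<in> B \<Longrightarrow> (\<And>\<phi>. \<phi> \<in> \<Phi> \<Longrightarrow> \<bar>\<phi> x - \<phi> y\<bar> \<le> \<eta>) \<Longrightarrow> \<bar>f x - f y\<bar> < c"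
proof -
  define S where "S = B \<times> B"
  define G where "G = {z \<in> S. \<bar>f (fst z) - f (snd z)\<bar> < c}"
  define U where "U = (\<lambda>(\<phi>, k::nat). {z \<in> S. 1 / (real k + 1) < \<bar>\<phi> (fst z) - \<phi> (snd z)\<bar>})"
  have cont: "continuous_on S (\<lambda>z. \<bar>\<phi> (fst z) - \<phi> (snd z)\<bar>)" if "continuous_on B \<phi>" for \<phi> :: "'k \<Rightarrow> real"
    unfolding S_def
    by (intro continuous_intros continuous_on_compose2[OF that]) auto
  have "openin (top_of_set S) C" if C: "C \<in> insert G (U ` (F \<times> UNIV))" for C
  proof -
    consider "C = G" | \<phi> k where "\<phi> \<in> F" "C = U (\<phi>, k)" using C by auto
    then show ?thesis
    proof cases
      case 1
      then show ?thesis
        using continuous_openin_preimage_gen[OF cont[OF f] open_lessThan[of c]]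
        by (simp add: G_def vimage_def Int_def)
    next
      case 2
      then show ?thesis
        using continuous_openin_preimage_gen[OF cont[OF F_continuous[OF 2(1)]] open_greaterThan[of "1 / (real k + 1)"]]
        by (simp add: U_def vimage_def Int_def)
    qed
  qed
  moreover have "S \<subseteq> \<Union> (insert G (U ` (F \<times> UNIV)))"
  proof
    fix z assume z: "z \<in> S"
    show "z \<in> \<Union> (insert G (U ` (F \<times> UNIV)))"
    proof (cases "fst z = snd z")
      case True
      then show ?thesis using z c by (auto simp: G_def)
    next
      case False
      have "fst z \<in> B" "snd z \<in> B" using z by (auto simp: S_def)
      then obtain \<phi> where \<phi>: "\<phi> \<in> F" "\<phi> (fst z) \<noteq> \<phi> (snd z)" using F_separates False by blast
      then have "0 < \<bar>\<phi> (fst z) - \<phi> (snd z)\<bar>" by simp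
      then obtain k where "1 / real (Suc k) < \<bar>\<phi> (fst z) - \<phi> (snd z)\<bar>"
        using nat_approx_posE by blast
      then have "z \<in> U (\<phi>, k)" using z by (simp add: U_def add.commute)
      then show ?thesis using \<phi> by blast
    qed
  qed
  moreover have "compact S" unfolding S_def using compact by (intro compact_Times)
  ultimately obtain D where D: "D \<subseteq> insert G (U ` (F \<times> UNIV))" "finite D" "S \<subseteq> \<Union> D"
    unfolding compact_eq_openin_cover by meson
  have "finite (D - {G})" "D - {G} \<subseteq> U ` (F \<times> UNIV)" using D by auto
  then obtain X where X: "X \<subseteq> F \<times> UNIV" "finite X" "D - {G} = U ` X"
    using finite_subset_image by meson
  define \<eta> where "\<eta> = Min (insert 1 ((\<lambda>(\<phi>, k). 1 / (real k + 1)) ` X))"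
  show ?thesis
  proof
    show "finite (fst ` X)" "fst ` X \<subseteq> F" using X by auto
    have "\<eta> \<in> insert 1 ((\<lambda>(\<phi>, k). 1 / (real k + 1)) ` X)"
      unfolding \<eta>_def using X(2) by (intro Min_in) auto
    then show "0 < \<eta>" by (auto simp: add_pos_nonneg)
    fix x y assume xy: "x \<in> B" "y \<in> B" and le: "\<And>\<phi>. \<phi> \<in> fst ` X \<Longrightarrow> \<bar>\<phi> x - \<phi> y\<bar> \<le> \<eta>"
    have "(x, y) \<notin> U (\<phi>, k)" if "(\<phi>, k) \<in> X" for \<phi> k
    proof -
      have "\<phi> \<in> fst ` X" using that by force
      moreover have "\<eta> \<le> 1 / (real k + 1)"
        unfolding \<eta>_def using X(2) that by (intro Min_le) force+
      ultimately show ?thesis using le[of \<phi>] by (auto simp: U_def)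
    qed
    then have "(x, y) \<notin> \<Union> (D - {G})" unfolding X(3) by auto
    moreover have "(x, y) \<in> \<Union> D" using xy D(3) by (auto simp: S_def)
    ultimately have "(x, y) \<in> G" by blast
    then show "\<bar>f x - f y\<bar> < c" by (simp add: G_def)
  qed
qed

text \<open>Independence provides a point \<open>x S\<close> for each of the \<open>2 ^ N\<close>
  subsets \<open>S\<close> of the first \<open>N\<close> indices. If two of these points share a
  cell of a cover adapted to the translates of \<open>\<Phi>\<close>, then \<open>f\<close> differs
  by less than \<open>b - a\<close> at each translate and the subsets agree. So the cells number at
  least \<open>2 ^ N\<close>, yet only polynomially many are needed.\<close>

lemma not_independent_orbit:
  assumes f: "continuous_on B f" and u: "\<And>i. u i = (\<lambda>x. f (act (g i) x))"
  shows "\<not> independent_sequence (top_of_set B) u"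
proof
  assume "independent_sequence (top_of_set B) u"
  then obtain a b where ab: "a < b" and ind: "\<And>P M. finite P \<Longrightarrow> finite M \<Longrightarrow> P \<inter> M = {} \<Longrightarrow>
        (\<exists>x\<in>B. (\<forall>i\<in>P. u i x \<le> a) \<and> (\<forall>j\<in>M. b \<le> u j x))"
    unfolding independent_sequence_def by auto
  obtain \<Phi> \<eta> where \<Phi>: "finite \<Phi>" "\<Phi> \<subseteq> F" "(0::real) < \<eta>"
    "\<And>x y. x \<in> B \<Longrightarrow> y \<in> B \<Longrightarrow> (\<And>\<phi>. \<phi> \<in> \<Phi> \<Longrightarrow> \<bar>\<phi> x - \<phi> y\<bar> \<le> \<eta>) \<Longrightarrow> \<bar>f x - f y\<bar> < b - a"
    using finite_control[OF f, of "b - a"] ab by (metis diff_gt_0_iff_gt)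
  from covering[unfolded polynomial_covering_def, rule_format, OF \<Phi>(3)]
  obtain D where D: "\<forall>\<Psi>\<subseteq>F. finite \<Psi> \<longrightarrow> coverable B \<Psi> \<eta> (D * (card \<Psi> + 1) ^ D)" ..
  define c where "c = card \<Phi> + 1"
  have count: "2 ^ N \<le> D * (c * (N + 1)) ^ D" for N
  proof -
    define \<Psi> where "\<Psi> = (\<lambda>(\<phi>, i). \<lambda>x. \<phi> (act (g i) x)) ` (\<Phi> \<times> {..<N})"
    have \<Psi>: "\<Psi> \<subseteq> F" "finite \<Psi>" using \<Phi>(1,2) F_invariant by (auto simp: \<Psi>_def)
    have "card \<Psi> \<le> card (\<Phi> \<times> {..<N})"
      unfolding \<Psi>_def using \<Phi>(1) by (intro card_image_le) simp
    then have card\<Psi>: "card \<Psi> + 1 \<le> c * (N + 1)" by (simp add: card_cartesian_product c_def)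
    from D[rule_format, OF \<Psi>, unfolded coverable_def] obtain \<P> where \<P>: "finite \<P>" "card \<P> \<le> D * (card \<Psi> + 1) ^ D" "B \<subseteq> \<Union>\<P>"
       "\<forall>P\<in>\<P>. \<forall>x\<in>P. \<forall>y\<in>P. \<forall>f\<in>\<Psi>. \<bar>f x - f y\<bar> \<le> \<eta>"
      by (elim exE conjE) (rule that)
    have "\<forall>S\<in>Pow {..<N}. \<exists>x\<in>B. (\<forall>i\<in>S. u i x \<le> a) \<and> (\<forall>i\<in>{..<N} - S. b \<le> u i x)"
      by (intro ballI ind) (auto intro: finite_subset)
    from bchoice[OF this[unfolded Bex_def]] obtain x where
      x: "\<And>S. S \<in> Pow {..<N} \<Longrightarrow> x S \<in> B"
        "\<And>S i. S \<in> Pow {..<N} \<Longrightarrow> i \<in> S \<Longrightarrow> u i (x S) \<le> a"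
        "\<And>S i. S \<in> Pow {..<N} \<Longrightarrow> i \<in> {..<N} - S \<Longrightarrow> b \<le> u i (x S)" by blast
    have "\<forall>S\<in>Pow {..<N}. \<exists>P. P \<in> \<P> \<and> x S \<in> P"
    proof
      fix S assume "S \<in> Pow {..<N}"
      from subsetD[OF \<P>(3) x(1)[OF this]] show "\<exists>P. P \<in> \<P> \<and> x S \<in> P" by blast
    qed
    from bchoice[OF this] obtain P where
      P: "\<And>S. S \<in> Pow {..<N} \<Longrightarrow> P S \<in> \<P>" "\<And>S. S \<in> Pow {..<N} \<Longrightarrow> x S \<in> P S" by blast
    have sub: "S \<subseteq> S'" if S: "S \<in> Pow {..<N}" "S' \<in> Pow {..<N}" "P S = P S'" for S S'
    proof
      fix i assume i: "i \<in> S"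
      then have iN: "i < N" using S(1) by auto
      show "i \<in> S'"
      proof (rule ccontr)
        assume "i \<notin> S'"
        have "\<bar>f (act (g i) (x S)) - f (act (g i) (x S'))\<bar> < b - a"
        proof (rule \<Phi>(4))
          fix \<phi> assume "\<phi> \<in> \<Phi>"
          then have mem: "(\<lambda>x. \<phi> (act (g i) x)) \<in> \<Psi>"
            unfolding \<Psi>_def using iN by (intro image_eqI[of _ _ "(\<phi>, i)"]) auto
          have "x S' \<in> P S" unfolding S(3) by (rule P(2)[OF S(2)])
          from \<P>(4)[rule_format, OF P(1)[OF S(1)] P(2)[OF S(1)] this mem]
          show "\<bar>\<phi> (act (g i) (x S)) - \<phi> (act (g i) (x S'))\<bar> \<le> \<eta>" .
        qed (use x(1) S act_mem in auto)
        moreover have "f (act (g i) (x S)) \<le> a" using x(2)[OF S(1) i] by (simp add: u)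
        moreover have "b \<le> f (act (g i) (x S'))"
          using x(3)[OF S(2), of i] iN \<open>i \<notin> S'\<close> by (simp add: u)
        ultimately show False by linarith
      qed
    qed
    have "inj_on P (Pow {..<N})"
      by (intro inj_onI subset_antisym sub) simp_all
    then have "card (Pow {..<N}) \<le> card \<P>"
      using P(1) \<P>(1) by (intro card_inj_on_le) auto
    then have "2 ^ N \<le> card \<P>" by (simp add: card_Pow)
    also have "\<dots> \<le> D * (card \<Psi> + 1) ^ D" by (rule \<P>(2))
    also have "\<dots> \<le> D * (c * (N + 1)) ^ D" using card\<Psi> by (intro mult_le_mono2 power_mono) auto
    finally show ?thesis .
  qed
  \<comment> \<open>The bound \<open>1 / 2\<close> leaves the margin for a strict
    contradiction.\<close>
  have "eventually (\<lambda>N. real (D * c ^ D) * (real N + 1) ^ D * exp (- ln 2 * N) \<le> 1 / 2) sequentially"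
    by (intro eventually_polynomial_exp_le) auto
  then obtain N where N: "real (D * c ^ D) * (real N + 1) ^ D * exp (- ln 2 * N) \<le> 1 / 2"
    by (auto simp: eventually_sequentially)
  have "exp (- ln 2 * N) = 1 / (2::real) ^ N"
    by (simp add: exp_minus exp_of_nat_mult inverse_eq_divide mult.commute)
  then have "real (D * c ^ D) * (real N + 1) ^ D \<le> 1 / 2 * 2 ^ N"
    using N by (simp add: divide_le_eq)
  moreover have "real (2 ^ N) \<le> real (D * (c * (N + 1)) ^ D)" using count by (rule of_nat_mono)
  moreover have "real (D * (c * (N + 1)) ^ D) = real (D * c ^ D) * (real N + 1) ^ D"
    unfolding power_mult_distrib by (simp add: add.commute)
  moreover have "(0::real) < 2 ^ N" "real (2 ^ N) = 2 ^ N" by simp_all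
  ultimately show False by linarith
qed

lemma compact_G_system: "compact_G_system act (top_of_set B)"
  using compact action by (simp add: compact_G_system_def compact_space_subtopology)

lemma tame_system: "tame_system act (top_of_set B)"
  unfolding tame_system_def
proof (intro conjI allI impI notI compact_G_system)
  fix f assume "continuous_map (top_of_set B) euclideanreal f"
    and "\<exists>u. range u \<subseteq> {\<lambda>x. f (act g x) |g. True} \<and> independent_sequence (top_of_set B) u"
  then obtain u where f: "continuous_on B f" and u: "range u \<subseteq> {\<lambda>x. f (act g x) |g. True}"
    and ind: "independent_sequence (top_of_set B) u" by auto
  have "\<forall>i. \<exists>g. u i = (\<lambda>x. f (act g x))" using u by blast
  then obtain g where "\<And>i. u i = (\<lambda>x. f (act (g i) x))" by metis
  then show False using not_independent_orbit[OF f] ind by blast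
qed

end

theorem corollary5p7:
  fixes act :: "'g::topological_group_add \<Rightarrow> 'a::metric_space \<Rightarrow> 'a"
  assumes "median_space TYPE('a)"
    and "complete (UNIV :: 'a set)"
    and "median_rank TYPE('a) < \<infinity>"
    and "continuous_action act euclidean"
    and "\<And>g x y. dist (act g x) (act g y) = dist x y"
  shows "compact_G_system (rf_action act) rf_compactification \<and>
    rosenthal_representable (rf_action act) rf_compactification \<and>
    tame_system (rf_action act) rf_compactification"
proof -
  interpret isometric_action "TYPE('a)" act
    by unfold_locales (rule assms)+
  obtain n where "median_rank TYPE('a) = enat n"
    using assms(3) by (cases "median_rank TYPE('a)") auto
  \<comment> \<open>Finite rank is used in this form only: a common bound on the dimensions of all
    embedded cubes.\<close>
  then have "\<forall>k. cube_embeds k TYPE('a) \<longrightarrow> k \<le> n"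
    unfolding median_rank_def by (metis Sup_upper enat_ord_simps(1) image_eqI mem_Collect_eq)
  note rank = this
  interpret rosenthal_family rf_space rf_median_functions "rf_action act"
  proof
    show "compact (rf_space :: ('a \<times> 'a \<Rightarrow> 'a) set)"
      by (intro compact_rf_space compact_interval[OF rank assms(2)])
    show "\<exists>f\<in>rf_median_functions. f \<xi> \<noteq> f \<eta>"
      if "\<xi> \<in> rf_space" "\<eta> \<in> rf_space" "\<xi> \<noteq> \<eta>" for \<xi> \<eta> :: "'a \<times> 'a \<Rightarrow> 'a"
      using rf_median_functions_separate[OF rank that] .
    show "polynomial_covering rf_space rf_median_functions"
      by (rule polynomial_covering_rf[OF rank])
    show "continuous_action (rf_action act) (top_of_set rf_space)"
      using continuous_action_rf by (simp add: rf_compactification_eq)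
  qed (use uminus_rf_median_functions rf_median_functions_invariant in
      \<open>auto simp: rf_median_functions_def\<close>)
  show ?thesis
    unfolding rf_compactification_eq
    by (intro conjI compact_G_system rosenthal_representable tame_system)
qed

end
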